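(* Let $R$ be a commutative Noetherian ring, let $C$ be a semidualizing $R$-module, and let $M\in\mathcal A_C(R)$. Then $$C\text{-}\mathrm{qid}_R M<\infty\iff\mathrm{qid}_R(C\otimes_R M)<\infty.$$ Moreover: (1) $C\text{-}\mathrm{qid}_R M=\mathrm{qid}_R(C\otimes_R M)$. (2) A bounded complex $I_\bullet$ of injective $R$-modules is a $C$-quasi-injective resolution of $M$ if and only if it is a quasi-injective resolution of $C\otimes_R M$.
   Context: A finitely generated $R$-module $C$ is semidualizing if the homothety map $R\to\operatorname{Hom}_R(C,C)$ is an isomorphism and $\operatorname{Ext}^i_R(C,C)=0$ for all $i>0$. The Auslander class $\mathcal A_C(R)$ consists of the $R$-modules $M$ such that the natural map $M\to\operatorname{Hom}_R(C,C\otimes_R M)$ is an isomorphism and $\operatorname{Tor}^R_i(C,M)=0=\operatorname{Ext}^i_R(C,C\otimes_R M)$ for all $i>0$. For a complex $X_\bullet$ of $R$-modules (homological indexing, differential lowering degree), $\sup X_\bullet=\sup\{i: X_i\neq0\}$, $\inf X_\bullet=\inf\{i: X_i\neq0\}$ and $\operatorname{hinf}X_\bullet=\inf\{i:\mathrm H_i(X_\bullet)\neq0\}$. A quasi-injective resolution of an $R$-module $L$ is a bounded above complex $I_\bullet$ of injective $R$-modules such that for all $i\le\sup I_\bullet$ there are non-negative integers $b_i$, not all zero, with $\mathrm H_i(I_\bullet)\cong L^{\oplus b_i}$. The quasi-injective dimension $\mathrm{qid}_R L$ is the infimum of $\operatorname{hinf}I_\bullet-\inf I_\bullet$ over all bounded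 quasi-injective resolutions $I_\bullet$ of $L$ ($\infty$ if there are none), and it is $-\infty$ if $L=0$. A $C$-quasi-injective resolution of an $R$-module $L$ is a bounded complex $I_\bullet$ of injective $R$-modules such that $\operatorname{Hom}_R(C,I_\bullet)$ is not acyclic and each of its homology modules is zero or a finite direct sum of copies of $L$. The $C$-quasi-injective dimension $C\text{-}\mathrm{qid}_R L$ is the infimum of $\operatorname{hinf}\operatorname{Hom}_R(C,I_\bullet)-\inf\operatorname{Hom}_R(C,I_\bullet)$ over all $C$-quasi-injective resolutions $I_\bullet$ of $L$ ($\infty$ if there are none), and it is $-\infty$ if $L=0$. Convention: in (2) the modules are understood to be nonzero (for the zero module the dimensions are $-\infty$ and resolutions play no role). *)

theory Defs
  imports "HOL-Library.Extended_Real" "HOL-Algebra.Module" "HOL-Algebra.Ring_Divisibility"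
begin

text \<open>
  A module over the commutative ring \<open>R\<close> is a record \<open>M\<close> with \<open>module R M\<close>. That record type
  extends the one of rings; the fields \<open>mult\<close> and \<open>one\<close> of a module carry no information, and
  the constructions below leave them \<open>undefined\<close>.
\<close>

section \<open>Modules\<close>

definition mod_hom ::
  "('r, 'z) ring_scheme \<Rightarrow> ('r, 'a) module \<Rightarrow> ('r, 'b) module \<Rightarrow> ('a \<Rightarrow> 'b) set" where
  "mod_hom R M N = {f \<in> carrier M \<rightarrow> carrier N.
     (\<forall>x\<in>carrier M. \<forall>y\<in>carrier M. f (x \<oplus>\<^bsub>M\<^esub> y) = f x \<oplus>\<^bsub>N\<^esub> f y) \<and>
     (\<forall>r\<in>carrier R. \<forall>x\<in>carrier M. f (r \<odot>\<^bsub>M\<^esub> x) = r \<odot>\<^bsub>N\<^esub> f x)}"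

definition mod_iso ::
  "('r, 'z) ring_scheme \<Rightarrow> ('r, 'a) module \<Rightarrow> ('r, 'b) module \<Rightarrow> ('a \<Rightarrow> 'b) set" where
  "mod_iso R M N = {f \<in> mod_hom R M N. bij_betw f (carrier M) (carrier N)}"

definition isomorphic ::
  "('r, 'z) ring_scheme \<Rightarrow> ('r, 'a) module \<Rightarrow> ('r, 'b) module \<Rightarrow> bool" where
  "isomorphic R M N \<longleftrightarrow> mod_iso R M N \<noteq> {}"

definition zero_module :: "('r, 'a) module \<Rightarrow> bool" where
  "zero_module M \<longleftrightarrow> carrier M = {\<zero>\<^bsub>M\<^esub>}"

definition ring_module :: "('r, 'z) ring_scheme \<Rightarrow> ('r, 'r) module" where
  "ring_module R = \<lparr>carrier = carrier R, mult = undefined, one = undefined,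
     zero = \<zero>\<^bsub>R\<^esub>, add = add R, smult = mult R\<rparr>"

definition mod_span ::
  "('r, 'z) ring_scheme \<Rightarrow> ('r, 'a) module \<Rightarrow> 'a set \<Rightarrow> 'a set" where
  "mod_span R M A = \<Inter>{N. submodule N R M \<and> A \<subseteq> N}"

definition fin_gen :: "('r, 'z) ring_scheme \<Rightarrow> ('r, 'a) module \<Rightarrow> bool" where
  "fin_gen R M \<longleftrightarrow> (\<exists>A. finite A \<and> A \<subseteq> carrier M \<and> mod_span R M A = carrier M)"

definition quot_module :: "('r, 'a) module \<Rightarrow> 'a set \<Rightarrow> ('r, 'a set) module" where
  "quot_module M N = \<lparr>carrier = a_rcosets\<^bsub>M\<^esub> N, mult = undefined, one = undefined,
     zero = N, add = set_add M,
     smult = (\<lambda>r X. \<Union>x\<in>X. N +>\<^bsub>M\<^esub> (r \<odot>\<^bsub>M\<^esub> x))\<rparr>"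

definition power_module :: "('r, 'a) module \<Rightarrow> nat \<Rightarrow> ('r, nat \<Rightarrow> 'a) module" where
  "power_module M n = \<lparr>carrier = {..<n} \<rightarrow>\<^sub>E carrier M, mult = undefined, one = undefined,
     zero = (\<lambda>i\<in>{..<n}. \<zero>\<^bsub>M\<^esub>),
     add = (\<lambda>f g. \<lambda>i\<in>{..<n}. f i \<oplus>\<^bsub>M\<^esub> g i),
     smult = (\<lambda>r f. \<lambda>i\<in>{..<n}. r \<odot>\<^bsub>M\<^esub> f i)\<rparr>"

text \<open>Homomorphisms are taken extensional, so that equality in \<open>Hom_module\<close> is equality on \<open>carrier M\<close>.\<close>

definition Hom_module ::
  "('r, 'z) ring_scheme \<Rightarrow> ('r, 'a) module \<Rightarrow> ('r, 'b) module \<Rightarrow> ('r, 'a \<Rightarrow> 'b) module" where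
  "Hom_module R M N = \<lparr>carrier = mod_hom R M N \<inter> extensional (carrier M),
     mult = undefined, one = undefined,
     zero = (\<lambda>x\<in>carrier M. \<zero>\<^bsub>N\<^esub>),
     add = (\<lambda>f g. \<lambda>x\<in>carrier M. f x \<oplus>\<^bsub>N\<^esub> g x),
     smult = (\<lambda>r f. \<lambda>x\<in>carrier M. r \<odot>\<^bsub>N\<^esub> f x)\<rparr>"

definition free_module :: "('r, 'z) ring_scheme \<Rightarrow> 'x set \<Rightarrow> ('r, 'x \<Rightarrow> 'r) module" where
  "free_module R S = \<lparr>carrier = {u. range u \<subseteq> carrier R \<and> finite {x. u x \<noteq> \<zero>\<^bsub>R\<^esub>} \<and>
       {x. u x \<noteq> \<zero>\<^bsub>R\<^esub>} \<subseteq> S},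
     mult = undefined, one = undefined,
     zero = (\<lambda>x. \<zero>\<^bsub>R\<^esub>),
     add = (\<lambda>u v x. u x \<oplus>\<^bsub>R\<^esub> v x),
     smult = (\<lambda>r u x. r \<otimes>\<^bsub>R\<^esub> u x)\<rparr>"

definition free_gen :: "('r, 'z) ring_scheme \<Rightarrow> 'x \<Rightarrow> 'x \<Rightarrow> 'r" where
  "free_gen R x = (\<lambda>y. if y = x then \<one>\<^bsub>R\<^esub> else \<zero>\<^bsub>R\<^esub>)"

text \<open>
  Injectivity is the extension property along monomorphisms \<open>A \<rightarrow> B\<close>. HOL cannot quantify over all
  types of modules \<open>A\<close>, \<open>B\<close> inside a definition; they range over all modules carried by subsets of
  \<open>('r + 'i) list\<close>. This type contains copies of \<open>R\<close> and of its ideals, so by Baer's criterion the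
  extension property against modules of any type follows.
\<close>

definition injective_module :: "('r, 'z) ring_scheme \<Rightarrow> ('r, 'i) module \<Rightarrow> bool" where
  "injective_module R I \<longleftrightarrow> module R I \<and>
     (\<forall>(A :: ('r, ('r + 'i) list) module) (B :: ('r, ('r + 'i) list) module) f g.
        module R A \<longrightarrow> module R B \<longrightarrow> f \<in> mod_hom R A B \<longrightarrow> inj_on f (carrier A) \<longrightarrow>
        g \<in> mod_hom R A I \<longrightarrow>
        (\<exists>h\<in>mod_hom R B I. \<forall>a\<in>carrier A. h (f a) = g a))"

section \<open>Tensor products\<close>

definition tensor_rels ::
  "('r, 'z) ring_scheme \<Rightarrow> ('r, 'a) module \<Rightarrow> ('r, 'b) module \<Rightarrow> ('a \<times> 'b \<Rightarrow> 'r) set" where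
  "tensor_rels R A B =
    (let F = free_module R (carrier A \<times> carrier B); e = (\<lambda>a b. free_gen R (a, b)) in
      {e (a \<oplus>\<^bsub>A\<^esub> a') b \<ominus>\<^bsub>F\<^esub> (e a b \<oplus>\<^bsub>F\<^esub> e a' b) | a a' b.
         a \<in> carrier A \<and> a' \<in> carrier A \<and> b \<in> carrier B} \<union>
      {e a (b \<oplus>\<^bsub>B\<^esub> b') \<ominus>\<^bsub>F\<^esub> (e a b \<oplus>\<^bsub>F\<^esub> e a b') | a b b'.
         a \<in> carrier A \<and> b \<in> carrier B \<and> b' \<in> carrier B} \<union>
      {e (r \<odot>\<^bsub>A\<^esub> a) b \<ominus>\<^bsub>F\<^esub> (r \<odot>\<^bsub>F\<^esub> e a b) | r a b.
         r \<in> carrier R \<and> a \<in> carrier A \<and> b \<in> carrier B} \<union>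
      {e a (r \<odot>\<^bsub>B\<^esub> b) \<ominus>\<^bsub>F\<^esub> (r \<odot>\<^bsub>F\<^esub> e a b) | r a b.
         r \<in> carrier R \<and> a \<in> carrier A \<and> b \<in> carrier B})"

definition tensor_ker ::
  "('r, 'z) ring_scheme \<Rightarrow> ('r, 'a) module \<Rightarrow> ('r, 'b) module \<Rightarrow> ('a \<times> 'b \<Rightarrow> 'r) set" where
  "tensor_ker R A B =
     mod_span R (free_module R (carrier A \<times> carrier B)) (tensor_rels R A B)"

definition tensor ::
  "('r, 'z) ring_scheme \<Rightarrow> ('r, 'a) module \<Rightarrow> ('r, 'b) module \<Rightarrow>
     ('r, ('a \<times> 'b \<Rightarrow> 'r) set) module" where
  "tensor R A B =
     quot_module (free_module R (carrier A \<times> carrier B)) (tensor_ker R A B)"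

definition pure_tensor ::
  "('r, 'z) ring_scheme \<Rightarrow> ('r, 'a) module \<Rightarrow> ('r, 'b) module \<Rightarrow> 'a \<Rightarrow> 'b \<Rightarrow>
     ('a \<times> 'b \<Rightarrow> 'r) set" where
  "pure_tensor R A B a b =
     tensor_ker R A B +>\<^bsub>free_module R (carrier A \<times> carrier B)\<^esub> free_gen R (a, b)"

text \<open>The map induced on tensor products by homomorphisms \<open>f: A \<rightarrow> A'\<close> and \<open>g: B \<rightarrow> B'\<close>.\<close>

definition tensor_map ::
  "('r, 'z) ring_scheme \<Rightarrow> ('r, 'a) module \<Rightarrow> ('r, 'b) module \<Rightarrow>
     ('r, 'c) module \<Rightarrow> ('r, 'd) module \<Rightarrow> ('a \<Rightarrow> 'c) \<Rightarrow> ('b \<Rightarrow> 'd) \<Rightarrow>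
     ('a \<times> 'b \<Rightarrow> 'r) set \<Rightarrow> ('c \<times> 'd \<Rightarrow> 'r) set" where
  "tensor_map R A B A' B' f g =
     (THE h. h \<in> carrier (Hom_module R (tensor R A B) (tensor R A' B')) \<and>
        (\<forall>a\<in>carrier A. \<forall>b\<in>carrier B.
           h (pure_tensor R A B a b) = pure_tensor R A' B' (f a) (g b)))"

section \<open>Complexes\<close>

text \<open>Homological indexing: \<open>diff X i\<close> maps \<open>obj X i\<close> to \<open>obj X (i - 1)\<close>.\<close>

record ('r, 'i) cpx =
  obj :: "int \<Rightarrow> ('r, 'i) module"
  diff :: "int \<Rightarrow> 'i \<Rightarrow> 'i"

definition is_complex :: "('r, 'z) ring_scheme \<Rightarrow> ('r, 'i) cpx \<Rightarrow> bool" where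
  "is_complex R X \<longleftrightarrow> (\<forall>i. module R (obj X i) \<and>
     diff X i \<in> mod_hom R (obj X i) (obj X (i - 1)) \<and>
     (\<forall>x\<in>carrier (obj X i). diff X (i - 1) (diff X i x) = \<zero>\<^bsub>obj X (i - 2)\<^esub>))"

definition cycles :: "('r, 'i) cpx \<Rightarrow> int \<Rightarrow> 'i set" where
  "cycles X i = {x \<in> carrier (obj X i). diff X i x = \<zero>\<^bsub>obj X (i - 1)\<^esub>}"

definition boundaries :: "('r, 'i) cpx \<Rightarrow> int \<Rightarrow> 'i set" where
  "boundaries X i = diff X (i + 1) ` carrier (obj X (i + 1))"

definition homology :: "('r, 'i) cpx \<Rightarrow> int \<Rightarrow> ('r, 'i set) module" where
  "homology X i = quot_module ((obj X i)\<lparr>carrier := cycles X i\<rparr>) (boundaries X i)"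

definition acyclic_cpx :: "('r, 'i) cpx \<Rightarrow> bool" where
  "acyclic_cpx X \<longleftrightarrow> (\<forall>i. zero_module (homology X i))"

definition bounded_above :: "('r, 'i) cpx \<Rightarrow> bool" where
  "bounded_above X \<longleftrightarrow> (\<exists>n. \<forall>i>n. zero_module (obj X i))"

definition bounded_below :: "('r, 'i) cpx \<Rightarrow> bool" where
  "bounded_below X \<longleftrightarrow> (\<exists>n. \<forall>i<n. zero_module (obj X i))"

definition bounded_cpx :: "('r, 'i) cpx \<Rightarrow> bool" where
  "bounded_cpx X \<longleftrightarrow> bounded_above X \<and> bounded_below X"

definition injective_cpx :: "('r, 'z) ring_scheme \<Rightarrow> ('r, 'i) cpx \<Rightarrow> bool" where
  "injective_cpx R X \<longleftrightarrow> is_complex R X \<and> (\<forall>i. injective_module R (obj X i))"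

definition cpx_sup :: "('r, 'i) cpx \<Rightarrow> ereal" where
  "cpx_sup X = Sup {ereal (real_of_int i) | i. \<not> zero_module (obj X i)}"

definition cpx_inf :: "('r, 'i) cpx \<Rightarrow> ereal" where
  "cpx_inf X = Inf {ereal (real_of_int i) | i. \<not> zero_module (obj X i)}"

definition cpx_hinf :: "('r, 'i) cpx \<Rightarrow> ereal" where
  "cpx_hinf X = Inf {ereal (real_of_int i) | i. \<not> zero_module (homology X i)}"

text \<open>The complex \<open>Hom(A, X)\<close> for a module \<open>A\<close>, with differential the composition with that of \<open>X\<close>.\<close>

definition Hom_cpx ::
  "('r, 'z) ring_scheme \<Rightarrow> ('r, 'a) module \<Rightarrow> ('r, 'i) cpx \<Rightarrow> ('r, 'a \<Rightarrow> 'i) cpx" where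
  "Hom_cpx R A X = \<lparr>obj = (\<lambda>i. Hom_module R A (obj X i)),
     diff = (\<lambda>i f. compose (carrier A) (diff X i) f)\<rparr>"

text \<open>
  The complex \<open>Hom(X, N)\<close> for a module \<open>N\<close>: the cochains \<open>Hom(X\<^sub>n, N)\<close> of cohomological
  degree \<open>n\<close> sit in homological degree \<open>-n\<close>.
\<close>

definition Hom_cpx_into ::
  "('r, 'z) ring_scheme \<Rightarrow> ('r, 'i) cpx \<Rightarrow> ('r, 'b) module \<Rightarrow> ('r, 'i \<Rightarrow> 'b) cpx" where
  "Hom_cpx_into R X N = \<lparr>obj = (\<lambda>j. Hom_module R (obj X (- j)) N),
     diff = (\<lambda>j f. compose (carrier (obj X (1 - j))) f (diff X (1 - j)))\<rparr>"

definition tensor_cpx ::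
  "('r, 'z) ring_scheme \<Rightarrow> ('r, 'i) cpx \<Rightarrow> ('r, 'b) module \<Rightarrow>
     ('r, ('i \<times> 'b \<Rightarrow> 'r) set) cpx" where
  "tensor_cpx R X N = \<lparr>obj = (\<lambda>i. tensor R (obj X i) N),
     diff = (\<lambda>i. tensor_map R (obj X i) N (obj X (i - 1)) N (diff X i) (\<lambda>x. x))\<rparr>"

section \<open>Ext and Tor\<close>

text \<open>
  A module \<open>A\<close> with elements in \<open>'a\<close> and all its successive syzygies have generating sets that embed
  into the type \<open>('r + 'a) list\<close>, by cardinality. Hence every \<open>A\<close> has a free resolution whose terms
  are free on subsets of this type. Ext and Tor do not depend, up to isomorphism, on the chosen one.
\<close>

definition free_resolution ::
  "('r, 'z) ring_scheme \<Rightarrow> ('r, 'a) module \<Rightarrow> ('r, 'x \<Rightarrow> 'r) cpx \<Rightarrow> (('x \<Rightarrow> 'r) \<Rightarrow> 'a) \<Rightarrow> bool" where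
  "free_resolution R A F \<epsilon> \<longleftrightarrow> is_complex R F \<and>
     (\<forall>n. \<exists>S. obj F n = free_module R S) \<and>
     (\<forall>n<0. zero_module (obj F n)) \<and>
     (\<forall>n>0. zero_module (homology F n)) \<and>
     \<epsilon> \<in> mod_hom R (obj F 0) A \<and> \<epsilon> ` carrier (obj F 0) = carrier A \<and>
     {x \<in> carrier (obj F 0). \<epsilon> x = \<zero>\<^bsub>A\<^esub>} = boundaries F 0"

definition chosen_resolution ::
  "('r, 'z) ring_scheme \<Rightarrow> ('r, 'a) module \<Rightarrow> ('r, ('r + 'a) list \<Rightarrow> 'r) cpx" where
  "chosen_resolution R A = (SOME F. \<exists>\<epsilon>. free_resolution R A F \<epsilon>)"

definition Ext ::
  "('r, 'z) ring_scheme \<Rightarrow> nat \<Rightarrow> ('r, 'a) module \<Rightarrow> ('r, 'b) module \<Rightarrow>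
     ('r, ((('r + 'a) list \<Rightarrow> 'r) \<Rightarrow> 'b) set) module" where
  "Ext R n A N = homology (Hom_cpx_into R (chosen_resolution R A) N) (- int n)"

definition Tor ::
  "('r, 'z) ring_scheme \<Rightarrow> nat \<Rightarrow> ('r, 'a) module \<Rightarrow> ('r, 'b) module \<Rightarrow>
     ('r, ((('r + 'a) list \<Rightarrow> 'r) \<times> 'b \<Rightarrow> 'r) set set) module" where
  "Tor R n A N = homology (tensor_cpx R (chosen_resolution R A) N) (int n)"

section \<open>Semidualizing modules and the Auslander class\<close>

definition homothety ::
  "('r, 'z) ring_scheme \<Rightarrow> ('r, 'c) module \<Rightarrow> 'r \<Rightarrow> 'c \<Rightarrow> 'c" where
  "homothety R C = (\<lambda>r. \<lambda>c\<in>carrier C. r \<odot>\<^bsub>C\<^esub> c)"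

definition semidualizing :: "('r, 'z) ring_scheme \<Rightarrow> ('r, 'c) module \<Rightarrow> bool" where
  "semidualizing R C \<longleftrightarrow> module R C \<and> fin_gen R C \<and>
     homothety R C \<in> mod_iso R (ring_module R) (Hom_module R C C) \<and>
     (\<forall>i>0. zero_module (Ext R i C C))"

definition tensor_unit ::
  "('r, 'z) ring_scheme \<Rightarrow> ('r, 'c) module \<Rightarrow> ('r, 'm) module \<Rightarrow> 'm \<Rightarrow> 'c \<Rightarrow>
     ('c \<times> 'm \<Rightarrow> 'r) set" where
  "tensor_unit R C M = (\<lambda>m. \<lambda>c\<in>carrier C. pure_tensor R C M c m)"

definition auslander_class :: "('r, 'z) ring_scheme \<Rightarrow> ('r, 'c) module \<Rightarrow> ('r, 'm) module set" where
  "auslander_class R C = {M. module R M \<and>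
     tensor_unit R C M \<in> mod_iso R M (Hom_module R C (tensor R C M)) \<and>
     (\<forall>i>0. zero_module (Tor R i C M)) \<and>
     (\<forall>i>0. zero_module (Ext R i C (tensor R C M)))}"

section \<open>Quasi-injective dimensions\<close>

definition qi_resolution ::
  "('r, 'z) ring_scheme \<Rightarrow> ('r, 'l) module \<Rightarrow> ('r, 'i) cpx \<Rightarrow> bool" where
  "qi_resolution R L I \<longleftrightarrow> injective_cpx R I \<and> bounded_above I \<and>
     (\<exists>b :: int \<Rightarrow> nat.
        (\<exists>i. ereal (real_of_int i) \<le> cpx_sup I \<and> b i \<noteq> 0) \<and>
        (\<forall>i. ereal (real_of_int i) \<le> cpx_sup I \<longrightarrow>
           isomorphic R (homology I i) (power_module L (b i))))"

definition C_qi_resolution ::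
  "('r, 'z) ring_scheme \<Rightarrow> ('r, 'c) module \<Rightarrow> ('r, 'l) module \<Rightarrow> ('r, 'i) cpx \<Rightarrow> bool" where
  "C_qi_resolution R C L I \<longleftrightarrow> injective_cpx R I \<and> bounded_cpx I \<and>
     \<not> acyclic_cpx (Hom_cpx R C I) \<and>
     (\<forall>i. zero_module (homology (Hom_cpx R C I) i) \<or>
        (\<exists>n. isomorphic R (homology (Hom_cpx R C I) i) (power_module L n)))"

text \<open>
  The type argument is the universe of the resolutions: the infima range over complexes of modules
  carried by subsets of \<open>'i\<close>. Over a Noetherian ring \<open>qid\<close> no longer depends on \<open>'i\<close> once \<open>'i\<close> is
  infinite and at least as large as \<open>R\<close> and \<open>L\<close>, since a bounded complex of injectives has its minimal
  complex, whose terms are of at most that size, as a direct summand. An infimum over an empty set is \<open>\<infinity>\<close> in \<^typ>\<open>ereal\<close>.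
\<close>

definition qid ::
  "'i itself \<Rightarrow> ('r, 'z) ring_scheme \<Rightarrow> ('r, 'l) module \<Rightarrow> ereal" where
  "qid _ R L = (if zero_module L then - \<infinity>
     else Inf {cpx_hinf I - cpx_inf I | I :: ('r, 'i) cpx. qi_resolution R L I \<and> bounded_cpx I})"

definition C_qid ::
  "'i itself \<Rightarrow> ('r, 'z) ring_scheme \<Rightarrow> ('r, 'c) module \<Rightarrow> ('r, 'l) module \<Rightarrow> ereal" where
  "C_qid _ R C L = (if zero_module L then - \<infinity>
     else Inf {cpx_hinf (Hom_cpx R C I) - cpx_inf (Hom_cpx R C I) | I :: ('r, 'i) cpx.
       C_qi_resolution R C L I})"

end

theory Submission
  imports Defs
begin

text \<open>
  Fix a resolution \<open>G\<close> of \<open>C\<close> by finite free modules. Since \<open>C\<close> is semidualizing,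
  \<open>0 \<rightarrow> R \<rightarrow> Hom(G\<^sub>0, C) \<rightarrow> Hom(G\<^sub>1, C) \<rightarrow> \<dots>\<close> is exact. Call \<open>N\<close> dual exact if \<open>Hom(-, N)\<close> keeps
  this sequence exact. Injective modules are dual exact; so is \<open>C \<otimes> M\<close> for \<open>M\<close> in the Auslander
  class, because \<open>Hom(Hom(G\<^sub>n, C), C \<otimes> M)\<close> is \<open>G\<^sub>n \<otimes> M\<close>. Kernels of surjections \<open>N \<rightarrow> N'\<close> of
  dual exact modules that stay surjective under \<open>Hom(C, -)\<close> are again dual exact, and a linear map
  \<open>Hom(C, N) \<rightarrow> Hom(C, N')\<close> is induced by a map \<open>N \<rightarrow> N'\<close> if \<open>N\<close> is dual exact.

  Let \<open>I\<close> be a bounded complex of injectives. If the homology modules of \<open>Hom(C, I)\<close> are powers of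
  \<open>M\<close>, then upwards from the lowest degree the cycles of \<open>I\<close> are dual exact and the maps
  \<open>Hom(C, Z\<^sub>i) \<rightarrow> M\<^sup>b = Hom(C, (C \<otimes> M)\<^sup>b)\<close> induce isomorphisms \<open>H\<^sub>i(I) = (C \<otimes> M)\<^sup>b\<close>. Conversely, if
  the homology modules of \<open>I\<close> are powers of \<open>C \<otimes> M\<close>, then downwards from the highest degree the
  cycles and boundaries of \<open>I\<close> have no higher \<open>Ext(C, -)\<close>, so that \<open>Hom(C, -)\<close> commutes with homology.
  Finally \<open>Hom(C, E) = 0\<close> only if \<open>E = 0\<close>, for \<open>E\<close> injective, so \<open>I\<close> and \<open>Hom(C, I)\<close> have the same
  infima.
\<close>

section \<open>Modules and homomorphisms\<close>

text \<open>Classically this is Foxby equivalence: injective modules lie in the Bass class, and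
  \<open>C \<otimes> -\<close> and \<open>Hom(C, -)\<close> are inverse to each other on the
  Auslander and Bass classes. Dual exactness stands in for the Bass class and speaks of
  \<open>Hom(-, N)\<close> only, so that no tensor product has to be carried along kernels. It
  passes to kernels for one reason: \<open>Hom(G_n, C)\<close> is a finite power of
  \<open>C\<close>, so a map that is onto under \<open>Hom(C, -)\<close> is onto under
  \<open>Hom(Hom(G_n, C), -)\<close>, and the long exact sequence applies. A dual exact
  \<open>N\<close> is the cokernel of
  \<open>Hom(Hom(G_1, C), N) \<rightarrow> Hom(Hom(G_0, C), N)\<close>, both terms being powers of
  \<open>Hom(C, N)\<close>; this produces the induced maps. Finite bases are essential for that,
  whereas Ext and Tor are defined by an unspecified free resolution, so their vanishing is first
  moved to \<open>G\<close> by a homotopy. The two inductions run in opposite directions because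
  dual exactness passes to kernels and vanishing of Ext to cokernels; boundedness supplies the zero
  modules at which each starts.\<close>

lemma module_zero_closed: "module R M \<Longrightarrow> \<zero>\<^bsub>M\<^esub> \<in> carrier M"
  by (simp add: module_def abelian_group_def abelian_monoid.zero_closed)

lemma module_minus_eq_zero_iff:
  assumes "module R M" "x \<in> carrier M" "y \<in> carrier M"
  shows "x \<ominus>\<^bsub>M\<^esub> y = \<zero>\<^bsub>M\<^esub> \<longleftrightarrow> x = y"
proof -
  interpret M: module R M by fact
  show ?thesis
    using assms M.minus_equality[of x "\<ominus>\<^bsub>M\<^esub> y"]
    by (auto simp: a_minus_def M.r_neg M.minus_minus)
qed

lemma module_minus_zero:
  assumes "module R M" "x \<in> carrier M"
  shows "x \<ominus>\<^bsub>M\<^esub> \<zero>\<^bsub>M\<^esub> = x"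
proof -
  interpret M: module R M by fact
  show ?thesis using assms by (simp add: a_minus_def M.add.inv_one)
qed

lemma mod_homI:
  assumes "\<And>x. x \<in> carrier M \<Longrightarrow> f x \<in> carrier N"
    and "\<And>x y. x \<in> carrier M \<Longrightarrow> y \<in> carrier M \<Longrightarrow> f (x \<oplus>\<^bsub>M\<^esub> y) = f x \<oplus>\<^bsub>N\<^esub> f y"
    and "\<And>r x. r \<in> carrier R \<Longrightarrow> x \<in> carrier M \<Longrightarrow> f (r \<odot>\<^bsub>M\<^esub> x) = r \<odot>\<^bsub>N\<^esub> f x"
  shows "f \<in> mod_hom R M N"
  using assms by (auto simp: mod_hom_def)

lemma mod_hom_closed: "f \<in> mod_hom R M N \<Longrightarrow> x \<in> carrier M \<Longrightarrow> f x \<in> carrier N"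
  by (auto simp: mod_hom_def)

lemma mod_hom_add:
  "f \<in> mod_hom R M N \<Longrightarrow> x \<in> carrier M \<Longrightarrow> y \<in> carrier M \<Longrightarrow> f (x \<oplus>\<^bsub>M\<^esub> y) = f x \<oplus>\<^bsub>N\<^esub> f y"
  by (auto simp: mod_hom_def)

lemma mod_hom_smult:
  "f \<in> mod_hom R M N \<Longrightarrow> r \<in> carrier R \<Longrightarrow> x \<in> carrier M \<Longrightarrow> f (r \<odot>\<^bsub>M\<^esub> x) = r \<odot>\<^bsub>N\<^esub> f x"
  by (auto simp: mod_hom_def)

lemma mod_hom_zero:
  assumes "module R M" "module R N" "f \<in> mod_hom R M N"
  shows "f \<zero>\<^bsub>M\<^esub> = \<zero>\<^bsub>N\<^esub>"
proof -
  interpret M: module R M by fact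
  interpret N: module R N by fact
  have "f \<zero>\<^bsub>M\<^esub> = f (\<zero>\<^bsub>R\<^esub> \<odot>\<^bsub>M\<^esub> \<zero>\<^bsub>M\<^esub>)" by simp
  also have "\<dots> = \<zero>\<^bsub>R\<^esub> \<odot>\<^bsub>N\<^esub> f \<zero>\<^bsub>M\<^esub>"
    using assms(3) by (intro mod_hom_smult) auto
  also have "\<dots> = \<zero>\<^bsub>N\<^esub>" using assms(3) by (simp add: mod_hom_closed)
  finally show ?thesis .
qed

lemma mod_hom_neg:
  assumes "module R M" "module R N" "f \<in> mod_hom R M N" "x \<in> carrier M"
  shows "f (\<ominus>\<^bsub>M\<^esub> x) = \<ominus>\<^bsub>N\<^esub> f x"
proof -
  interpret M: module R M by fact
  interpret N: module R N by fact
  have "f (\<ominus>\<^bsub>M\<^esub> x) \<oplus>\<^bsub>N\<^esub> f x = f (\<ominus>\<^bsub>M\<^esub> x \<oplus>\<^bsub>M\<^esub> x)"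
    using assms by (simp add: mod_hom_add)
  also have "\<dots> = \<zero>\<^bsub>N\<^esub>" using assms by (simp add: M.l_neg mod_hom_zero)
  finally show ?thesis
    using assms by (simp add: N.minus_equality[symmetric] mod_hom_closed)
qed

lemma mod_hom_minus:
  assumes "module R M" "module R N" "f \<in> mod_hom R M N" "x \<in> carrier M" "y \<in> carrier M"
  shows "f (x \<ominus>\<^bsub>M\<^esub> y) = f x \<ominus>\<^bsub>N\<^esub> f y"
proof -
  interpret M: module R M by fact
  show ?thesis
    using assms by (simp add: a_minus_def mod_hom_add mod_hom_neg)
qed

lemma mod_hom_comp:
  assumes "f \<in> mod_hom R A B" "g \<in> mod_hom R B D"
  shows "(\<lambda>x. g (f x)) \<in> mod_hom R A D"
  using assms by (auto simp: mod_hom_def Pi_iff)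

lemma mod_hom_cong:
  assumes "module R M" "f \<in> mod_hom R M N" "\<And>x. x \<in> carrier M \<Longrightarrow> g x = f x"
  shows "g \<in> mod_hom R M N"
proof -
  interpret M: module R M by fact
  show ?thesis using assms(2,3)
    by (intro mod_homI) (simp_all add: mod_hom_closed mod_hom_add mod_hom_smult)
qed

lemma mod_hom_id: "(\<lambda>x. x) \<in> mod_hom R M M"
  by (auto simp: mod_hom_def)

lemma mod_hom_const_zero:
  assumes "module R N"
  shows "(\<lambda>x. \<zero>\<^bsub>N\<^esub>) \<in> mod_hom R M N"
proof -
  interpret N: module R N by fact
  show ?thesis by (rule mod_homI) auto
qed

lemma mod_hom_plus:
  assumes "module R N" "f \<in> mod_hom R M N" "g \<in> mod_hom R M N"
  shows "(\<lambda>x. f x \<oplus>\<^bsub>N\<^esub> g x) \<in> mod_hom R M N"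
proof -
  interpret N: module R N by fact
  show ?thesis using assms(2,3)
    by (intro mod_homI)
      (simp_all add: mod_hom_closed mod_hom_add mod_hom_smult N.smult_r_distr N.a_ac)
qed

lemma mod_hom_scale:
  assumes "module R N" "f \<in> mod_hom R M N" "r \<in> carrier R"
  shows "(\<lambda>x. r \<odot>\<^bsub>N\<^esub> f x) \<in> mod_hom R M N"
proof -
  interpret N: module R N by fact
  show ?thesis using assms(2,3)
    by (intro mod_homI)
      (simp_all add: mod_hom_closed mod_hom_add mod_hom_smult N.smult_r_distr N.m_comm
        N.smult_assoc1[symmetric])
qed

lemma mod_hom_diff:
  assumes "module R N" "f \<in> mod_hom R M N" "g \<in> mod_hom R M N"
  shows "(\<lambda>x. f x \<ominus>\<^bsub>N\<^esub> g x) \<in> mod_hom R M N"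
proof -
  interpret N: module R N by fact
  show ?thesis using assms(2,3)
    by (intro mod_homI)
      (simp_all add: mod_hom_closed mod_hom_add mod_hom_smult a_minus_def N.smult_r_distr N.a_ac
        N.minus_add N.smult_r_minus)
qed

lemma mod_hom_into_sub:
  assumes "f \<in> mod_hom R A N" "\<And>x. x \<in> carrier A \<Longrightarrow> f x \<in> H"
  shows "f \<in> mod_hom R A (N\<lparr>carrier := H\<rparr>)"
  using assms by (auto simp: mod_hom_def)

lemma mod_hom_from_into_sub:
  assumes "f \<in> mod_hom R A (N\<lparr>carrier := H\<rparr>)" "H \<subseteq> carrier N"
  shows "f \<in> mod_hom R A N"
  using assms by (auto simp: mod_hom_def)

lemma mod_hom_restrict_dom:
  assumes "f \<in> mod_hom R M N" "H \<subseteq> carrier M"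
  shows "f \<in> mod_hom R (M\<lparr>carrier := H\<rparr>) N"
  using assms by (auto simp: mod_hom_def subset_eq)

section \<open>Submodules: kernels, images, equalizers and spans\<close>

lemma submodule_subset: "submodule H R M \<Longrightarrow> H \<subseteq> carrier M"
  by (simp add: submodule_def subgroup_def)

lemma submodule_module: "submodule H R M \<Longrightarrow> module R M \<Longrightarrow> module R (M\<lparr>carrier := H\<rparr>)"
  by (rule submodule.submodule_is_module)

lemma submodule_preimage:
  assumes "module R M" "module R N" "f \<in> mod_hom R M N" "submodule H R N"
  shows "submodule {x \<in> carrier M. f x \<in> H} R M"
proof -
  interpret M: module R M by fact
  interpret N: module R N by fact
  have z: "\<zero>\<^bsub>N\<^esub> \<in> H"
    using assms(4) subgroup.one_closed by (fastforce simp: submodule_def)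
  show ?thesis
    by (rule M.submoduleI)
      (use z N.submoduleE[OF assms(4)] assms in
        \<open>auto simp: mod_hom_zero mod_hom_neg mod_hom_add mod_hom_smult\<close>)
qed

lemma submodule_zero:
  assumes "module R M" shows "submodule {\<zero>\<^bsub>M\<^esub>} R M"
proof -
  interpret M: module R M by fact
  show ?thesis by (rule M.submoduleI) auto
qed

lemma submodule_kernel:
  assumes "module R M" "module R N" "f \<in> mod_hom R M N"
  shows "submodule {x \<in> carrier M. f x = \<zero>\<^bsub>N\<^esub>} R M"
  using submodule_preimage[OF assms submodule_zero[OF assms(2)]] by simp

lemma submodule_image:
  assumes "module R M" "module R N" "f \<in> mod_hom R M N"
  shows "submodule (f ` carrier M) R N"
proof -
  interpret M: module R M by fact
  interpret N: module R N by fact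
  show ?thesis
  proof (rule N.submoduleI)
    show "f ` carrier M \<subseteq> carrier N" using assms(3) by (auto simp: mod_hom_closed)
    show "\<zero>\<^bsub>N\<^esub> \<in> f ` carrier M"
      using mod_hom_zero[OF assms] by (metis M.zero_closed imageI)
    show "\<ominus>\<^bsub>N\<^esub> a \<in> f ` carrier M" if "a \<in> f ` carrier M" for a
      using that mod_hom_neg[OF assms] by (metis (no_types, lifting) M.a_inv_closed image_iff)
    show "a \<oplus>\<^bsub>N\<^esub> b \<in> f ` carrier M" if "a \<in> f ` carrier M" "b \<in> f ` carrier M" for a b
      using that mod_hom_add[OF assms(3)] by (metis (no_types, lifting) M.a_closed image_iff)
    show "a \<odot>\<^bsub>N\<^esub> x \<in> f ` carrier M" if "a \<in> carrier R" "x \<in> f ` carrier M" for a x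
      using that mod_hom_smult[OF assms(3)] by (metis (no_types, lifting) M.smult_closed image_iff)
  qed
qed

lemma submodule_zero_mem: "submodule H R M \<Longrightarrow> \<zero>\<^bsub>M\<^esub> \<in> H"
  using subgroup.one_closed by (fastforce simp: submodule_def)

lemma submodule_equalizer:
  assumes "module R M" "module R N" "f \<in> mod_hom R M N" "g \<in> mod_hom R M N"
  shows "submodule {x \<in> carrier M. f x = g x} R M"
proof -
  interpret M: module R M by fact
  interpret N: module R N by fact
  show ?thesis
    by (rule M.submoduleI)
      (use assms in \<open>auto simp: mod_hom_zero[of R M N] mod_hom_neg[of R M N]
        mod_hom_add[of _ R M N] mod_hom_smult[of _ R M N]\<close>)
qed

lemma mod_span_subset: "submodule N R M \<Longrightarrow> A \<subseteq> N \<Longrightarrow> mod_span R M A \<subseteq> N"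
  by (auto simp: mod_span_def)

lemma mod_span_base: "A \<subseteq> mod_span R M A"
  by (auto simp: mod_span_def)

lemma submodule_mod_span:
  assumes "module R M" "A \<subseteq> carrier M"
  shows "submodule (mod_span R M A) R M"
proof -
  interpret M: module R M by fact
  have c: "submodule (carrier M) R M" by (rule M.carrier_is_submodule)
  show ?thesis
  proof (rule M.submoduleI)
    show "mod_span R M A \<subseteq> carrier M" using mod_span_subset[OF c assms(2)] .
  qed (auto simp: mod_span_def submodule_zero_mem M.submoduleE)
qed

text \<open>The module axioms are equations, so they pass to the image of any map that respects the
  operations; \<open>Q\<close> need not be known to be a module beforehand. This yields quotient
  modules and, later, a copy of \<open>R\<close> inside a list type.\<close>

lemma module_of_surjection:
  assumes "module R M" "\<pi> ` carrier M = carrier Q" "\<pi> \<zero>\<^bsub>M\<^esub> = \<zero>\<^bsub>Q\<^esub>"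
    and add: "\<And>x y. x \<in> carrier M \<Longrightarrow> y \<in> carrier M \<Longrightarrow> \<pi> (x \<oplus>\<^bsub>M\<^esub> y) = \<pi> x \<oplus>\<^bsub>Q\<^esub> \<pi> y"
    and smult: "\<And>r x. r \<in> carrier R \<Longrightarrow> x \<in> carrier M \<Longrightarrow> \<pi> (r \<odot>\<^bsub>M\<^esub> x) = r \<odot>\<^bsub>Q\<^esub> \<pi> x"
  shows "module R Q" "\<pi> \<in> mod_hom R M Q"
proof -
  interpret M: module R M by fact
  have im: "\<exists>y\<in>carrier M. x = \<pi> y" if "x \<in> carrier Q" for x
    using that assms(2) by auto
  have cl: "\<pi> x \<in> carrier Q" if "x \<in> carrier M" for x
    using that assms(2) by auto
  show "\<pi> \<in> mod_hom R M Q"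
    by (rule mod_homI) (auto simp: cl add smult)
  have ab: "abelian_group Q"
  proof (rule abelian_groupI)
    show "\<exists>y\<in>carrier Q. y \<oplus>\<^bsub>Q\<^esub> x = \<zero>\<^bsub>Q\<^esub>" if x: "x \<in> carrier Q" for x
    proof -
      obtain u where u: "u \<in> carrier M" "x = \<pi> u" using im[OF x] by blast
      have "\<pi> (\<ominus>\<^bsub>M\<^esub> u) \<oplus>\<^bsub>Q\<^esub> x = \<zero>\<^bsub>Q\<^esub>"
        using u assms(3) by (simp add: add[symmetric] M.l_neg)
      thus ?thesis using cl u by blast
    qed
    show "x \<oplus>\<^bsub>Q\<^esub> y \<oplus>\<^bsub>Q\<^esub> z = x \<oplus>\<^bsub>Q\<^esub> (y \<oplus>\<^bsub>Q\<^esub> z)"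
      if "x \<in> carrier Q" "y \<in> carrier Q" "z \<in> carrier Q" for x y z
      using im[OF that(1)] im[OF that(2)] im[OF that(3)] by (auto simp: add[symmetric] M.a_assoc)
    show "x \<oplus>\<^bsub>Q\<^esub> y = y \<oplus>\<^bsub>Q\<^esub> x" if "x \<in> carrier Q" "y \<in> carrier Q" for x y
      using im[OF that(1)] im[OF that(2)] by (auto simp: add[symmetric] M.a_comm)
    show "x \<oplus>\<^bsub>Q\<^esub> y \<in> carrier Q" if "x \<in> carrier Q" "y \<in> carrier Q" for x y
      using im[OF that(1)] im[OF that(2)] by (auto simp: add[symmetric] cl)
    show "\<zero>\<^bsub>Q\<^esub> \<in> carrier Q" using cl[OF M.zero_closed] assms(3) by simp
    show "\<zero>\<^bsub>Q\<^esub> \<oplus>\<^bsub>Q\<^esub> x = x" if "x \<in> carrier Q" for x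
      using im[OF that] by (auto simp: add[symmetric] assms(3)[symmetric])
  qed
  show "module R Q"
  proof (rule moduleI[OF M.is_cring ab])
    fix a b x y assume r: "a \<in> carrier R" "b \<in> carrier R" and "x \<in> carrier Q" "y \<in> carrier Q"
    then obtain u v where u: "u \<in> carrier M" "x = \<pi> u" "v \<in> carrier M" "y = \<pi> v"
      using im by blast
    show "a \<odot>\<^bsub>Q\<^esub> (x \<oplus>\<^bsub>Q\<^esub> y) = a \<odot>\<^bsub>Q\<^esub> x \<oplus>\<^bsub>Q\<^esub> a \<odot>\<^bsub>Q\<^esub> y"
      using u r by (simp add: add[symmetric] smult[symmetric] M.smult_r_distr)
  next
    fix a b x assume r: "a \<in> carrier R" "b \<in> carrier R" and "x \<in> carrier Q"
    then obtain u where u: "u \<in> carrier M" "x = \<pi> u"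
      using im by blast
    show "a \<odot>\<^bsub>Q\<^esub> x \<in> carrier Q" using u r by (simp add: smult[symmetric] cl)
    show "(a \<oplus>\<^bsub>R\<^esub> b) \<odot>\<^bsub>Q\<^esub> x = a \<odot>\<^bsub>Q\<^esub> x \<oplus>\<^bsub>Q\<^esub> b \<odot>\<^bsub>Q\<^esub> x"
      using u r by (simp add: add[symmetric] smult[symmetric] M.smult_l_distr)
    show "(a \<otimes>\<^bsub>R\<^esub> b) \<odot>\<^bsub>Q\<^esub> x = a \<odot>\<^bsub>Q\<^esub> (b \<odot>\<^bsub>Q\<^esub> x)"
      using u r by (simp add: smult[symmetric] M.smult_assoc1)
  next
    fix x assume "x \<in> carrier Q"
    then obtain u where u: "u \<in> carrier M" "x = \<pi> u"
      using im by blast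
    show "\<one>\<^bsub>R\<^esub> \<odot>\<^bsub>Q\<^esub> x = x" using u by (simp add: smult[symmetric])
  qed
qed

text \<open>The homomorphism theorem for an arbitrary surjection \<open>\<pi>\<close> in place of a
  quotient by cosets. Preimages are chosen with \<open>SOME\<close>; two of them differ by an
  element of the kernel of \<open>\<pi>\<close>, where \<open>f\<close> vanishes.\<close>

lemma mod_hom_factor:
  assumes "module R M" "module R P" "\<pi> \<in> mod_hom R M Q" "module R Q"
    and surj: "carrier Q \<subseteq> \<pi> ` carrier M" and f: "f \<in> mod_hom R M P"
    and ker: "\<And>x. x \<in> carrier M \<Longrightarrow> \<pi> x = \<zero>\<^bsub>Q\<^esub> \<Longrightarrow> f x = \<zero>\<^bsub>P\<^esub>"
  obtains g where "g \<in> mod_hom R Q P" "\<And>x. x \<in> carrier M \<Longrightarrow> g (\<pi> x) = f x"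
proof -
  interpret M: module R M by fact
  interpret P: module R P by fact
  interpret Q: module R Q by fact
  define s where "s q = (SOME x. x \<in> carrier M \<and> \<pi> x = q)" for q
  have s: "s q \<in> carrier M" "\<pi> (s q) = q" if "q \<in> carrier Q" for q
  proof -
    have "\<exists>x. x \<in> carrier M \<and> \<pi> x = q" using surj that by auto
    from someI_ex[OF this] show "s q \<in> carrier M" "\<pi> (s q) = q" by (auto simp: s_def)
  qed
  have eq: "f (s (\<pi> x)) = f x" if x: "x \<in> carrier M" for x
  proof -
    have q: "\<pi> x \<in> carrier Q" using assms(3) x by (rule mod_hom_closed)
    have "\<pi> (s (\<pi> x) \<ominus>\<^bsub>M\<^esub> x) = \<zero>\<^bsub>Q\<^esub>"
      using mod_hom_minus[OF assms(1,4,3) s(1)[OF q] x] s[OF q] q by (simp add: Q.r_neg a_minus_def)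
    hence "f (s (\<pi> x) \<ominus>\<^bsub>M\<^esub> x) = \<zero>\<^bsub>P\<^esub>" using ker s[OF q] x by simp
    hence "f (s (\<pi> x)) \<ominus>\<^bsub>P\<^esub> f x = \<zero>\<^bsub>P\<^esub>"
      using mod_hom_minus[OF assms(1,2) f s(1)[OF q] x] by simp
    thus ?thesis using s[OF q] x f by (simp add: mod_hom_closed module_minus_eq_zero_iff[OF assms(2)])
  qed
  have "(\<lambda>q. f (s q)) \<in> mod_hom R Q P"
  proof (rule mod_homI)
    fix x assume x: "x \<in> carrier Q"
    show "f (s x) \<in> carrier P" using s[OF x] f by (simp add: mod_hom_closed)
    fix y assume y: "y \<in> carrier Q"
    have "x \<oplus>\<^bsub>Q\<^esub> y = \<pi> (s x \<oplus>\<^bsub>M\<^esub> s y)"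
      using s x y assms(3) by (simp add: mod_hom_add)
    thus "f (s (x \<oplus>\<^bsub>Q\<^esub> y)) = f (s x) \<oplus>\<^bsub>P\<^esub> f (s y)"
      using s x y f by (simp add: eq mod_hom_add)
  next
    fix r x assume r: "r \<in> carrier R" and x: "x \<in> carrier Q"
    have "r \<odot>\<^bsub>Q\<^esub> x = \<pi> (r \<odot>\<^bsub>M\<^esub> s x)"
      using s x r assms(3) by (simp add: mod_hom_smult)
    thus "f (s (r \<odot>\<^bsub>Q\<^esub> x)) = r \<odot>\<^bsub>P\<^esub> f (s x)"
      using s x r f by (simp add: eq mod_hom_smult)
  qed
  thus ?thesis using that eq by blast
qed

lemma a_coset_eq_iff:
  assumes "module R M" "submodule N R M" "x \<in> carrier M" "y \<in> carrier M"
  shows "N +>\<^bsub>M\<^esub> x = N +>\<^bsub>M\<^esub> y \<longleftrightarrow> x \<ominus>\<^bsub>M\<^esub> y \<in> N"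
proof -
  interpret M: module R M by fact
  have N: "subgroup N (add_monoid M)" using assms(2) by (simp add: submodule_def)
  have sub: "N \<subseteq> carrier M" using assms(2) by (rule submodule_subset)
  show ?thesis
  proof
    assume "N +>\<^bsub>M\<^esub> x = N +>\<^bsub>M\<^esub> y"
    hence "x \<in> N +>\<^bsub>M\<^esub> y"
      using M.a_rcosI[OF submodule_zero_mem[OF assms(2)] sub assms(3)] assms(3) by simp
    then obtain n where "n \<in> N" "x = n \<oplus>\<^bsub>M\<^esub> y" by (auto simp: a_r_coset_def')
    thus "x \<ominus>\<^bsub>M\<^esub> y \<in> N"
      using sub assms(4) by (auto simp: a_minus_def M.a_assoc M.r_neg)
  next
    assume "x \<ominus>\<^bsub>M\<^esub> y \<in> N"
    hence "x \<in> N +>\<^bsub>M\<^esub> y"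
      using assms(3,4)
      by (auto simp: a_r_coset_def' a_minus_def M.a_assoc M.l_neg intro!: bexI[of _ "x \<ominus>\<^bsub>M\<^esub> y"])
    thus "N +>\<^bsub>M\<^esub> x = N +>\<^bsub>M\<^esub> y" using M.a_repr_independence[OF _ assms(4) N] by simp
  qed
qed

lemma quot_module:
  assumes "module R M" "submodule N R M"
  shows "module R (quot_module M N)"
    and "(\<lambda>x. N +>\<^bsub>M\<^esub> x) \<in> mod_hom R M (quot_module M N)"
    and "carrier (quot_module M N) = (\<lambda>x. N +>\<^bsub>M\<^esub> x) ` carrier M"
proof -
  interpret M: module R M by fact
  have N: "subgroup N (add_monoid M)" using assms(2) by (simp add: submodule_def)
  have sub: "N \<subseteq> carrier M" using assms(2) by (rule submodule_subset)
  have nrm: "N \<lhd> (add_monoid M)"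
    by (rule comm_group.normal_iff_subgroup[THEN iffD2, OF M.a_comm_group N])
  show car: "carrier (quot_module M N) = (\<lambda>x. N +>\<^bsub>M\<^esub> x) ` carrier M"
    by (auto simp: quot_module_def A_RCOSETS_def')
  have z: "N +>\<^bsub>M\<^esub> \<zero>\<^bsub>M\<^esub> = \<zero>\<^bsub>quot_module M N\<^esub>"
    using sub by (simp add: quot_module_def)
  have a: "N +>\<^bsub>M\<^esub> (x \<oplus>\<^bsub>M\<^esub> y) = (N +>\<^bsub>M\<^esub> x) \<oplus>\<^bsub>quot_module M N\<^esub> (N +>\<^bsub>M\<^esub> y)"
    if "x \<in> carrier M" "y \<in> carrier M" for x y
    using normal.rcos_sum[OF nrm, of x y] that
    by (simp add: quot_module_def set_add_def a_r_coset_def)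
  have s: "N +>\<^bsub>M\<^esub> (r \<odot>\<^bsub>M\<^esub> x) = r \<odot>\<^bsub>quot_module M N\<^esub> (N +>\<^bsub>M\<^esub> x)"
    if r: "r \<in> carrier R" and x: "x \<in> carrier M" for r x
  proof -
    \<comment> \<open>Scalar multiplication on \<open>quot_module\<close> is a union over all
      representatives of a coset; every member of that union is the same coset.\<close>
    have *: "N +>\<^bsub>M\<^esub> (r \<odot>\<^bsub>M\<^esub> y) = N +>\<^bsub>M\<^esub> (r \<odot>\<^bsub>M\<^esub> x)" if y: "y \<in> N +>\<^bsub>M\<^esub> x" for y
    proof -
      obtain n where n: "n \<in> N" "y = n \<oplus>\<^bsub>M\<^esub> x" using y by (auto simp: a_r_coset_def')
      have nc: "n \<in> carrier M" using n sub by auto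
      have "r \<odot>\<^bsub>M\<^esub> y \<ominus>\<^bsub>M\<^esub> r \<odot>\<^bsub>M\<^esub> x = r \<odot>\<^bsub>M\<^esub> n"
        using n nc x r by (simp add: M.smult_r_distr a_minus_def M.a_assoc M.r_neg)
      also have "\<dots> \<in> N" using M.submoduleE(4)[OF assms(2) r n(1)] .
      finally show ?thesis using a_coset_eq_iff[OF assms] n nc x r by simp
    qed
    have "N +>\<^bsub>M\<^esub> x \<noteq> {}"
      using M.a_rcosI[OF submodule_zero_mem[OF assms(2)] sub x] x by auto
    hence "(\<Union>y\<in>N +>\<^bsub>M\<^esub> x. N +>\<^bsub>M\<^esub> (r \<odot>\<^bsub>M\<^esub> x)) = N +>\<^bsub>M\<^esub> (r \<odot>\<^bsub>M\<^esub> x)" by simp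
    moreover have "(\<Union>y\<in>N +>\<^bsub>M\<^esub> x. N +>\<^bsub>M\<^esub> (r \<odot>\<^bsub>M\<^esub> y)) = (\<Union>y\<in>N +>\<^bsub>M\<^esub> x. N +>\<^bsub>M\<^esub> (r \<odot>\<^bsub>M\<^esub> x))"
      by (rule SUP_cong[OF refl *])
    ultimately show ?thesis by (simp add: quot_module_def)
  qed
  show "module R (quot_module M N)"
    by (rule module_of_surjection(1)[OF assms(1) car[symmetric] z a s])
  show "(\<lambda>x. N +>\<^bsub>M\<^esub> x) \<in> mod_hom R M (quot_module M N)"
    by (rule module_of_surjection(2)[OF assms(1) car[symmetric] z a s])
qed

lemma quot_module_eq_zero_iff:
  assumes "module R M" "submodule N R M" "x \<in> carrier M"
  shows "N +>\<^bsub>M\<^esub> x = \<zero>\<^bsub>quot_module M N\<^esub> \<longleftrightarrow> x \<in> N"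
proof -
  interpret M: module R M by fact
  have "\<zero>\<^bsub>quot_module M N\<^esub> = N +>\<^bsub>M\<^esub> \<zero>\<^bsub>M\<^esub>"
    using submodule_subset[OF assms(2)] by (simp add: quot_module_def)
  thus ?thesis
    using a_coset_eq_iff[OF assms M.zero_closed] assms(3) by (simp add: module_minus_zero[OF assms(1)])
qed

section \<open>The ring, Hom and finite powers as modules\<close>

lemma module_ring_module:
  assumes "cring R"
  shows "module R (ring_module R)"
proof -
  interpret cring R by fact
  show ?thesis
  proof (rule moduleI)
    show "abelian_group (ring_module R)"
      by (rule abelian_groupI) (auto simp: ring_module_def a_ac intro: l_neg)
  qed (auto simp: ring_module_def l_distr r_distr m_assoc is_cring)
qed

lemma module_Hom_module:
  assumes "module R M" "module R N"
  shows "module R (Hom_module R M N)"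
proof -
  interpret M: module R M by fact
  interpret N: module R N by fact
  show ?thesis
  proof (rule moduleI)
    show "abelian_group (Hom_module R M N)"
    proof (rule abelian_groupI)
      show "\<exists>g\<in>carrier (Hom_module R M N). g \<oplus>\<^bsub>Hom_module R M N\<^esub> f = \<zero>\<^bsub>Hom_module R M N\<^esub>"
        if "f \<in> carrier (Hom_module R M N)" for f
      proof
        show "(\<lambda>x\<in>carrier M. \<ominus>\<^bsub>N\<^esub> f x) \<in> carrier (Hom_module R M N)"
          using that by (auto simp: Hom_module_def mod_hom_def Pi_iff N.minus_add N.smult_r_minus N.a_comm)
        show "(\<lambda>x\<in>carrier M. \<ominus>\<^bsub>N\<^esub> f x) \<oplus>\<^bsub>Hom_module R M N\<^esub> f = \<zero>\<^bsub>Hom_module R M N\<^esub>"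
          using that by (auto simp: Hom_module_def mod_hom_def Pi_iff N.l_neg restrict_def)
      qed
    qed (auto simp: Hom_module_def mod_hom_def Pi_iff N.a_ac N.smult_r_distr fun_eq_iff extensional_def)
  qed (auto simp: Hom_module_def mod_hom_def Pi_iff fun_eq_iff extensional_def N.smult_r_distr 
      N.smult_l_distr N.smult_assoc1[symmetric] M.m_comm M.is_cring)
qed

lemma Hom_module_simps:
  "carrier (Hom_module R M N) = mod_hom R M N \<inter> extensional (carrier M)"
  "\<zero>\<^bsub>Hom_module R M N\<^esub> = (\<lambda>x\<in>carrier M. \<zero>\<^bsub>N\<^esub>)"
  "f \<oplus>\<^bsub>Hom_module R M N\<^esub> g = (\<lambda>x\<in>carrier M. f x \<oplus>\<^bsub>N\<^esub> g x)"
  "r \<odot>\<^bsub>Hom_module R M N\<^esub> f = (\<lambda>x\<in>carrier M. r \<odot>\<^bsub>N\<^esub> f x)"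
  by (simp_all add: Hom_module_def)

lemma Hom_module_restrict:
  assumes "module R M" "f \<in> mod_hom R M N"
  shows "restrict f (carrier M) \<in> carrier (Hom_module R M N)"
  using mod_hom_cong[OF assms, of "restrict f (carrier M)"] by (simp add: Hom_module_simps)

lemma module_power_module:
  assumes "module R M"
  shows "module R (power_module M n)"
proof -
  interpret M: module R M by fact
  show ?thesis
  proof (rule moduleI)
    show "abelian_group (power_module M n)"
    proof (rule abelian_groupI)
      show "\<exists>g\<in>carrier (power_module M n). g \<oplus>\<^bsub>power_module M n\<^esub> f = \<zero>\<^bsub>power_module M n\<^esub>"
        if "f \<in> carrier (power_module M n)" for f
        using that by (intro bexI[of _ "\<lambda>i\<in>{..<n}. \<ominus>\<^bsub>M\<^esub> f i"])
          (auto simp: power_module_def fun_eq_iff PiE_iff M.l_neg)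
    qed (auto simp: power_module_def PiE_iff M.a_ac fun_eq_iff extensional_def)
  qed (auto simp: power_module_def PiE_iff fun_eq_iff extensional_def M.smult_r_distr 
      M.smult_l_distr M.smult_assoc1[symmetric] M.is_cring)
qed

lemma power_module_simps:
  "carrier (power_module M n) = {..<n} \<rightarrow>\<^sub>E carrier M"
  "\<zero>\<^bsub>power_module M n\<^esub> = (\<lambda>i\<in>{..<n}. \<zero>\<^bsub>M\<^esub>)"
  "f \<oplus>\<^bsub>power_module M n\<^esub> g = (\<lambda>i\<in>{..<n}. f i \<oplus>\<^bsub>M\<^esub> g i)"
  "r \<odot>\<^bsub>power_module M n\<^esub> f = (\<lambda>i\<in>{..<n}. r \<odot>\<^bsub>M\<^esub> f i)"
  by (simp_all add: power_module_def)

section \<open>Free modules and free resolutions\<close>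

lemma free_module_simps:
  "carrier (free_module R S) =
     {u. range u \<subseteq> carrier R \<and> finite {x. u x \<noteq> \<zero>\<^bsub>R\<^esub>} \<and> {x. u x \<noteq> \<zero>\<^bsub>R\<^esub>} \<subseteq> S}"
  "\<zero>\<^bsub>free_module R S\<^esub> = (\<lambda>x. \<zero>\<^bsub>R\<^esub>)"
  "u \<oplus>\<^bsub>free_module R S\<^esub> v = (\<lambda>x. u x \<oplus>\<^bsub>R\<^esub> v x)"
  "r \<odot>\<^bsub>free_module R S\<^esub> u = (\<lambda>x. r \<otimes>\<^bsub>R\<^esub> u x)"
  by (simp_all add: free_module_def)

lemma module_free_module:
  fixes R :: "('r, 'z) ring_scheme" and S :: "'x set"
  assumes "cring R"
  shows "module R (free_module R S)"
proof -
  interpret cring R by fact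
  have sub: "{x. u x \<oplus>\<^bsub>R\<^esub> v x \<noteq> \<zero>\<^bsub>R\<^esub>} \<subseteq> {x. u x \<noteq> \<zero>\<^bsub>R\<^esub>} \<union> {x. v x \<noteq> \<zero>\<^bsub>R\<^esub>}" for u v :: "'x \<Rightarrow> 'r"
    by auto
  have fin: "finite {x. u x \<oplus>\<^bsub>R\<^esub> v x \<noteq> \<zero>\<^bsub>R\<^esub>}" if "finite {x. u x \<noteq> \<zero>\<^bsub>R\<^esub>}" "finite {x. v x \<noteq> \<zero>\<^bsub>R\<^esub>}"
    for u v :: "'x \<Rightarrow> 'r"
    by (rule finite_subset[OF sub]) (use that in auto)
  have fin': "finite {x. r \<otimes>\<^bsub>R\<^esub> u x \<noteq> \<zero>\<^bsub>R\<^esub>}" if "finite {x. u x \<noteq> \<zero>\<^bsub>R\<^esub>}" "r \<in> carrier R"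
    for r and u :: "'x \<Rightarrow> 'r"
    by (rule finite_subset[OF _ that(1)]) (use that(2) in auto)
  have fin'': "finite {x. \<ominus>\<^bsub>R\<^esub> u x \<noteq> \<zero>\<^bsub>R\<^esub>}" if "finite {x. u x \<noteq> \<zero>\<^bsub>R\<^esub>}"
    for u :: "'x \<Rightarrow> 'r"
    by (rule finite_subset[OF _ that(1)]) auto
  have cl: "u x \<in> carrier R" if "range u \<subseteq> carrier R" for u :: "'x \<Rightarrow> 'r" and x
    using that by auto
  show ?thesis
  proof (rule moduleI)
    show "abelian_group (free_module R S)"
    proof (rule abelian_groupI)
      show "\<exists>v\<in>carrier (free_module R S). v \<oplus>\<^bsub>free_module R S\<^esub> u = \<zero>\<^bsub>free_module R S\<^esub>"
        if u: "u \<in> carrier (free_module R S)" for u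
      proof (rule bexI[of _ "\<lambda>x. \<ominus>\<^bsub>R\<^esub> u x"])
        show "(\<lambda>x. \<ominus>\<^bsub>R\<^esub> u x) \<oplus>\<^bsub>free_module R S\<^esub> u = \<zero>\<^bsub>free_module R S\<^esub>"
          using u by (auto simp: free_module_simps cl l_neg fun_eq_iff)
        have "u x = \<zero>\<^bsub>R\<^esub> \<Longrightarrow> \<ominus>\<^bsub>R\<^esub> u x = \<zero>\<^bsub>R\<^esub>" for x by simp
        thus "(\<lambda>x. \<ominus>\<^bsub>R\<^esub> u x) \<in> carrier (free_module R S)"
          using u by (auto simp: free_module_simps cl fin'')
      qed
    next
      fix u v assume u: "u \<in> carrier (free_module R S)" and v: "v \<in> carrier (free_module R S)"
      have "{x. u x \<oplus>\<^bsub>R\<^esub> v x \<noteq> \<zero>\<^bsub>R\<^esub>} \<subseteq> S"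
        using sub[of u v] u v unfolding free_module_simps by blast
      thus "u \<oplus>\<^bsub>free_module R S\<^esub> v \<in> carrier (free_module R S)"
        using u v by (auto simp: free_module_simps cl fin)
    qed (auto simp: free_module_simps cl a_ac)
  next
    fix r u assume r: "r \<in> carrier R" and u: "u \<in> carrier (free_module R S)"
    have "u x = \<zero>\<^bsub>R\<^esub> \<Longrightarrow> r \<otimes>\<^bsub>R\<^esub> u x = \<zero>\<^bsub>R\<^esub>" for x using r by simp
    thus "r \<odot>\<^bsub>free_module R S\<^esub> u \<in> carrier (free_module R S)"
      using r u by (auto simp: free_module_simps cl fin')
  qed (auto simp: free_module_simps cl l_distr r_distr m_assoc is_cring)
qed

lemma free_gen_closed:
  assumes "cring R" "x \<in> S"
  shows "free_gen R x \<in> carrier (free_module R S)"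
proof -
  interpret cring R by fact
  have "{y. free_gen R x y \<noteq> \<zero>\<^bsub>R\<^esub>} \<subseteq> {x}" by (auto simp: free_gen_def)
  thus ?thesis
    using assms finite_subset[of _ "{x}"] by (auto simp: free_module_simps free_gen_def)
qed

text \<open>Truncation to the coordinates in \<open>T\<close>. It allows inductions over a finite
  set of basis elements without leaving the given free module.\<close>

definition free_part :: "('r, 'z) ring_scheme \<Rightarrow> 'x set \<Rightarrow> ('x \<Rightarrow> 'r) \<Rightarrow> 'x \<Rightarrow> 'r" where
  "free_part R T u = (\<lambda>y. if y \<in> T then u y else \<zero>\<^bsub>R\<^esub>)"

lemma free_part_hom:
  assumes "cring R"
  shows "free_part R T \<in> mod_hom R (free_module R S) (free_module R S)"
proof -
  interpret cring R by fact
  show ?thesis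
  proof (rule mod_homI)
    fix u assume u: "u \<in> carrier (free_module R S)"
    have "{x. free_part R T u x \<noteq> \<zero>\<^bsub>R\<^esub>} \<subseteq> {x. u x \<noteq> \<zero>\<^bsub>R\<^esub>}" by (auto simp: free_part_def)
    thus "free_part R T u \<in> carrier (free_module R S)"
      using u finite_subset[of _ "{x. u x \<noteq> \<zero>\<^bsub>R\<^esub>}"] by (auto simp: free_module_simps free_part_def)
  qed (auto simp: free_part_def free_module_simps fun_eq_iff)
qed

lemma free_part_full:
  assumes "u \<in> carrier (free_module R S)" "{x. u x \<noteq> \<zero>\<^bsub>R\<^esub>} \<subseteq> T"
  shows "free_part R T u = u"
proof (rule ext)
  fix y show "free_part R T u y = u y"
    using assms(2) unfolding free_part_def by (metis (mono_tags, lifting) mem_Collect_eq subsetD)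
qed

lemma free_part_empty: "free_part R {} u = \<zero>\<^bsub>free_module R S\<^esub>"
  by (auto simp: free_part_def free_module_simps)

lemma free_part_insert:
  assumes "cring R" "u \<in> carrier (free_module R S)" "x \<notin> T"
  shows "free_part R (insert x T) u =
    free_part R T u \<oplus>\<^bsub>free_module R S\<^esub> u x \<odot>\<^bsub>free_module R S\<^esub> free_gen R x"
proof -
  interpret cring R by fact
  have "\<And>y. u y \<in> carrier R" using assms(2) by (auto simp: free_module_simps)
  thus ?thesis using assms(3) by (auto simp: free_part_def free_module_simps fun_eq_iff free_gen_def)
qed

lemma free_coeff_closed: "u \<in> carrier (free_module R S) \<Longrightarrow> u x \<in> carrier R"
  by (auto simp: free_module_simps)

lemma free_module_generated:
  assumes "cring R" "submodule H R (free_module R S)" "\<And>x. x \<in> S \<Longrightarrow> free_gen R x \<in> H"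
    and u: "u \<in> carrier (free_module R S)"
  shows "u \<in> H"
proof -
  interpret F: module R "free_module R S" by (rule module_free_module) fact
  have "finite {x. u x \<noteq> \<zero>\<^bsub>R\<^esub>}" "{x. u x \<noteq> \<zero>\<^bsub>R\<^esub>} \<subseteq> S"
    using u by (auto simp: free_module_simps)
  hence "free_part R {x. u x \<noteq> \<zero>\<^bsub>R\<^esub>} u \<in> H"
  proof (induction rule: finite_induct)
    case empty
    show ?case using submodule_zero_mem[OF assms(2)] by (simp add: free_part_empty[of R u S])
  next
    case (insert x T)
    thus ?case
      using free_part_insert[OF assms(1) u] assms(3) F.submoduleE(4,5)[OF assms(2)]
        free_coeff_closed[OF u] by simp
  qed
  thus ?thesis using free_part_full[OF u] by simp
qed

lemma free_hom_eqI:
  assumes "cring R" "module R N" "f \<in> mod_hom R (free_module R S) N" "g \<in> mod_hom R (free_module R S) N"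
    and "\<And>x. x \<in> S \<Longrightarrow> f (free_gen R x) = g (free_gen R x)"
    and "u \<in> carrier (free_module R S)"
  shows "f u = g u"
proof -
  have "u \<in> {x \<in> carrier (free_module R S). f x = g x}"
    by (rule free_module_generated[OF assms(1) submodule_equalizer[OF module_free_module]])
      (use assms in \<open>auto intro: free_gen_closed\<close>)
  thus ?thesis by simp
qed

lemma free_hom_exists:
  assumes "cring R" "module R N" "\<And>x. x \<in> S \<Longrightarrow> b x \<in> carrier N"
  obtains h where "h \<in> mod_hom R (free_module R S) N" "\<And>x. x \<in> S \<Longrightarrow> h (free_gen R x) = b x"
proof -
  interpret N: module R N by fact
  \<comment> \<open>The sum runs over the support of \<open>u\<close>, which is finite even if
    \<open>S\<close> is not. The fact \<open>h\<close> below enlarges the index set to any finite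
    part of \<open>S\<close> containing the support, as needed to treat two elements at
    once.\<close>
  define h where "h u = finsum N (\<lambda>x. u x \<odot>\<^bsub>N\<^esub> b x) {x. u x \<noteq> \<zero>\<^bsub>R\<^esub>}" for u
  let ?F = "free_module R S"
  have cl: "u x \<in> carrier R" if "u \<in> carrier ?F" for u x
    using that by (rule free_coeff_closed)
  have supp: "finite {x. u x \<noteq> \<zero>\<^bsub>R\<^esub>}" "{x. u x \<noteq> \<zero>\<^bsub>R\<^esub>} \<subseteq> S" if "u \<in> carrier ?F" for u
    using that by (auto simp: free_module_simps)
  have h: "h u = finsum N (\<lambda>x. u x \<odot>\<^bsub>N\<^esub> b x) T"
    if u: "u \<in> carrier ?F" and T: "finite T" "{x. u x \<noteq> \<zero>\<^bsub>R\<^esub>} \<subseteq> T" "T \<subseteq> S" for u T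
    unfolding h_def
    by (rule N.add.finprod_mono_neutral_cong_left) (use T cl[OF u] assms(3) in auto)
  interpret F: module R ?F by (rule module_free_module) fact
  have hom: "h \<in> mod_hom R ?F N"
  proof (rule mod_homI)
    fix u assume u: "u \<in> carrier ?F"
    let ?U = "{x. u x \<noteq> \<zero>\<^bsub>R\<^esub>}"
    show "h u \<in> carrier N"
      unfolding h_def using supp[OF u] cl[OF u] assms(3) by (intro N.finsum_closed) auto
    show "h (r \<odot>\<^bsub>?F\<^esub> u) = r \<odot>\<^bsub>N\<^esub> h u" if r: "r \<in> carrier R" for r
    proof -
      have ru: "r \<odot>\<^bsub>?F\<^esub> u \<in> carrier ?F" using r u by simp
      have "h (r \<odot>\<^bsub>?F\<^esub> u) = finsum N (\<lambda>x. (r \<odot>\<^bsub>?F\<^esub> u) x \<odot>\<^bsub>N\<^esub> b x) ?U"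
        by (rule h[OF ru supp(1)[OF u] _ supp(2)[OF u]]) (use r in \<open>auto simp: free_module_simps\<close>)
      also have "\<dots> = finsum N (\<lambda>x. r \<odot>\<^bsub>N\<^esub> (u x \<odot>\<^bsub>N\<^esub> b x)) ?U"
        by (rule N.finsum_cong')
          (use r supp[OF u] cl[OF u] assms(3) in \<open>auto simp: free_module_simps N.smult_assoc1\<close>)
      also have "\<dots> = r \<odot>\<^bsub>N\<^esub> h u"
        unfolding h_def
        by (rule N.finsum_smult_ldistr[symmetric]) (use r supp[OF u] cl[OF u] assms(3) in auto)
      finally show ?thesis .
    qed
    fix v assume v: "v \<in> carrier ?F"
    let ?T = "{x. u x \<noteq> \<zero>\<^bsub>R\<^esub>} \<union> {x. v x \<noteq> \<zero>\<^bsub>R\<^esub>}"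
    have T: "finite ?T" "?T \<subseteq> S" using supp[OF u] supp[OF v] by auto
    have uv: "u \<oplus>\<^bsub>?F\<^esub> v \<in> carrier ?F" using u v by simp
    have "h (u \<oplus>\<^bsub>?F\<^esub> v) = finsum N (\<lambda>x. (u \<oplus>\<^bsub>?F\<^esub> v) x \<odot>\<^bsub>N\<^esub> b x) ?T"
      by (rule h[OF uv T(1) _ T(2)]) (auto simp: free_module_simps)
    also have "\<dots> = finsum N (\<lambda>x. u x \<odot>\<^bsub>N\<^esub> b x \<oplus>\<^bsub>N\<^esub> v x \<odot>\<^bsub>N\<^esub> b x) ?T"
      by (rule N.finsum_cong')
        (use T cl[OF u] cl[OF v] assms(3) in \<open>auto simp: free_module_simps N.smult_l_distr\<close>)
    also have "\<dots> = finsum N (\<lambda>x. u x \<odot>\<^bsub>N\<^esub> b x) ?T \<oplus>\<^bsub>N\<^esub> finsum N (\<lambda>x. v x \<odot>\<^bsub>N\<^esub> b x) ?T"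
      by (rule N.finsum_addf) (use T cl[OF u] cl[OF v] assms(3) in auto)
    also have "\<dots> = h u \<oplus>\<^bsub>N\<^esub> h v"
      using h[OF u T(1) _ T(2)] h[OF v T(1) _ T(2)] by auto
    finally show "h (u \<oplus>\<^bsub>?F\<^esub> v) = h u \<oplus>\<^bsub>N\<^esub> h v" .
  qed
  have "h (free_gen R x) = b x" if x: "x \<in> S" for x
  proof -
    have "h (free_gen R x) = finsum N (\<lambda>y. free_gen R x y \<odot>\<^bsub>N\<^esub> b y) {x}"
      by (rule h[OF free_gen_closed[OF assms(1) x]]) (use x in \<open>auto simp: free_gen_def\<close>)
    also have "\<dots> = b x" using assms(3)[OF x] by (simp add: free_gen_def)
    finally show ?thesis .
  qed
  with hom that show ?thesis by blast
qed

text \<open>Projectivity of free modules. The map \<open>p\<close> need not be onto: only the image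
  of \<open>w\<close> has to lie in that of \<open>p\<close>, which is the situation of a
  differential that covers a kernel.\<close>

lemma free_module_lift:
  assumes "cring R" "module R N" "module R N'" "p \<in> mod_hom R N N'"
    and w: "w \<in> mod_hom R (free_module R S) N'"
    and im: "\<And>u. u \<in> carrier (free_module R S) \<Longrightarrow> w u \<in> p ` carrier N"
  obtains v where "v \<in> mod_hom R (free_module R S) N"
    "\<And>u. u \<in> carrier (free_module R S) \<Longrightarrow> p (v u) = w u"
proof -
  have "\<forall>x\<in>S. \<exists>n\<in>carrier N. p n = w (free_gen R x)"
    using im[OF free_gen_closed[OF assms(1)]] by fastforce
  then obtain b where b: "\<And>x. x \<in> S \<Longrightarrow> b x \<in> carrier N" "\<And>x. x \<in> S \<Longrightarrow> p (b x) = w (free_gen R x)"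
    by metis
  obtain v where v: "v \<in> mod_hom R (free_module R S) N" "\<And>x. x \<in> S \<Longrightarrow> v (free_gen R x) = b x"
    using free_hom_exists[OF assms(1,2), of S b] b(1) by blast
  have "p (v u) = w u" if "u \<in> carrier (free_module R S)" for u
    by (rule free_hom_eqI[OF assms(1,3) mod_hom_comp[OF v(1) assms(4)] w _ that])
      (simp add: v(2) b(2))
  with v(1) that show ?thesis by blast
qed

text \<open>Induction on the rank. The values of the coordinate \<open>x\<close> on \<open>H\<close>
  form an ideal, finitely generated since \<open>R\<close> is Noetherian, and the part of
  \<open>H\<close> where this coordinate vanishes lies in a free module of smaller rank. Generators
  of that part together with preimages of generators of the ideal span \<open>H\<close>.\<close>

lemma free_submodule_fin_gen:
  assumes "cring R" "noetherian_ring R" "finite S" "submodule H R (free_module R S)"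
  shows "\<exists>A. finite A \<and> A \<subseteq> H \<and> H \<subseteq> mod_span R (free_module R S) A"
  using assms(3,4)
proof (induction S arbitrary: H rule: finite_induct)
  case empty
  have "H \<subseteq> {\<lambda>x. \<zero>\<^bsub>R\<^esub>}"
    using submodule_subset[OF empty] by (auto simp: free_module_simps fun_eq_iff)
  thus ?case using submodule_zero_mem[OF empty] 
    by (intro exI[of _ H]) (auto simp: mod_span_base intro: finite_subset)
next
  case (insert x S)
  let ?F = "free_module R (insert x S)" and ?G = "free_module R S"
  interpret noetherian_ring R by fact
  interpret cring R by fact
  interpret F: module R ?F by (rule module_free_module) fact
  interpret G: module R ?G by (rule module_free_module) fact
  have coord: "(\<lambda>u. u x) \<in> mod_hom R ?F (ring_module R)"
    by (rule mod_homI) (auto simp: free_module_simps ring_module_def)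
  \<comment> \<open>Elements of a free module are functions on the whole type, so \<open>?G\<close>
    is literally the part of \<open>?F\<close> where the coordinate \<open>x\<close>
    vanishes.\<close>
  have GF: "u \<in> carrier ?G \<longleftrightarrow> u \<in> carrier ?F \<and> u x = \<zero>\<^bsub>R\<^esub>" for u
    using insert.hyps(2) by (auto simp: free_module_simps)
  have incl: "(\<lambda>u. u) \<in> mod_hom R ?G ?F"
    by (rule mod_homI) (auto simp: GF, auto simp: free_module_simps)
  have subG: "submodule {u \<in> carrier ?G. u \<in> H} R ?G"
    by (rule submodule_preimage[OF G.module_axioms F.module_axioms incl insert.prems])
  obtain A where A: "finite A" "A \<subseteq> {u \<in> carrier ?G. u \<in> H}" "{u \<in> carrier ?G. u \<in> H} \<subseteq> mod_span R ?G A"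
    using insert.IH[OF subG] by blast
  have ideal_img: "ideal ((\<lambda>u. u x) ` K) R" if K: "submodule K R ?F" for K
  proof (rule idealI)
    have mK: "module R (?F\<lparr>carrier := K\<rparr>)" by (rule submodule_module[OF K F.module_axioms])
    have "submodule ((\<lambda>u. u x) ` K) R (ring_module R)"
      using submodule_image[OF mK module_ring_module[OF assms(1)] mod_hom_restrict_dom[OF coord submodule_subset[OF K]]]
      by simp
    note sm = this
    interpret Q: module R "ring_module R" by (rule module_ring_module) fact
    show "subgroup ((\<lambda>u. u x) ` K) (add_monoid R)"
      using sm by (simp add: submodule_def subgroup_def ring_module_def m_inv_def)
    fix a r assume a: "a \<in> (\<lambda>u. u x) ` K" and r: "r \<in> carrier R"
    show ra: "r \<otimes>\<^bsub>R\<^esub> a \<in> (\<lambda>u. u x) ` K"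
      using Q.submoduleE(4)[OF sm r a] by (simp add: ring_module_def)
    have "a \<in> carrier R" 
      using a submodule_subset[OF K] free_coeff_closed[of _ R "insert x S" x] by blast
    thus "a \<otimes>\<^bsub>R\<^esub> r \<in> (\<lambda>u. u x) ` K"
      using ra r m_comm[of a r] by simp
  qed (rule ring_axioms)
  obtain I where I: "I \<subseteq> carrier R" "finite I" "(\<lambda>u. u x) ` H = Idl\<^bsub>R\<^esub> I"
    using finetely_gen[OF ideal_img[OF insert.prems]] by blast
  have "I \<subseteq> (\<lambda>u. u x) ` H" using I genideal_self by simp
  then obtain B where B: "B \<subseteq> H" "finite B" "I = (\<lambda>u. u x) ` B"
    using I(2) by (metis finite_subset_image)
  let ?A = "A \<union> B"
  have Asub: "?A \<subseteq> H" using A(2) B(1) by auto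
  have Hsub: "H \<subseteq> carrier ?F" by (rule submodule_subset[OF insert.prems])
  have sp: "submodule (mod_span R ?F ?A) R ?F"
    by (rule submodule_mod_span[OF F.module_axioms]) (use Asub Hsub in blast)
  have spH: "mod_span R ?F ?A \<subseteq> H" by (rule mod_span_subset[OF insert.prems Asub])
  have "u \<in> mod_span R ?F ?A" if u: "u \<in> H" for u
  proof -
    \<comment> \<open>The coordinate \<open>x\<close> takes the span of \<open>?A\<close> to an
      ideal containing \<open>I\<close>, so some \<open>v\<close> in the span has the same
      coordinate as \<open>u\<close>, and \<open>u - v\<close> falls under the induction
      hypothesis.\<close>
    have "Idl\<^bsub>R\<^esub> I \<subseteq> (\<lambda>u. u x) ` mod_span R ?F ?A"
      by (rule genideal_minimal[OF ideal_img[OF sp]]) (use B(3) mod_span_base[of ?A R ?F] in blast)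
    then obtain v where v: "v \<in> mod_span R ?F ?A" "u x = v x"
      using I(3) u by blast
    have vc: "v \<in> H" using v spH by auto
    have uc: "u \<in> carrier ?F" "v \<in> carrier ?F" using u vc Hsub by auto
    have "(u \<ominus>\<^bsub>?F\<^esub> v) x = u x \<ominus>\<^bsub>ring_module R\<^esub> v x"
      using mod_hom_minus[OF F.module_axioms module_ring_module[OF assms(1)] coord] uc by simp
    also have "\<dots> = \<zero>\<^bsub>ring_module R\<^esub>"
      using module_minus_eq_zero_iff[OF module_ring_module[OF assms(1)], of "u x" "v x"] v uc
      by (auto simp: ring_module_def free_module_simps)
    finally have "(u \<ominus>\<^bsub>?F\<^esub> v) x = \<zero>\<^bsub>R\<^esub>" by (simp add: ring_module_def)
    hence "u \<ominus>\<^bsub>?F\<^esub> v \<in> carrier ?G" using uc by (simp add: GF)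
    moreover have "u \<ominus>\<^bsub>?F\<^esub> v \<in> H"
      using F.submoduleE(3,5)[OF insert.prems] u vc by (simp add: a_minus_def)
    ultimately have "u \<ominus>\<^bsub>?F\<^esub> v \<in> mod_span R ?G A" using A(3) by blast
    moreover have "mod_span R ?G A \<subseteq> {w \<in> carrier ?G. w \<in> mod_span R ?F ?A}"
      by (rule mod_span_subset[OF submodule_preimage[OF G.module_axioms F.module_axioms incl sp]])
        (use A(2) mod_span_base[of ?A R ?F] in blast)
    ultimately have "(u \<ominus>\<^bsub>?F\<^esub> v) \<oplus>\<^bsub>?F\<^esub> v \<in> mod_span R ?F ?A"
      using F.submoduleE(5)[OF sp] v by blast
    thus ?thesis using uc by (simp add: a_minus_def F.a_assoc F.l_neg)
  qed
  thus ?case using A(1) B(2) Asub by (intro exI[of _ ?A]) auto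
qed

text \<open>The basis type is fixed in advance so that all terms of a resolution have the same type;
  being infinite, it contains index sets of every finite size. The image is a span, so the lemma
  covers kernels as well as whole modules.\<close>

lemma finite_free_cover:
  fixes M :: "('r, 'a) module"
  assumes "cring R" "module R M" "infinite (UNIV :: 'x set)" "finite A" "A \<subseteq> carrier M"
  obtains S :: "'x set" and h where "finite S" "h \<in> mod_hom R (free_module R S) M"
    "h ` carrier (free_module R S) = mod_span R M A"
proof -
  obtain S :: "'x set" where S: "finite S" "card S = card A"
    using infinite_arbitrarily_large[OF assms(3)] by blast
  obtain b where b: "bij_betw b S A" using finite_same_card_bij[OF S(1) assms(4) S(2)] by blast
  have bS: "\<And>x. x \<in> S \<Longrightarrow> b x \<in> A" using b by (auto simp: bij_betw_def)
  obtain h where h: "h \<in> mod_hom R (free_module R S) M" "\<And>x. x \<in> S \<Longrightarrow> h (free_gen R x) = b x"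
    using free_hom_exists[OF assms(1,2), of S b] bS assms(5) by blast
  note F = module_free_module[OF assms(1), of S]
  note sp = submodule_mod_span[OF assms(2,5)]
  have "h u \<in> mod_span R M A" if u: "u \<in> carrier (free_module R S)" for u
    using free_module_generated[OF assms(1) submodule_preimage[OF F assms(2) h(1) sp] _ u]
      h(2) bS mod_span_base[of A R M] free_gen_closed[OF assms(1)] by fastforce
  moreover have "mod_span R M A \<subseteq> h ` carrier (free_module R S)"
  proof (rule mod_span_subset[OF submodule_image[OF F assms(2) h(1)]], rule subsetI)
    fix a assume "a \<in> A"
    then obtain x where x: "x \<in> S" "a = b x" using b by (auto simp: bij_betw_def)
    show "a \<in> h ` carrier (free_module R S)"
      using x h(2) free_gen_closed[OF assms(1), of x S] by (metis imageI)
  qed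
  ultimately have "h ` carrier (free_module R S) = mod_span R M A" by auto
  thus ?thesis using that S(1) h(1) by blast
qed

text \<open>Indexing by natural numbers, with \<open>d n\<close> leaving degree
  \<open>n + 1\<close>, permits recursion and avoids negative degrees. Complexes indexed by integers
  serve only to reach the definitions of Ext and Tor.\<close>

definition nat_resolution ::
  "('r, 'z) ring_scheme \<Rightarrow> ('r, 'a) module \<Rightarrow> (nat \<Rightarrow> 'x set) \<Rightarrow>
     (nat \<Rightarrow> ('x \<Rightarrow> 'r) \<Rightarrow> 'x \<Rightarrow> 'r) \<Rightarrow> (('x \<Rightarrow> 'r) \<Rightarrow> 'a) \<Rightarrow> bool" where
  "nat_resolution R A S d \<epsilon> \<longleftrightarrow>
     (\<forall>n. d n \<in> mod_hom R (free_module R (S (Suc n))) (free_module R (S n))) \<and>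
     \<epsilon> \<in> mod_hom R (free_module R (S 0)) A \<and>
     \<epsilon> ` carrier (free_module R (S 0)) = carrier A \<and>
     {x \<in> carrier (free_module R (S 0)). \<epsilon> x = \<zero>\<^bsub>A\<^esub>} = d 0 ` carrier (free_module R (S 1)) \<and>
     (\<forall>n. {x \<in> carrier (free_module R (S (Suc n))). d n x = \<zero>\<^bsub>free_module R (S n)\<^esub>} =
        d (Suc n) ` carrier (free_module R (S (Suc (Suc n)))))"

lemma finite_nat_resolution_exists:
  fixes A :: "('r, 'a) module"
  assumes "cring R" "noetherian_ring R" "module R A" "fin_gen R A" "infinite (UNIV :: 'x set)"
  obtains S :: "nat \<Rightarrow> 'x set" and d \<epsilon> where "nat_resolution R A S d \<epsilon>" "\<And>n. finite (S n)"
proof -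
  let ?F = "free_module R :: 'x set \<Rightarrow> _"
  note mF = module_free_module[OF assms(1)]
  obtain X where X: "finite X" "X \<subseteq> carrier A" "mod_span R A X = carrier A"
    using assms(4) by (auto simp: fin_gen_def)
  obtain S0 :: "'x set" and \<epsilon> where S0: "finite S0" "\<epsilon> \<in> mod_hom R (?F S0) A"
    "\<epsilon> ` carrier (?F S0) = carrier A"
    using finite_free_cover[OF assms(1,3,5) X(1,2)] X(3) by metis
  \<comment> \<open>A state consists of a basis \<open>S\<close>, the kernel \<open>K\<close> of the
    map that leaves its free module, and that map. In degree 0 the map is \<open>\<epsilon>\<close>,
    which has another type, so only its kernel is prescribed and the third component is
    arbitrary.\<close>
  define P :: "nat \<Rightarrow> 'x set \<times> ('x \<Rightarrow> 'r) set \<times> (('x \<Rightarrow> 'r) \<Rightarrow> 'x \<Rightarrow> 'r) \<Rightarrow> bool" where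
    "P n s \<longleftrightarrow> (case s of (S, K, d) \<Rightarrow> finite S \<and> submodule K R (?F S) \<and>
      (n = 0 \<longrightarrow> S = S0 \<and> K = {x \<in> carrier (?F S0). \<epsilon> x = \<zero>\<^bsub>A\<^esub>}))" for n s
  define Q :: "nat \<Rightarrow> 'x set \<times> ('x \<Rightarrow> 'r) set \<times> (('x \<Rightarrow> 'r) \<Rightarrow> 'x \<Rightarrow> 'r) \<Rightarrow>
      'x set \<times> ('x \<Rightarrow> 'r) set \<times> (('x \<Rightarrow> 'r) \<Rightarrow> 'x \<Rightarrow> 'r) \<Rightarrow> bool" where
    "Q n s s' \<longleftrightarrow> (case s of (S, K, d) \<Rightarrow> case s' of (S', K', d') \<Rightarrow>
      d' \<in> mod_hom R (?F S') (?F S) \<and> d' ` carrier (?F S') = K \<and>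
      K' = {x \<in> carrier (?F S'). d' x = \<zero>\<^bsub>?F S\<^esub>})" for n s s'
  have "\<exists>f. \<forall>n. P n (f n) \<and> Q n (f n) (f (Suc n))"
  proof (rule dependent_nat_choice)
    show "\<exists>s. P 0 s"
      using S0 submodule_kernel[OF mF assms(3) S0(2)] by (auto simp: P_def)
    fix s n assume P: "P n s"
    obtain S K d where s: "s = (S, K, d)" by (cases s)
    have S: "finite S" and K: "submodule K R (?F S)" using P by (auto simp: P_def s)
    obtain B where B: "finite B" "B \<subseteq> K" "K \<subseteq> mod_span R (?F S) B"
      using free_submodule_fin_gen[OF assms(1,2) S K] by blast
    have Bc: "B \<subseteq> carrier (?F S)" using B(2) submodule_subset[OF K] by simp
    have eq: "mod_span R (?F S) B = K" using B(3) mod_span_subset[OF K B(2)] by simp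
    obtain S' :: "'x set" and d' where S': "finite S'" "d' \<in> mod_hom R (?F S') (?F S)"
      "d' ` carrier (?F S') = K"
      using finite_free_cover[OF assms(1) mF assms(5) B(1) Bc, unfolded eq] by metis
    show "\<exists>s'. P (Suc n) s' \<and> Q n s s'"
      using S' submodule_kernel[OF mF mF S'(2)]
      by (auto simp: P_def Q_def s)
  qed
  then obtain f where f: "\<And>n. P n (f n)" "\<And>n. Q n (f n) (f (Suc n))" by blast
  define S where "S n = fst (f n)" for n
  define K where "K n = fst (snd (f n))" for n
  define d where "d n = snd (snd (f (Suc n)))" for n
  have fS: "finite (S n)" for n using f(1)[of n] by (auto simp: P_def S_def split: prod.splits)
  have Z: "S 0 = S0" "K 0 = {x \<in> carrier (?F S0). \<epsilon> x = \<zero>\<^bsub>A\<^esub>}"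
    using f(1)[of 0] by (auto simp: P_def S_def K_def split: prod.splits)
  have D: "d n \<in> mod_hom R (?F (S (Suc n))) (?F (S n))" "d n ` carrier (?F (S (Suc n))) = K n"
    "K (Suc n) = {x \<in> carrier (?F (S (Suc n))). d n x = \<zero>\<^bsub>?F (S n)\<^esub>}" for n
    using f(2)[of n] by (auto simp: Q_def S_def K_def d_def split: prod.splits)
  have "nat_resolution R A S d \<epsilon>"
    unfolding nat_resolution_def
    using S0 Z D(1) D(2)[of 0] D(3) D(2)[of "Suc _"] by simp
  with fS that show ?thesis by blast
qed

lemma zero_module_free_empty: "cring R \<Longrightarrow> zero_module (free_module R {})"
  by (auto simp: zero_module_def free_module_simps cring_def ring_def abelian_group_def 
      fun_eq_iff intro!: abelian_monoid.zero_closed)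

section \<open>Cycles, boundaries and homology\<close>

definition cycle_module :: "('r, 'i) cpx \<Rightarrow> int \<Rightarrow> ('r, 'i) module" where
  "cycle_module X i = (obj X i)\<lparr>carrier := cycles X i\<rparr>"

lemma submodule_cycles:
  assumes "is_complex R X"
  shows "submodule (cycles X i) R (obj X i)"
  unfolding cycles_def by (rule submodule_kernel) (use assms in \<open>auto simp: is_complex_def\<close>)

lemma module_cycle_module:
  assumes "is_complex R X"
  shows "module R (cycle_module X i)"
  unfolding cycle_module_def
  by (rule submodule_module[OF submodule_cycles[OF assms]]) (use assms in \<open>auto simp: is_complex_def\<close>)

lemma boundaries_subset_cycles:
  assumes "is_complex R X"
  shows "boundaries X i \<subseteq> cycles X i"
proof
  fix x assume "x \<in> boundaries X i"
  then obtain y where y: "y \<in> carrier (obj X (i + 1))" "x = diff X (i + 1) y"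
    by (auto simp: boundaries_def)
  have c: "diff X (i + 1) \<in> mod_hom R (obj X (i + 1)) (obj X (i + 1 - 1))"
    "diff X (i + 1 - 1) (diff X (i + 1) y) = \<zero>\<^bsub>obj X (i + 1 - 2)\<^esub>"
    using assms y(1) unfolding is_complex_def by blast+
  have "i + 1 - 2 = i - 1" by simp
  thus "x \<in> cycles X i" using y mod_hom_closed[OF c(1) y(1)] c(2) by (simp add: cycles_def)
qed

lemma submodule_boundaries:
  assumes "is_complex R X"
  shows "submodule (boundaries X i) R (cycle_module X i)"
proof -
  have m: "module R (obj X (i + 1))" and d: "diff X (i + 1) \<in> mod_hom R (obj X (i + 1)) (obj X (i + 1 - 1))"
    using assms unfolding is_complex_def by blast+
  have "diff X (i + 1) \<in> mod_hom R (obj X (i + 1)) (cycle_module X i)"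
    unfolding cycle_module_def
    by (rule mod_hom_into_sub)
      (use d boundaries_subset_cycles[OF assms, of i] in \<open>auto simp: boundaries_def\<close>)
  from submodule_image[OF m module_cycle_module[OF assms] this] show ?thesis
    by (simp add: boundaries_def)
qed

text \<open>A coset contains its representative as soon as 0 is a boundary. As \<open>X\<close> need
  not be a complex here, this applies to \<open>Hom_cpx_into\<close> and \<open>tensor_cpx\<close>
  without verifying the axioms of a complex for them.\<close>

lemma zero_homology_cycles_subset:
  assumes "module R (obj X i)" "\<zero>\<^bsub>obj X i\<^esub> \<in> boundaries X i" "zero_module (homology X i)"
  shows "cycles X i \<subseteq> boundaries X i"
proof
  fix x assume x: "x \<in> cycles X i"
  interpret module R "obj X i" by fact
  have "boundaries X i +>\<^bsub>cycle_module X i\<^esub> x \<in> carrier (homology X i)"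
    using x by (auto simp: homology_def quot_module_def A_RCOSETS_def' cycle_module_def)
  hence "boundaries X i +>\<^bsub>cycle_module X i\<^esub> x = boundaries X i"
    using assms(3) by (simp add: zero_module_def) (simp add: homology_def quot_module_def)
  moreover have "x \<in> boundaries X i +>\<^bsub>cycle_module X i\<^esub> x"
    using assms(2) x by (auto simp: a_r_coset_def' cycle_module_def cycles_def intro!: bexI[of _ "\<zero>\<^bsub>obj X i\<^esub>"])
  ultimately show "x \<in> boundaries X i" by simp
qed

lemma zero_homology_iff:
  assumes "is_complex R X"
  shows "zero_module (homology X i) \<longleftrightarrow> cycles X i = boundaries X i"
proof -
  note q = quot_module[OF module_cycle_module[OF assms] submodule_boundaries[OF assms], of i]
  note e = quot_module_eq_zero_iff[OF module_cycle_module[OF assms] submodule_boundaries[OF assms], of _ i]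
  have h: "homology X i = quot_module (cycle_module X i) (boundaries X i)"
    by (simp add: homology_def cycle_module_def)
  have c: "carrier (cycle_module X i) = cycles X i" by (simp add: cycle_module_def)
  note z = submodule_zero_mem[OF submodule_cycles[OF assms], of i]
  show ?thesis
    unfolding zero_module_def h q(3) c
    using boundaries_subset_cycles[OF assms, of i] e[unfolded c] z by (auto simp: image_iff)
qed

text \<open>The first isomorphism theorem, in both directions. It turns a statement on cosets into
  the existence of a surjection on cycles whose kernel consists of the boundaries, the form in which
  homology is compared later.\<close>

lemma homology_iso_iff:
  assumes X: "is_complex R X" and P: "module R P"
  shows "isomorphic R (homology X i) P \<longleftrightarrow>
    (\<exists>p\<in>mod_hom R (cycle_module X i) P. p ` cycles X i = carrier P \<and>
       (\<forall>x\<in>cycles X i. p x = \<zero>\<^bsub>P\<^esub> \<longleftrightarrow> x \<in> boundaries X i))"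
proof -
  let ?Z = "cycle_module X i" and ?B = "boundaries X i"
  note mZ = module_cycle_module[OF X, of i] and sB = submodule_boundaries[OF X, of i]
  note q = quot_module[OF mZ sB]
  note e = quot_module_eq_zero_iff[OF mZ sB]
  have h: "homology X i = quot_module ?Z ?B"
    by (simp add: homology_def cycle_module_def)
  have c: "carrier ?Z = cycles X i" by (simp add: cycle_module_def)
  let ?\<pi> = "\<lambda>x. ?B +>\<^bsub>?Z\<^esub> x" and ?H = "quot_module ?Z ?B"
  show ?thesis
  proof
    assume "isomorphic R (homology X i) P"
    then obtain f where f: "f \<in> mod_hom R ?H P" "bij_betw f (carrier ?H) (carrier P)"
      by (auto simp: isomorphic_def mod_iso_def h)
    have "(\<lambda>x. f (?\<pi> x)) \<in> mod_hom R ?Z P" by (rule mod_hom_comp[OF q(2) f(1)])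
    moreover have "(\<lambda>x. f (?\<pi> x)) ` cycles X i = carrier P"
      using f(2) by (simp add: bij_betw_def q(3) c image_image)
    moreover have "f (?\<pi> x) = \<zero>\<^bsub>P\<^esub> \<longleftrightarrow> x \<in> ?B" if x: "x \<in> cycles X i" for x
    proof -
      interpret H: module R ?H by (rule q(1))
      have "f (?\<pi> x) = \<zero>\<^bsub>P\<^esub> \<longleftrightarrow> f (?\<pi> x) = f \<zero>\<^bsub>?H\<^esub>"
        using mod_hom_zero[OF q(1) P f(1)] by simp
      also have "\<dots> \<longleftrightarrow> ?\<pi> x = \<zero>\<^bsub>?H\<^esub>"
        using f(2) x c q(3) H.zero_closed by (intro inj_on_eq_iff[of f "carrier ?H"]) (auto simp: bij_betw_def)
      also have "\<dots> \<longleftrightarrow> x \<in> ?B" using e x c by simp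
      finally show ?thesis .
    qed
    ultimately show "\<exists>p\<in>mod_hom R ?Z P. p ` cycles X i = carrier P \<and>
       (\<forall>x\<in>cycles X i. p x = \<zero>\<^bsub>P\<^esub> \<longleftrightarrow> x \<in> ?B)" by blast
  next
    assume "\<exists>p\<in>mod_hom R ?Z P. p ` cycles X i = carrier P \<and>
       (\<forall>x\<in>cycles X i. p x = \<zero>\<^bsub>P\<^esub> \<longleftrightarrow> x \<in> ?B)"
    then obtain p where p: "p \<in> mod_hom R ?Z P" "p ` cycles X i = carrier P"
      "\<And>x. x \<in> cycles X i \<Longrightarrow> p x = \<zero>\<^bsub>P\<^esub> \<longleftrightarrow> x \<in> ?B" by blast
    have ker: "p x = \<zero>\<^bsub>P\<^esub>" if "x \<in> carrier ?Z" "?\<pi> x = \<zero>\<^bsub>?H\<^esub>" for x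
      using p(3)[of x] e[OF that(1)] that c by simp
    obtain g where g: "g \<in> mod_hom R ?H P" "\<And>x. x \<in> carrier ?Z \<Longrightarrow> g (?\<pi> x) = p x"
      by (rule mod_hom_factor[OF mZ P q(2,1) _ p(1) ker]) (use q(3) in auto)
    have "g ` carrier ?H = carrier P"
      using g(2) p(2) by (simp add: q(3) c image_image)
    moreover have "inj_on g (carrier ?H)"
    proof (rule inj_onI)
      fix a b assume "a \<in> carrier ?H" "b \<in> carrier ?H" and ab: "g a = g b"
      then obtain x y where x: "x \<in> carrier ?Z" "a = ?\<pi> x" and y: "y \<in> carrier ?Z" "b = ?\<pi> y"
        using q(3) by auto
      interpret Z: module R ?Z by (rule mZ)
      have pc: "p x \<in> carrier P" "p y \<in> carrier P" using p(1) x y by (auto intro: mod_hom_closed)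
      have "p (x \<ominus>\<^bsub>?Z\<^esub> y) = p x \<ominus>\<^bsub>P\<^esub> p y"
        by (rule mod_hom_minus[OF mZ P p(1) x(1) y(1)])
      also have "\<dots> = \<zero>\<^bsub>P\<^esub>"
        using ab g(2) x y pc module_minus_eq_zero_iff[OF P] by simp
      finally have "x \<ominus>\<^bsub>?Z\<^esub> y \<in> ?B"
        using p(3)[of "x \<ominus>\<^bsub>?Z\<^esub> y"] Z.minus_closed[OF x(1) y(1)] c by simp
      thus "a = b" using a_coset_eq_iff[OF mZ sB x(1) y(1)] x y by simp
    qed
    ultimately show "isomorphic R (homology X i) P"
      using g(1) by (auto simp: isomorphic_def mod_iso_def h bij_betw_def)
  qed
qed

section \<open>Free resolutions indexed by integers and by natural numbers\<close>

lemma free_resolution_imp_nat_resolution: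
  assumes "free_resolution R A F \<epsilon>"
  obtains S where "\<And>n. obj F (int n) = free_module R (S n)"
    "nat_resolution R A S (\<lambda>n. diff F (int n + 1)) \<epsilon>"
proof -
  have cx: "is_complex R F" and "\<forall>n. \<exists>S. obj F n = free_module R S" and
    ex: "\<forall>n>0. zero_module (homology F n)" and
    eps: "\<epsilon> \<in> mod_hom R (obj F 0) A" "\<epsilon> ` carrier (obj F 0) = carrier A"
     "{x \<in> carrier (obj F 0). \<epsilon> x = \<zero>\<^bsub>A\<^esub>} = boundaries F 0"
    using assms by (auto simp: free_resolution_def)
  then obtain S' where S': "\<And>n. obj F n = free_module R (S' n)" by metis
  define S where "S n = S' (int n)" for n
  have S: "obj F (int n) = free_module R (S n)" for n by (simp add: S_def S')
  have S0: "obj F 0 = free_module R (S 0)" using S[of 0] by simp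
  have Suc: "obj F (int n + 1) = free_module R (S (Suc n))" for n 
    using S[of "Suc n"] by (simp add: add.commute)
  have Suc2: "obj F (int n + 1 + 1) = free_module R (S (Suc (Suc n)))" for n
    using S[of "Suc (Suc n)"] by (simp add: add.commute)
  have d: "diff F (int n + 1) \<in> mod_hom R (free_module R (S (Suc n))) (free_module R (S n))" for n
  proof -
    have "diff F (int n + 1) \<in> mod_hom R (obj F (int n + 1)) (obj F (int n + 1 - 1))"
      using cx unfolding is_complex_def by blast
    thus ?thesis by (simp add: S Suc)
  qed
  have ex': "{x \<in> carrier (free_module R (S (Suc n))). diff F (int n + 1) x = \<zero>\<^bsub>free_module R (S n)\<^esub>} =
      diff F (int (Suc n) + 1) ` carrier (free_module R (S (Suc (Suc n))))" for n
  proof -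
    have "cycles F (int n + 1) = boundaries F (int n + 1)"
      using ex zero_homology_iff[OF cx] by simp
    moreover have "int (Suc n) + 1 = int n + 1 + 1" by simp
    ultimately show ?thesis
      by (simp only: cycles_def boundaries_def Suc Suc2 S add_diff_cancel_right')
  qed
  have "nat_resolution R A S (\<lambda>n. diff F (int n + 1)) \<epsilon>"
    unfolding nat_resolution_def
    using eps S0 Suc[of 0] d ex' by (simp add: boundaries_def)
  with S that show ?thesis by blast
qed

lemma nat_resolution_imp_free_resolution:
  fixes S :: "nat \<Rightarrow> 'x set"
  assumes "cring R" "module R A" "nat_resolution R A S d \<epsilon>"
  shows "\<exists>F. free_resolution R A F \<epsilon>"
proof -
  \<comment> \<open>Below degree 0 the basis is empty. The zero function is the zero of every
    \<open>free_module\<close> over this type, so the zero of \<open>free_module R (S 0)\<close> can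
    serve as the value of all differentials out of degrees at most 0.\<close>
  define F where "F = \<lparr>obj = (\<lambda>i. free_module R (if i \<ge> 0 then S (nat i) else {})),
    diff = (\<lambda>i. if i > 0 then d (nat (i - 1)) else (\<lambda>_. \<zero>\<^bsub>free_module R (S 0)\<^esub>))\<rparr>"
  note mF = module_free_module[OF assms(1)]
  have d: "d n \<in> mod_hom R (free_module R (S (Suc n))) (free_module R (S n))" for n
    using assms(3) by (simp add: nat_resolution_def)
  have ex: "{x \<in> carrier (free_module R (S (Suc n))). d n x = \<zero>\<^bsub>free_module R (S n)\<^esub>} =
        d (Suc n) ` carrier (free_module R (S (Suc (Suc n))))" for n
    using assms(3) by (simp add: nat_resolution_def)
  have z: "\<zero>\<^bsub>free_module R T\<^esub> = (\<lambda>_. \<zero>\<^bsub>R\<^esub>)" for T :: "'x set" by (simp add: free_module_simps)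
  have nonneg: "obj F (int n) = free_module R (S n)" for n by (simp add: F_def)
  have dF: "diff F (int n + 1) = d n" for n by (simp add: F_def)
  have cases: "(i < 0 \<Longrightarrow> Q) \<Longrightarrow> (i = 0 \<Longrightarrow> Q) \<Longrightarrow> (\<And>n. i = int n + 1 \<Longrightarrow> Q) \<Longrightarrow> Q" for i :: int and Q
  proof -
    assume a: "i < 0 \<Longrightarrow> Q" "i = 0 \<Longrightarrow> Q" "\<And>n. i = int n + 1 \<Longrightarrow> Q"
    have "i > 0 \<Longrightarrow> i = int (nat (i - 1)) + 1" by simp
    thus Q using a by (meson linorder_neqE_linordered_idom)
  qed
  have o1: "obj F (int n + 1) = free_module R (S (Suc n))" for n
    using nonneg[of "Suc n"] by (simp add: add.commute)
  have cx: "is_complex R F"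
    unfolding is_complex_def
  proof (intro allI conjI)
    fix i
    show "module R (obj F i)" by (simp add: F_def mF)
    show "diff F i \<in> mod_hom R (obj F i) (obj F (i - 1))"
    proof (rule cases[of i])
      fix n assume "i = int n + 1"
      thus ?thesis using d[of n] by (simp add: dF o1 nonneg)
    qed (auto simp: F_def z[of "S 0"] z[of "{}", symmetric] intro!: mod_hom_const_zero mF)
    show "\<forall>x\<in>carrier (obj F i). diff F (i - 1) (diff F i x) = \<zero>\<^bsub>obj F (i - 2)\<^esub>"
    proof (rule cases[of i])
      fix n assume i: "i = int n + 1"
      show ?thesis
      proof (cases n)
        case 0 thus ?thesis by (simp add: i F_def z)
      next
        case (Suc m)
        have "d m (d n x) = \<zero>\<^bsub>free_module R (S m)\<^esub>" if "x \<in> carrier (free_module R (S (Suc n)))" for x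
          using ex[of m] that by (auto simp: Suc)
        moreover have "i - 1 = int m + 1" "i - 2 = int m" by (auto simp: i Suc)
        ultimately show ?thesis
          by (simp only: i dF o1 nonneg) simp
      qed
    qed (auto simp: F_def z)
  qed
  have "zero_module (homology F n)" if n: "n > 0" for n
  proof (rule cases[of n])
    fix m assume m: "n = int m + 1"
    have "cycles F n = boundaries F n"
      using ex[of m] dF[of "Suc m"] o1[of "Suc m"]
      by (simp add: m cycles_def boundaries_def dF o1 nonneg add.commute[of 1])
    thus ?thesis by (simp add: zero_homology_iff[OF cx])
  qed (use n in auto)
  moreover have "zero_module (obj F n)" if "n < 0" for n
    using that zero_module_free_empty[OF assms(1)] by (simp add: F_def)
  moreover have "\<exists>S. obj F n = free_module R S" for n by (auto simp: F_def)
  moreover have "obj F 0 = free_module R (S 0)" using nonneg[of 0] by simp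
  moreover have "boundaries F 0 = d 0 ` carrier (free_module R (S 1))"
    using dF[of 0] o1[of 0] by (simp add: boundaries_def)
  ultimately have "free_resolution R A F \<epsilon>"
    using assms(3) cx by (auto simp: free_resolution_def nat_resolution_def)
  thus ?thesis by blast
qed

section \<open>Tensor products\<close>

lemma tensor_ker_submodule:
  assumes "module R A" "module R B"
  shows "tensor_rels R A B \<subseteq> carrier (free_module R (carrier A \<times> carrier B))"
    and "submodule (tensor_ker R A B) R (free_module R (carrier A \<times> carrier B))"
proof -
  interpret A: module R A by fact
  interpret B: module R B by fact
  let ?F = "free_module R (carrier A \<times> carrier B)"
  interpret F: module R ?F by (rule module_free_module[OF A.is_cring])
  show "tensor_rels R A B \<subseteq> carrier ?F"
    unfolding tensor_rels_def Let_def by (auto intro!: F.minus_closed free_gen_closed[OF A.is_cring])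
  thus "submodule (tensor_ker R A B) R ?F"
    unfolding tensor_ker_def by (rule submodule_mod_span[OF F.module_axioms])
qed

lemma tensor_module:
  assumes "module R A" "module R B"
  shows "module R (tensor R A B)"
  unfolding tensor_def
  by (rule quot_module(1)[OF module_free_module tensor_ker_submodule(2)])
    (use assms in \<open>auto simp: module_def\<close>)

lemma
  assumes A: "module R A" and B: "module R B"
  shows pure_tensor_closed:
      "a \<in> carrier A \<Longrightarrow> b \<in> carrier B \<Longrightarrow> pure_tensor R A B a b \<in> carrier (tensor R A B)"
    and pure_tensor_add_left: "a \<in> carrier A \<Longrightarrow> a' \<in> carrier A \<Longrightarrow> b \<in> carrier B \<Longrightarrow>
      pure_tensor R A B (a \<oplus>\<^bsub>A\<^esub> a') b =
        pure_tensor R A B a b \<oplus>\<^bsub>tensor R A B\<^esub> pure_tensor R A B a' b"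
    and pure_tensor_add_right: "a \<in> carrier A \<Longrightarrow> b \<in> carrier B \<Longrightarrow> b' \<in> carrier B \<Longrightarrow>
      pure_tensor R A B a (b \<oplus>\<^bsub>B\<^esub> b') =
        pure_tensor R A B a b \<oplus>\<^bsub>tensor R A B\<^esub> pure_tensor R A B a b'"
    and pure_tensor_smult_left: "r \<in> carrier R \<Longrightarrow> a \<in> carrier A \<Longrightarrow> b \<in> carrier B \<Longrightarrow>
      pure_tensor R A B (r \<odot>\<^bsub>A\<^esub> a) b = r \<odot>\<^bsub>tensor R A B\<^esub> pure_tensor R A B a b"
    and pure_tensor_smult_right: "r \<in> carrier R \<Longrightarrow> a \<in> carrier A \<Longrightarrow> b \<in> carrier B \<Longrightarrow>
      pure_tensor R A B a (r \<odot>\<^bsub>B\<^esub> b) = r \<odot>\<^bsub>tensor R A B\<^esub> pure_tensor R A B a b"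
    and tensor_generated: "submodule H R (tensor R A B) \<Longrightarrow>
      (\<And>a b. a \<in> carrier A \<Longrightarrow> b \<in> carrier B \<Longrightarrow> pure_tensor R A B a b \<in> H) \<Longrightarrow>
      t \<in> carrier (tensor R A B) \<Longrightarrow> t \<in> H"
proof -
  interpret A: module R A by fact
  interpret B: module R B by fact
  let ?F = "free_module R (carrier A \<times> carrier B)"
  let ?K = "tensor_ker R A B" and ?T = "tensor R A B"
  interpret F: module R ?F by (rule module_free_module[OF A.is_cring])
  note K = tensor_ker_submodule(2)[OF A B]
  note q = quot_module[OF F.module_axioms K, folded tensor_def]
  note gen = free_gen_closed[OF A.is_cring]
  have rel: "?K +>\<^bsub>?F\<^esub> u = ?K +>\<^bsub>?F\<^esub> v"
    if "u \<ominus>\<^bsub>?F\<^esub> v \<in> tensor_rels R A B" "u \<in> carrier ?F" "v \<in> carrier ?F" for u v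
    unfolding a_coset_eq_iff[OF F.module_axioms K that(2,3)]
    using that(1) mod_span_base[of "tensor_rels R A B" R ?F] by (auto simp: tensor_ker_def)
  show closed: "pure_tensor R A B a b \<in> carrier ?T" if "a \<in> carrier A" "b \<in> carrier B" for a b
    using that gen[of "(a, b)"] by (auto simp: pure_tensor_def q(3))
  show "pure_tensor R A B (a \<oplus>\<^bsub>A\<^esub> a') b = pure_tensor R A B a b \<oplus>\<^bsub>?T\<^esub> pure_tensor R A B a' b"
    if h: "a \<in> carrier A" "a' \<in> carrier A" "b \<in> carrier B" for a a' b
  proof -
    have "pure_tensor R A B (a \<oplus>\<^bsub>A\<^esub> a') b =
        ?K +>\<^bsub>?F\<^esub> (free_gen R (a, b) \<oplus>\<^bsub>?F\<^esub> free_gen R (a', b))"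
      unfolding pure_tensor_def by (rule rel) (use h in \<open>auto simp: tensor_rels_def Let_def gen\<close>)
    thus ?thesis using h by (simp add: pure_tensor_def mod_hom_add[OF q(2)] gen)
  qed
  show "pure_tensor R A B a (b \<oplus>\<^bsub>B\<^esub> b') = pure_tensor R A B a b \<oplus>\<^bsub>?T\<^esub> pure_tensor R A B a b'"
    if h: "a \<in> carrier A" "b \<in> carrier B" "b' \<in> carrier B" for a b b'
  proof -
    have "pure_tensor R A B a (b \<oplus>\<^bsub>B\<^esub> b') =
        ?K +>\<^bsub>?F\<^esub> (free_gen R (a, b) \<oplus>\<^bsub>?F\<^esub> free_gen R (a, b'))"
      unfolding pure_tensor_def by (rule rel) (use h in \<open>auto simp: tensor_rels_def Let_def gen\<close>)
    thus ?thesis using h by (simp add: pure_tensor_def mod_hom_add[OF q(2)] gen)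
  qed
  show "pure_tensor R A B (r \<odot>\<^bsub>A\<^esub> a) b = r \<odot>\<^bsub>?T\<^esub> pure_tensor R A B a b"
    if h: "r \<in> carrier R" "a \<in> carrier A" "b \<in> carrier B" for r a b
  proof -
    have "pure_tensor R A B (r \<odot>\<^bsub>A\<^esub> a) b = ?K +>\<^bsub>?F\<^esub> (r \<odot>\<^bsub>?F\<^esub> free_gen R (a, b))"
      unfolding pure_tensor_def by (rule rel) (use h in \<open>auto simp: tensor_rels_def Let_def gen\<close>)
    thus ?thesis using h by (simp add: pure_tensor_def mod_hom_smult[OF q(2)] gen)
  qed
  show "pure_tensor R A B a (r \<odot>\<^bsub>B\<^esub> b) = r \<odot>\<^bsub>?T\<^esub> pure_tensor R A B a b"
    if h: "r \<in> carrier R" "a \<in> carrier A" "b \<in> carrier B" for r a b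
  proof -
    have "pure_tensor R A B a (r \<odot>\<^bsub>B\<^esub> b) = ?K +>\<^bsub>?F\<^esub> (r \<odot>\<^bsub>?F\<^esub> free_gen R (a, b))"
      unfolding pure_tensor_def by (rule rel) (use h in \<open>auto simp: tensor_rels_def Let_def gen\<close>)
    thus ?thesis using h by (simp add: pure_tensor_def mod_hom_smult[OF q(2)] gen)
  qed
  show "t \<in> H" if H: "submodule H R ?T" and t: "t \<in> carrier ?T"
    and p: "\<And>a b. a \<in> carrier A \<Longrightarrow> b \<in> carrier B \<Longrightarrow> pure_tensor R A B a b \<in> H"
  proof -
    obtain u where u: "u \<in> carrier ?F" "t = ?K +>\<^bsub>?F\<^esub> u" using t q(3) by auto
    have "u \<in> {u \<in> carrier ?F. ?K +>\<^bsub>?F\<^esub> u \<in> H}"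
      by (rule free_module_generated[OF A.is_cring submodule_preimage[OF F.module_axioms q(1,2) H] _ u(1)])
        (use p in \<open>auto simp: pure_tensor_def gen\<close>)
    thus ?thesis using u by simp
  qed
qed

lemma tensor_hom_eqI:
  assumes "module R A" "module R B" "module R P"
    and "f \<in> mod_hom R (tensor R A B) P" "g \<in> mod_hom R (tensor R A B) P"
    and "\<And>a b. a \<in> carrier A \<Longrightarrow> b \<in> carrier B \<Longrightarrow>
      f (pure_tensor R A B a b) = g (pure_tensor R A B a b)"
    and "t \<in> carrier (tensor R A B)"
  shows "f t = g t"
proof -
  have "t \<in> {t \<in> carrier (tensor R A B). f t = g t}"
    by (rule tensor_generated[OF assms(1,2) submodule_equalizer[OF tensor_module]])
      (use assms in \<open>auto intro: pure_tensor_closed\<close>)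
  thus ?thesis by simp
qed

lemma tensor_universal:
  assumes A: "module R A" and B: "module R B" and P: "module R P"
    and cl: "\<And>a b. a \<in> carrier A \<Longrightarrow> b \<in> carrier B \<Longrightarrow> \<beta> a b \<in> carrier P"
    and al: "\<And>a a' b. a \<in> carrier A \<Longrightarrow> a' \<in> carrier A \<Longrightarrow> b \<in> carrier B \<Longrightarrow>
      \<beta> (a \<oplus>\<^bsub>A\<^esub> a') b = \<beta> a b \<oplus>\<^bsub>P\<^esub> \<beta> a' b"
    and ar: "\<And>a b b'. a \<in> carrier A \<Longrightarrow> b \<in> carrier B \<Longrightarrow> b' \<in> carrier B \<Longrightarrow>
      \<beta> a (b \<oplus>\<^bsub>B\<^esub> b') = \<beta> a b \<oplus>\<^bsub>P\<^esub> \<beta> a b'"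
    and sl: "\<And>r a b. r \<in> carrier R \<Longrightarrow> a \<in> carrier A \<Longrightarrow> b \<in> carrier B \<Longrightarrow>
      \<beta> (r \<odot>\<^bsub>A\<^esub> a) b = r \<odot>\<^bsub>P\<^esub> \<beta> a b"
    and sr: "\<And>r a b. r \<in> carrier R \<Longrightarrow> a \<in> carrier A \<Longrightarrow> b \<in> carrier B \<Longrightarrow>
      \<beta> a (r \<odot>\<^bsub>B\<^esub> b) = r \<odot>\<^bsub>P\<^esub> \<beta> a b"
  obtains h where "h \<in> mod_hom R (tensor R A B) P"
    "\<And>a b. a \<in> carrier A \<Longrightarrow> b \<in> carrier B \<Longrightarrow> h (pure_tensor R A B a b) = \<beta> a b"
proof -
  interpret A: module R A by fact
  interpret B: module R B by fact
  interpret P: module R P by fact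
  let ?F = "free_module R (carrier A \<times> carrier B)"
  let ?K = "tensor_ker R A B" and ?T = "tensor R A B"
  interpret F: module R ?F by (rule module_free_module[OF A.is_cring])
  note K = tensor_ker_submodule(2)[OF A B]
  note q = quot_module[OF F.module_axioms K, folded tensor_def]
  note gen = free_gen_closed[OF A.is_cring]
  obtain h0 where h0: "h0 \<in> mod_hom R ?F P"
    and h0g: "\<And>x. x \<in> carrier A \<times> carrier B \<Longrightarrow> h0 (free_gen R x) = (case x of (a, b) \<Rightarrow> \<beta> a b)"
    using free_hom_exists[OF A.is_cring P, of "carrier A \<times> carrier B" "\<lambda>(a, b). \<beta> a b"] cl
    by auto
  have diff: "h0 (u \<ominus>\<^bsub>?F\<^esub> v) = \<zero>\<^bsub>P\<^esub>" if "u \<in> carrier ?F" "v \<in> carrier ?F" "h0 u = h0 v" for u v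
    using mod_hom_minus[OF F.module_axioms P h0 that(1,2)] module_minus_eq_zero_iff[OF P]
      mod_hom_closed[OF h0] that by simp
  \<comment> \<open>Every relator is a difference of two elements to which \<open>h0\<close> assigns
    the same value, by bilinearity of \<open>\<beta>\<close>.\<close>
  have "h0 x = \<zero>\<^bsub>P\<^esub>" if "x \<in> tensor_rels R A B" for x
    using that unfolding tensor_rels_def Let_def Un_iff mem_Collect_eq
    by (elim disjE exE conjE; simp only:; intro diff;
        simp add: gen mod_hom_add[OF h0] mod_hom_smult[OF h0] h0g al ar sl sr)
  hence "tensor_rels R A B \<subseteq> {u \<in> carrier ?F. h0 u = \<zero>\<^bsub>P\<^esub>}"
    using tensor_ker_submodule(1)[OF A B] by blast
  hence "?K \<subseteq> {u \<in> carrier ?F. h0 u = \<zero>\<^bsub>P\<^esub>}"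
    unfolding tensor_ker_def
    by (rule mod_span_subset[OF submodule_kernel[OF F.module_axioms P h0]])
  hence ker: "h0 u = \<zero>\<^bsub>P\<^esub>" if "u \<in> carrier ?F" "?K +>\<^bsub>?F\<^esub> u = \<zero>\<^bsub>?T\<^esub>" for u
    using that quot_module_eq_zero_iff[OF F.module_axioms K that(1), folded tensor_def] by auto
  obtain h where "h \<in> mod_hom R ?T P" "\<And>u. u \<in> carrier ?F \<Longrightarrow> h (?K +>\<^bsub>?F\<^esub> u) = h0 u"
    by (rule mod_hom_factor[OF F.module_axioms P q(2,1) _ h0 ker]) (use q(3) in auto)
  thus ?thesis using that[of h] h0g by (simp add: pure_tensor_def gen)
qed

abbreviation tensor_left ::
  "('r, 'z) ring_scheme \<Rightarrow> ('r, 'b) module \<Rightarrow> ('r, 'a) module \<Rightarrow> ('r, 'c) module \<Rightarrow> ('a \<Rightarrow> 'c) \<Rightarrow>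
     ('a \<times> 'b \<Rightarrow> 'r) set \<Rightarrow> ('c \<times> 'b \<Rightarrow> 'r) set" where
  "tensor_left R B A A' f \<equiv> tensor_map R A B A' B f (\<lambda>x. x)"

text \<open>\<open>tensor_map\<close> is a definite description. Existence comes from the universal
  property; uniqueness holds because pure tensors generate and the maps in \<open>Hom_module\<close>
  are extensional.\<close>

lemma
  assumes A: "module R A" and B: "module R B" and A': "module R A'" and f: "f \<in> mod_hom R A A'"
  shows tensor_left_hom: "tensor_left R B A A' f \<in> mod_hom R (tensor R A B) (tensor R A' B)"
    and tensor_left_pure: "\<And>a b. a \<in> carrier A \<Longrightarrow> b \<in> carrier B \<Longrightarrow>
      tensor_left R B A A' f (pure_tensor R A B a b) = pure_tensor R A' B (f a) b"
proof -
  let ?P = "\<lambda>h. h \<in> carrier (Hom_module R (tensor R A B) (tensor R A' B)) \<and>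
        (\<forall>a\<in>carrier A. \<forall>b\<in>carrier B. h (pure_tensor R A B a b) = pure_tensor R A' B (f a) b)"
  note T = tensor_module[OF A B] and T' = tensor_module[OF A' B]
  obtain h where h: "h \<in> mod_hom R (tensor R A B) (tensor R A' B)"
    "\<And>a b. a \<in> carrier A \<Longrightarrow> b \<in> carrier B \<Longrightarrow> h (pure_tensor R A B a b) = pure_tensor R A' B (f a) b"
    by (rule tensor_universal[OF A B T', of "\<lambda>a b. pure_tensor R A' B (f a) b"])
      (simp_all add: pure_tensor_closed[OF A' B] mod_hom_closed[OF f] mod_hom_add[OF f] mod_hom_smult[OF f]
        pure_tensor_add_left[OF A' B] pure_tensor_add_right[OF A' B]
        pure_tensor_smult_left[OF A' B] pure_tensor_smult_right[OF A' B])
  have "?P (restrict h (carrier (tensor R A B)))"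
    using h Hom_module_restrict[OF T h(1)] pure_tensor_closed[OF A B] by simp
  moreover have "h1 = h2" if "?P h1" "?P h2" for h1 h2
  proof (rule extensionalityI[where A = "carrier (tensor R A B)"])
    fix t assume "t \<in> carrier (tensor R A B)"
    thus "h1 t = h2 t"
      by (rule tensor_hom_eqI[OF A B T', rotated -1]) (use that in \<open>auto simp: Hom_module_simps\<close>)
  qed (use that in \<open>auto simp: Hom_module_simps\<close>)
  ultimately have "\<exists>!h. ?P h" by blast
  from theI'[OF this]
  have "?P (tensor_left R B A A' f)" unfolding tensor_map_def by simp
  thus "tensor_left R B A A' f \<in> mod_hom R (tensor R A B) (tensor R A' B)"
    "\<And>a b. a \<in> carrier A \<Longrightarrow> b \<in> carrier B \<Longrightarrow>
      tensor_left R B A A' f (pure_tensor R A B a b) = pure_tensor R A' B (f a) b"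
    by (auto simp: Hom_module_simps)
qed

lemma tensor_left_eqI:
  assumes "module R A" "module R B" "module R A'" "f \<in> mod_hom R A A'"
    and "h \<in> mod_hom R (tensor R A B) (tensor R A' B)"
    and "\<And>a b. a \<in> carrier A \<Longrightarrow> b \<in> carrier B \<Longrightarrow>
      h (pure_tensor R A B a b) = pure_tensor R A' B (f a) b"
    and "t \<in> carrier (tensor R A B)"
  shows "tensor_left R B A A' f t = h t"
  by (rule tensor_hom_eqI[OF assms(1,2) tensor_module[OF assms(3,2)] tensor_left_hom[OF assms(1-4)] assms(5) _ assms(7)])
    (simp add: tensor_left_pure[OF assms(1-4)] assms(6))

lemma tensor_left_comp:
  assumes A: "module R A" and B: "module R B" and A': "module R A'" and A'': "module R A''"
    and f: "f \<in> mod_hom R A A'" and g: "g \<in> mod_hom R A' A''" and t: "t \<in> carrier (tensor R A B)"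
  shows "tensor_left R B A A'' (\<lambda>x. g (f x)) t = tensor_left R B A' A'' g (tensor_left R B A A' f t)"
  by (rule tensor_left_eqI[OF A B A'' mod_hom_comp[OF f g] 
        mod_hom_comp[OF tensor_left_hom[OF A B A' f] tensor_left_hom[OF A' B A'' g]] _ t])
    (simp add: tensor_left_pure[OF A B A' f] tensor_left_pure[OF A' B A'' g] mod_hom_closed[OF f])

lemma tensor_left_cong:
  assumes "module R A" "module R B" "module R A'" "f \<in> mod_hom R A A'" "g \<in> mod_hom R A A'"
    and "\<And>x. x \<in> carrier A \<Longrightarrow> f x = g x" "t \<in> carrier (tensor R A B)"
  shows "tensor_left R B A A' f t = tensor_left R B A A' g t"
  by (rule tensor_left_eqI[OF assms(1-4) tensor_left_hom[OF assms(1-3,5)] _ assms(7)])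
    (simp add: tensor_left_pure[OF assms(1-3,5)] assms(6))

lemma tensor_left_id:
  assumes "module R A" "module R B" "f \<in> mod_hom R A A" "\<And>x. x \<in> carrier A \<Longrightarrow> f x = x"
    "t \<in> carrier (tensor R A B)"
  shows "tensor_left R B A A f t = t"
  by (rule tensor_left_eqI[OF assms(1,2,1,3) mod_hom_id _ assms(5)]) (simp add: assms(4))

lemma tensor_left_plus:
  assumes A: "module R A" and B: "module R B" and A': "module R A'"
    and f: "f \<in> mod_hom R A A'" and g: "g \<in> mod_hom R A A'" and t: "t \<in> carrier (tensor R A B)"
  shows "tensor_left R B A A' (\<lambda>x. f x \<oplus>\<^bsub>A'\<^esub> g x) t =
    tensor_left R B A A' f t \<oplus>\<^bsub>tensor R A' B\<^esub> tensor_left R B A A' g t"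
  by (rule tensor_left_eqI[OF A B A' mod_hom_plus[OF A' f g]
        mod_hom_plus[OF tensor_module[OF A' B] tensor_left_hom[OF A B A' f] tensor_left_hom[OF A B A' g]] _ t])
    (simp add: tensor_left_pure[OF A B A' f] tensor_left_pure[OF A B A' g] mod_hom_closed[OF f]
      mod_hom_closed[OF g] pure_tensor_add_left[OF A' B])

lemma tensor_left_scale:
  assumes A: "module R A" and B: "module R B" and A': "module R A'"
    and f: "f \<in> mod_hom R A A'" and r: "r \<in> carrier R" and t: "t \<in> carrier (tensor R A B)"
  shows "tensor_left R B A A' (\<lambda>x. r \<odot>\<^bsub>A'\<^esub> f x) t =
    r \<odot>\<^bsub>tensor R A' B\<^esub> tensor_left R B A A' f t"
  by (rule tensor_left_eqI[OF A B A' mod_hom_scale[OF A' f r]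
        mod_hom_scale[OF tensor_module[OF A' B] tensor_left_hom[OF A B A' f] r] _ t])
    (simp add: tensor_left_pure[OF A B A' f] mod_hom_closed[OF f] r pure_tensor_smult_left[OF A' B])

lemma pure_tensor_zero_left:
  assumes A: "module R A" and B: "module R B" and b: "b \<in> carrier B"
  shows "pure_tensor R A B \<zero>\<^bsub>A\<^esub> b = \<zero>\<^bsub>tensor R A B\<^esub>"
proof -
  have "(\<lambda>a. pure_tensor R A B a b) \<in> mod_hom R A (tensor R A B)"
    by (rule mod_homI) (use b in \<open>auto simp: pure_tensor_closed[OF A B] pure_tensor_add_left[OF A B]
      pure_tensor_smult_left[OF A B]\<close>)
  from mod_hom_zero[OF A tensor_module[OF A B] this] show ?thesis .
qed

lemma tensor_left_zero:
  assumes A: "module R A" and B: "module R B" and A': "module R A'" 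
    and f: "f \<in> mod_hom R A A'" "\<And>x. x \<in> carrier A \<Longrightarrow> f x = \<zero>\<^bsub>A'\<^esub>"
    and t: "t \<in> carrier (tensor R A B)"
  shows "tensor_left R B A A' f t = \<zero>\<^bsub>tensor R A' B\<^esub>"
  by (rule tensor_left_eqI[OF A B A' f(1) mod_hom_const_zero[OF tensor_module[OF A' B]] _ t])
    (simp add: f(2) pure_tensor_zero_left[OF A' B])

lemma tensor_left_surj:
  assumes A: "module R A" and B: "module R B" and A': "module R A'"
    and f: "f \<in> mod_hom R A A'" and surj: "f ` carrier A = carrier A'"
  shows "tensor_left R B A A' f ` carrier (tensor R A B) = carrier (tensor R A' B)"
proof -
  note h = tensor_left_hom[OF A B A' f]
  have "t \<in> tensor_left R B A A' f ` carrier (tensor R A B)" if "t \<in> carrier (tensor R A' B)" for t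
  proof (rule tensor_generated[OF A' B submodule_image[OF tensor_module[OF A B] tensor_module[OF A' B] h] _ that])
    fix a b assume "a \<in> carrier A'" and b: "b \<in> carrier B"
    then obtain x where "x \<in> carrier A" "a = f x" using surj by auto
    thus "pure_tensor R A' B a b \<in> tensor_left R B A A' f ` carrier (tensor R A B)"
      using tensor_left_pure[OF A B A' f _ b] pure_tensor_closed[OF A B _ b] by (metis imageI)
  qed
  thus ?thesis using mod_hom_closed[OF h] by blast
qed

text \<open>Let \<open>Q\<close> be \<open>A' \<otimes> B\<close> modulo the image of
  \<open>d \<otimes> B\<close>. Sending \<open>(e x, b)\<close> to the class of
  \<open>x \<otimes> b\<close> is well defined, since the kernel of \<open>e\<close> lies in the
  image of \<open>d\<close>, and induces \<open>h: A'' \<otimes> B \<rightarrow> Q\<close> whose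
  composite with \<open>e \<otimes> B\<close> is the projection. An element killed by
  \<open>e \<otimes> B\<close> therefore has class zero.\<close>

lemma tensor_right_exact:
  assumes A: "module R A" and B: "module R B" and A': "module R A'" and A'': "module R A''"
    and d: "d \<in> mod_hom R A A'" and e: "e \<in> mod_hom R A' A''" and surj: "e ` carrier A' = carrier A''"
    and ker: "\<And>x. x \<in> carrier A' \<Longrightarrow> e x = \<zero>\<^bsub>A''\<^esub> \<Longrightarrow> x \<in> d ` carrier A"
    and t: "t \<in> carrier (tensor R A' B)" "tensor_left R B A' A'' e t = \<zero>\<^bsub>tensor R A'' B\<^esub>"
  shows "t \<in> tensor_left R B A A' d ` carrier (tensor R A B)"
proof -
  let ?T = "tensor R A B" and ?T' = "tensor R A' B" and ?T'' = "tensor R A'' B"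
  note T = tensor_module[OF A B] and T' = tensor_module[OF A' B] and T'' = tensor_module[OF A'' B]
  note td = tensor_left_hom[OF A B A' d] and te = tensor_left_hom[OF A' B A'' e]
  define I where "I = tensor_left R B A A' d ` carrier ?T"
  have I: "submodule I R ?T'" unfolding I_def by (rule submodule_image[OF T T' td])
  note q = quot_module[OF T' I]
  define Q where "Q = quot_module ?T' I"
  have qm: "module R Q" unfolding Q_def by (rule q(1))
  have qh: "(\<lambda>x. I +>\<^bsub>?T'\<^esub> x) \<in> mod_hom R ?T' Q" unfolding Q_def by (rule q(2))
  define \<beta> where "\<beta> b = (\<lambda>x. I +>\<^bsub>?T'\<^esub> pure_tensor R A' B x b)" for b
  have \<beta>h: "\<beta> b \<in> mod_hom R A' Q" if b: "b \<in> carrier B" for b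
    unfolding \<beta>_def
    by (rule mod_homI) (use b in \<open>simp_all add: pure_tensor_closed[OF A' B] mod_hom_closed[OF qh]
      mod_hom_add[OF qh] mod_hom_smult[OF qh] pure_tensor_add_left[OF A' B] pure_tensor_smult_left[OF A' B]\<close>)
  have "\<forall>b\<in>carrier B. \<exists>g. g \<in> mod_hom R A'' Q \<and> (\<forall>x\<in>carrier A'. g (e x) = \<beta> b x)"
  proof
    fix b assume b: "b \<in> carrier B"
    have k: "\<beta> b x = \<zero>\<^bsub>Q\<^esub>" if x: "x \<in> carrier A'" "e x = \<zero>\<^bsub>A''\<^esub>" for x
    proof -
      obtain y where y: "y \<in> carrier A" "x = d y" using ker[OF x] by auto
      have "pure_tensor R A' B x b \<in> I"
        unfolding I_def using y tensor_left_pure[OF A B A' d y(1) b] pure_tensor_closed[OF A B y(1) b]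
        by (metis imageI)
      thus ?thesis
        using quot_module_eq_zero_iff[OF T' I pure_tensor_closed[OF A' B x(1) b]] by (simp add: \<beta>_def Q_def)
    qed
    obtain g where "g \<in> mod_hom R A'' Q" "\<And>x. x \<in> carrier A' \<Longrightarrow> g (e x) = \<beta> b x"
      by (rule mod_hom_factor[OF A' qm e A'' _ \<beta>h[OF b] k]) (use surj in auto)
    thus "\<exists>g. g \<in> mod_hom R A'' Q \<and> (\<forall>x\<in>carrier A'. g (e x) = \<beta> b x)" by blast
  qed
  then obtain g where g: "\<And>b. b \<in> carrier B \<Longrightarrow> g b \<in> mod_hom R A'' Q"
    "\<And>b x. b \<in> carrier B \<Longrightarrow> x \<in> carrier A' \<Longrightarrow> g b (e x) = \<beta> b x" by metis
  interpret B: module R B by fact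
  interpret A': module R A' by fact
  have pre: "\<exists>x\<in>carrier A'. a = e x" if "a \<in> carrier A''" for a using that surj by auto
  obtain h where h: "h \<in> mod_hom R ?T'' Q"
    "\<And>a b. a \<in> carrier A'' \<Longrightarrow> b \<in> carrier B \<Longrightarrow> h (pure_tensor R A'' B a b) = g b a"
  proof (rule tensor_universal[OF A'' B qm, of "\<lambda>a b. g b a"])
    fix a b b' assume "a \<in> carrier A''" and b: "b \<in> carrier B" "b' \<in> carrier B"
    then obtain x where x: "x \<in> carrier A'" "a = e x" using pre by blast
    show "g (b \<oplus>\<^bsub>B\<^esub> b') a = g b a \<oplus>\<^bsub>Q\<^esub> g b' a"
      using x b by (simp add: g(2) \<beta>_def pure_tensor_add_right[OF A' B] mod_hom_add[OF qh]
          pure_tensor_closed[OF A' B])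
  next
    fix r a b assume r: "r \<in> carrier R" and "a \<in> carrier A''" and b: "b \<in> carrier B"
    then obtain x where x: "x \<in> carrier A'" "a = e x" using pre by blast
    show "g (r \<odot>\<^bsub>B\<^esub> b) a = r \<odot>\<^bsub>Q\<^esub> g b a"
      using x b r by (simp add: g(2) \<beta>_def pure_tensor_smult_right[OF A' B] mod_hom_smult[OF qh]
          pure_tensor_closed[OF A' B])
  qed (auto simp: mod_hom_closed[OF g(1)] mod_hom_add[OF g(1)] mod_hom_smult[OF g(1)])
  have "h (tensor_left R B A' A'' e t) = I +>\<^bsub>?T'\<^esub> t"
    by (rule tensor_hom_eqI[OF A' B qm mod_hom_comp[OF te h(1)] qh _ t(1)])
      (simp add: tensor_left_pure[OF A' B A'' e] h(2) mod_hom_closed[OF e] g(2) \<beta>_def)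
  hence "I +>\<^bsub>?T'\<^esub> t = \<zero>\<^bsub>Q\<^esub>" using t(2) mod_hom_zero[OF T'' qm h(1)] by simp
  thus ?thesis using quot_module_eq_zero_iff[OF T' I t(1)] by (simp add: Q_def I_def)
qed

section \<open>Injective modules and comparison of resolutions\<close>

text \<open>Injectivity is only tested on modules carried by \<open>('r + 'i) list\<close>, so the
  inclusion of \<open>J\<close> into \<open>R\<close> is first copied into that type by
  \<open>r \<mapsto> [Inl r]\<close>. The element \<open>e\<close> is the value at 1 of the extended
  map.\<close>

lemma injective_module_baer:
  fixes I :: "('r, 'i) module"
  assumes inj: "injective_module R I" and R: "cring R"
    and J: "submodule J R (ring_module R)" and g: "g \<in> mod_hom R ((ring_module R)\<lparr>carrier := J\<rparr>) I"
  obtains e where "e \<in> carrier I" "\<And>r. r \<in> J \<Longrightarrow> g r = r \<odot>\<^bsub>I\<^esub> e"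
proof -
  interpret R: cring R by fact
  define \<pi> :: "'r \<Rightarrow> ('r + 'i) list" where "\<pi> r = [Inl r]" for r
  define \<sigma> :: "('r + 'i) list \<Rightarrow> 'r" where "\<sigma> l = projl (hd l)" for l
  have \<sigma>\<pi>: "\<sigma> (\<pi> r) = r" for r by (simp add: \<pi>_def \<sigma>_def)
  define B :: "('r, ('r + 'i) list) module" where
    "B = \<lparr>carrier = \<pi> ` carrier R, mult = undefined, one = undefined, zero = \<pi> \<zero>\<^bsub>R\<^esub>,
      add = (\<lambda>x y. \<pi> (\<sigma> x \<oplus>\<^bsub>R\<^esub> \<sigma> y)), smult = (\<lambda>r x. \<pi> (r \<otimes>\<^bsub>R\<^esub> \<sigma> x))\<rparr>"
  have rm: "module R (ring_module R)" by (rule module_ring_module[OF R])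
  have *: "\<pi> ` carrier (ring_module R) = carrier B" "\<pi> \<zero>\<^bsub>ring_module R\<^esub> = \<zero>\<^bsub>B\<^esub>"
    "\<And>x y. \<pi> (x \<oplus>\<^bsub>ring_module R\<^esub> y) = \<pi> x \<oplus>\<^bsub>B\<^esub> \<pi> y"
    "\<And>r x. \<pi> (r \<odot>\<^bsub>ring_module R\<^esub> x) = r \<odot>\<^bsub>B\<^esub> \<pi> x"
    by (simp_all add: B_def ring_module_def \<sigma>\<pi>)
  have B: "module R B" by (rule module_of_surjection(1)[OF rm *])
  have \<pi>: "\<pi> \<in> mod_hom R (ring_module R) B" by (rule module_of_surjection(2)[OF rm *])
  have \<sigma>: "\<sigma> \<in> mod_hom R B (ring_module R)"
    by (rule mod_homI) (auto simp: B_def \<sigma>\<pi> ring_module_def)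
  have Jm: "module R ((ring_module R)\<lparr>carrier := J\<rparr>)" by (rule submodule_module[OF J rm])
  have A: "submodule (\<pi> ` J) R B"
    using submodule_image[OF Jm B mod_hom_restrict_dom[OF \<pi> submodule_subset[OF J]]] by simp
  let ?A = "B\<lparr>carrier := \<pi> ` J\<rparr>"
  have gA: "(\<lambda>x. g (\<sigma> x)) \<in> mod_hom R ?A I"
    by (rule mod_hom_comp[OF mod_hom_into_sub[OF mod_hom_restrict_dom[OF \<sigma> submodule_subset[OF A]]] g])
      (auto simp: \<sigma>\<pi>)
  have id: "(\<lambda>x. x) \<in> mod_hom R ?A B"
    by (rule mod_hom_restrict_dom[OF mod_hom_id submodule_subset[OF A]])
  obtain h where h: "h \<in> mod_hom R B I" "\<And>a. a \<in> \<pi> ` J \<Longrightarrow> h a = g (\<sigma> a)"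
    using inj[unfolded injective_module_def, THEN conjunct2, rule_format, OF submodule_module[OF A B] B id _ gA]
    by auto
  have one: "\<one>\<^bsub>R\<^esub> \<in> carrier (ring_module R)" by (simp add: ring_module_def)
  show ?thesis
  proof
    show "h (\<pi> \<one>\<^bsub>R\<^esub>) \<in> carrier I" using mod_hom_closed[OF h(1) mod_hom_closed[OF \<pi> one]] .
    fix r assume r: "r \<in> J"
    hence rc: "r \<in> carrier R" using submodule_subset[OF J] by (auto simp: ring_module_def)
    have "g r = h (\<pi> r)" using r by (simp add: h(2) \<sigma>\<pi>)
    also have "\<pi> r = r \<odot>\<^bsub>B\<^esub> \<pi> \<one>\<^bsub>R\<^esub>" using rc by (simp add: B_def \<sigma>\<pi>)
    also have "h \<dots> = r \<odot>\<^bsub>I\<^esub> h (\<pi> \<one>\<^bsub>R\<^esub>)"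
      by (rule mod_hom_smult[OF h(1) rc mod_hom_closed[OF \<pi> one]])
    finally show "g r = r \<odot>\<^bsub>I\<^esub> h (\<pi> \<one>\<^bsub>R\<^esub>)" .
  qed
qed

lemma smult_hom:
  assumes "module R M" "x \<in> carrier M"
  shows "(\<lambda>r. r \<odot>\<^bsub>M\<^esub> x) \<in> mod_hom R (ring_module R) M"
proof -
  interpret module R M by fact
  show ?thesis
    by (rule mod_homI) (use assms(2) in \<open>auto simp: ring_module_def smult_l_distr smult_assoc1\<close>)
qed

text \<open>The step in the proof of Baer's criterion. The map \<open>r \<mapsto> g (r b)\<close> on
  the ideal \<open>J\<close> of all \<open>r\<close> with \<open>r b \<in> H\<close> is
  multiplication by some \<open>e\<close>, and \<open>g\<close> extends to \<open>H + R b\<close> by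
  \<open>h + r b \<mapsto> g h + r e\<close>. Two representations of one element have
  \<open>h - h' = (r' - r) b\<close> with \<open>r' - r \<in> J\<close>, whence the value is well
  defined.\<close>

lemma injective_extend_one:
  assumes inj: "injective_module R E" and B: "module R B" and H: "submodule H R B"
    and g: "g \<in> mod_hom R (B\<lparr>carrier := H\<rparr>) E" and b: "b \<in> carrier B"
  obtains H' g' where "submodule H' R B" "insert b H \<subseteq> H'" "g' \<in> mod_hom R (B\<lparr>carrier := H'\<rparr>) E"
    "\<And>x. x \<in> H \<Longrightarrow> g' x = g x"
proof -
  have E: "module R E" using inj by (simp add: injective_module_def)
  interpret B: module R B by fact
  interpret E: module R E by fact
  let ?H = "B\<lparr>carrier := H\<rparr>" and ?R = "ring_module R"
  have HB: "H \<subseteq> carrier B" by (rule submodule_subset[OF H])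
  have Hm: "module R ?H" by (rule submodule_module[OF H B])
  note rm = module_ring_module[OF B.is_cring] and sb = smult_hom[OF B b]
  define J where "J = {r \<in> carrier ?R. r \<odot>\<^bsub>B\<^esub> b \<in> H}"
  have J: "submodule J R ?R" unfolding J_def by (rule submodule_preimage[OF rm B sb H])
  have JR: "J \<subseteq> carrier ?R" by (rule submodule_subset[OF J])
  have "(\<lambda>r. r \<odot>\<^bsub>B\<^esub> b) \<in> mod_hom R (?R\<lparr>carrier := J\<rparr>) ?H"
    by (rule mod_hom_into_sub[OF mod_hom_restrict_dom[OF sb JR]]) (simp add: J_def)
  from mod_hom_comp[OF this g] obtain e where e: "e \<in> carrier E" "\<And>r. r \<in> J \<Longrightarrow> g (r \<odot>\<^bsub>B\<^esub> b) = r \<odot>\<^bsub>E\<^esub> e"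
    by (rule injective_module_baer[OF inj B.is_cring J]) blast
  define H' where "H' = {h \<oplus>\<^bsub>B\<^esub> r \<odot>\<^bsub>B\<^esub> b | h r. h \<in> H \<and> r \<in> carrier R}"
  have uniq: "g h \<oplus>\<^bsub>E\<^esub> r \<odot>\<^bsub>E\<^esub> e = g h' \<oplus>\<^bsub>E\<^esub> r' \<odot>\<^bsub>E\<^esub> e"
    if h: "h \<in> H" "r \<in> carrier R" "h' \<in> H" "r' \<in> carrier R"
      and eq: "h \<oplus>\<^bsub>B\<^esub> r \<odot>\<^bsub>B\<^esub> b = h' \<oplus>\<^bsub>B\<^esub> r' \<odot>\<^bsub>B\<^esub> b" for h r h' r'
  proof -
    have hc: "h \<in> carrier B" "h' \<in> carrier B" using h HB by auto
    have s: "(r' \<ominus>\<^bsub>R\<^esub> r) \<odot>\<^bsub>B\<^esub> b = h \<ominus>\<^bsub>B\<^esub> h'"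
    proof -
      have "(r' \<ominus>\<^bsub>R\<^esub> r) \<odot>\<^bsub>B\<^esub> b = \<ominus>\<^bsub>B\<^esub> h' \<oplus>\<^bsub>B\<^esub> (h' \<oplus>\<^bsub>B\<^esub> r' \<odot>\<^bsub>B\<^esub> b) \<ominus>\<^bsub>B\<^esub> r \<odot>\<^bsub>B\<^esub> b"
        using h hc b by (simp add: a_minus_def B.smult_l_distr B.smult_l_minus B.r_neg1)
      also have "\<dots> = h \<ominus>\<^bsub>B\<^esub> h'"
        unfolding eq[symmetric] using h hc b
        by (simp add: a_minus_def B.a_ac B.r_neg)
      finally show ?thesis .
    qed
    have d: "h \<ominus>\<^bsub>B\<^esub> h' \<in> H" using B.submoduleE(3,5)[OF H] h by (simp add: a_minus_def)
    have "r' \<ominus>\<^bsub>R\<^esub> r \<in> J" using s d h by (simp add: J_def ring_module_def)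
    hence "g (h \<ominus>\<^bsub>B\<^esub> h') = (r' \<ominus>\<^bsub>R\<^esub> r) \<odot>\<^bsub>E\<^esub> e" using e(2) s by metis
    also have "\<dots> = r' \<odot>\<^bsub>E\<^esub> e \<ominus>\<^bsub>E\<^esub> r \<odot>\<^bsub>E\<^esub> e"
      using h e by (simp add: a_minus_def E.smult_l_distr E.smult_l_minus)
    finally have k: "g (h \<ominus>\<^bsub>B\<^esub> h') = r' \<odot>\<^bsub>E\<^esub> e \<ominus>\<^bsub>E\<^esub> r \<odot>\<^bsub>E\<^esub> e" .
    have gc: "g h \<in> carrier E" "g h' \<in> carrier E" using h by (auto intro: mod_hom_closed[OF g])
    have "g h = g ((h \<ominus>\<^bsub>B\<^esub> h') \<oplus>\<^bsub>B\<^esub> h')" using hc by (simp add: a_minus_def B.a_assoc B.l_neg)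
    also have "\<dots> = g (h \<ominus>\<^bsub>B\<^esub> h') \<oplus>\<^bsub>E\<^esub> g h'" using mod_hom_add[OF g, of "h \<ominus>\<^bsub>B\<^esub> h'" h'] d h by simp
    finally show ?thesis
      using h e gc unfolding k by (simp add: a_minus_def E.a_ac E.r_neg E.r_neg1)
  qed
  define g' where "g' x = (THE y. \<exists>h\<in>H. \<exists>r\<in>carrier R. x = h \<oplus>\<^bsub>B\<^esub> r \<odot>\<^bsub>B\<^esub> b \<and> y = g h \<oplus>\<^bsub>E\<^esub> r \<odot>\<^bsub>E\<^esub> e)" for x
  have g'_eq: "g' (h \<oplus>\<^bsub>B\<^esub> r \<odot>\<^bsub>B\<^esub> b) = g h \<oplus>\<^bsub>E\<^esub> r \<odot>\<^bsub>E\<^esub> e" if "h \<in> H" "r \<in> carrier R" for h r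
    unfolding g'_def
  proof (rule the_equality)
    show "\<exists>ha\<in>H. \<exists>ra\<in>carrier R. h \<oplus>\<^bsub>B\<^esub> r \<odot>\<^bsub>B\<^esub> b = ha \<oplus>\<^bsub>B\<^esub> ra \<odot>\<^bsub>B\<^esub> b \<and>
        g h \<oplus>\<^bsub>E\<^esub> r \<odot>\<^bsub>E\<^esub> e = g ha \<oplus>\<^bsub>E\<^esub> ra \<odot>\<^bsub>E\<^esub> e"
      using that by blast
  next
    fix y assume "\<exists>ha\<in>H. \<exists>ra\<in>carrier R. h \<oplus>\<^bsub>B\<^esub> r \<odot>\<^bsub>B\<^esub> b = ha \<oplus>\<^bsub>B\<^esub> ra \<odot>\<^bsub>B\<^esub> b \<and>
        y = g ha \<oplus>\<^bsub>E\<^esub> ra \<odot>\<^bsub>E\<^esub> e"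
    thus "y = g h \<oplus>\<^bsub>E\<^esub> r \<odot>\<^bsub>E\<^esub> e" using uniq that by metis
  qed
  have add_eq: "(h \<oplus>\<^bsub>B\<^esub> r \<odot>\<^bsub>B\<^esub> b) \<oplus>\<^bsub>B\<^esub> (h' \<oplus>\<^bsub>B\<^esub> r' \<odot>\<^bsub>B\<^esub> b) = (h \<oplus>\<^bsub>B\<^esub> h') \<oplus>\<^bsub>B\<^esub> (r \<oplus>\<^bsub>R\<^esub> r') \<odot>\<^bsub>B\<^esub> b"
    if "h \<in> H" "r \<in> carrier R" "h' \<in> H" "r' \<in> carrier R" for h r h' r'
    using that HB b by (simp add: B.smult_l_distr B.a_ac subset_eq)
  have smult_eq: "s \<odot>\<^bsub>B\<^esub> (h \<oplus>\<^bsub>B\<^esub> r \<odot>\<^bsub>B\<^esub> b) = (s \<odot>\<^bsub>B\<^esub> h) \<oplus>\<^bsub>B\<^esub> (s \<otimes>\<^bsub>R\<^esub> r) \<odot>\<^bsub>B\<^esub> b"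
    if "h \<in> H" "r \<in> carrier R" "s \<in> carrier R" for h r s
    using that HB b by (simp add: B.smult_r_distr B.smult_assoc1 subset_eq)
  show ?thesis
  proof
    show "submodule H' R B"
    proof (rule B.submoduleI)
      show "H' \<subseteq> carrier B" using HB b by (auto simp: H'_def)
      show "\<zero>\<^bsub>B\<^esub> \<in> H'"
        unfolding H'_def using submodule_zero_mem[OF H] b
        by (auto intro!: exI[of _ "\<zero>\<^bsub>B\<^esub>"] exI[of _ "\<zero>\<^bsub>R\<^esub>"])
      show ad: "x \<oplus>\<^bsub>B\<^esub> y \<in> H'" if "x \<in> H'" "y \<in> H'" for x y
        using that unfolding H'_def mem_Collect_eq by (metis add_eq B.submoduleE(5)[OF H] B.R.a_closed)
      show sm: "s \<odot>\<^bsub>B\<^esub> x \<in> H'" if "s \<in> carrier R" "x \<in> H'" for s x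
        using that unfolding H'_def mem_Collect_eq by (metis smult_eq B.submoduleE(4)[OF H] B.R.m_closed)
      show "\<ominus>\<^bsub>B\<^esub> x \<in> H'" if x: "x \<in> H'" for x
      proof -
        have xc: "x \<in> carrier B" using x HB b by (auto simp: H'_def)
        have "(\<ominus>\<^bsub>R\<^esub> \<one>\<^bsub>R\<^esub>) \<odot>\<^bsub>B\<^esub> x = \<ominus>\<^bsub>B\<^esub> x" using xc by (simp add: B.smult_l_minus)
        thus ?thesis using sm[of "\<ominus>\<^bsub>R\<^esub> \<one>\<^bsub>R\<^esub>" x] x by simp
      qed
    qed
    have inH: "h \<oplus>\<^bsub>B\<^esub> \<zero>\<^bsub>R\<^esub> \<odot>\<^bsub>B\<^esub> b = h" if "h \<in> H" for h using that HB b by (simp add: subset_eq)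
    have "h \<in> H'" if "h \<in> H" for h
      unfolding H'_def mem_Collect_eq using inH[OF that] that B.R.zero_closed by metis
    moreover have "b \<in> H'"
      unfolding H'_def using submodule_zero_mem[OF H] b
      by (auto intro!: exI[of _ "\<zero>\<^bsub>B\<^esub>"] exI[of _ "\<one>\<^bsub>R\<^esub>"])
    ultimately show "insert b H \<subseteq> H'" by auto
    show "g' x = g x" if x: "x \<in> H" for x
      using g'_eq[OF x B.R.zero_closed] inH[OF x] mod_hom_closed[OF g] x e(1) by simp
    show "g' \<in> mod_hom R (B\<lparr>carrier := H'\<rparr>) E"
    proof (rule mod_homI)
      fix x assume "x \<in> carrier (B\<lparr>carrier := H'\<rparr>)"
      then obtain h r where x: "h \<in> H" "r \<in> carrier R" "x = h \<oplus>\<^bsub>B\<^esub> r \<odot>\<^bsub>B\<^esub> b" by (auto simp: H'_def)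
      have gh: "g h \<in> carrier E" using mod_hom_closed[OF g] x by simp
      show "g' x \<in> carrier E" using x gh e(1) by (simp add: g'_eq)
      show "g' (s \<odot>\<^bsub>B\<lparr>carrier := H'\<rparr>\<^esub> x) = s \<odot>\<^bsub>E\<^esub> g' x" if s: "s \<in> carrier R" for s
        using x gh e(1) s B.submoduleE(4)[OF H] mod_hom_smult[OF g, of s h]
        by (simp add: g'_eq smult_eq E.smult_r_distr E.smult_assoc1)
      fix y assume "y \<in> carrier (B\<lparr>carrier := H'\<rparr>)"
      then obtain h' r' where y: "h' \<in> H" "r' \<in> carrier R" "y = h' \<oplus>\<^bsub>B\<^esub> r' \<odot>\<^bsub>B\<^esub> b" by (auto simp: H'_def)
      have gh': "g h' \<in> carrier E" using mod_hom_closed[OF g] y by simp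
      show "g' (x \<oplus>\<^bsub>B\<lparr>carrier := H'\<rparr>\<^esub> y) = g' x \<oplus>\<^bsub>E\<^esub> g' y"
        using x y gh gh' e(1) B.submoduleE(5)[OF H] mod_hom_add[OF g, of h h']
        by (simp add: g'_eq add_eq E.smult_l_distr E.a_ac)
    qed
  qed
qed

lemma injective_extend:
  assumes inj: "injective_module R E" and M: "module R M" and B: "module R B" and fg: "fin_gen R B"
    and k: "k \<in> mod_hom R M B" and g: "g \<in> mod_hom R M E"
    and ker: "\<And>x. x \<in> carrier M \<Longrightarrow> k x = \<zero>\<^bsub>B\<^esub> \<Longrightarrow> g x = \<zero>\<^bsub>E\<^esub>"
  obtains h where "h \<in> mod_hom R B E" "\<And>x. x \<in> carrier M \<Longrightarrow> h (k x) = g x"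
proof -
  have E: "module R E" using inj by (simp add: injective_module_def)
  interpret B: module R B by fact
  let ?H = "k ` carrier M"
  have H: "submodule ?H R B" by (rule submodule_image[OF M B k])
  have kH: "k \<in> mod_hom R M (B\<lparr>carrier := ?H\<rparr>)" by (rule mod_hom_into_sub[OF k]) auto
  obtain g0 where g0: "g0 \<in> mod_hom R (B\<lparr>carrier := ?H\<rparr>) E" "\<And>x. x \<in> carrier M \<Longrightarrow> g0 (k x) = g x"
    by (rule mod_hom_factor[OF M E kH submodule_module[OF H B] _ g]) (use ker in auto)
  obtain X where X: "finite X" "X \<subseteq> carrier B" "mod_span R B X = carrier B"
    using fg by (auto simp: fin_gen_def)
  have "\<exists>H' g'. submodule H' R B \<and> ?H \<union> Y \<subseteq> H' \<and> g' \<in> mod_hom R (B\<lparr>carrier := H'\<rparr>) E \<and>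
      (\<forall>x\<in>?H. g' x = g0 x)" if "finite Y" "Y \<subseteq> X" for Y
    using that
  proof (induction rule: finite_induct)
    case empty
    thus ?case using H g0 by (intro exI[of _ ?H] exI[of _ g0]) auto
  next
    case (insert y Y)
    hence "Y \<subseteq> X" by simp
    from insert.IH[OF this] obtain H' g' where H': "submodule H' R B" "?H \<union> Y \<subseteq> H'"
      "g' \<in> mod_hom R (B\<lparr>carrier := H'\<rparr>) E" "\<forall>x\<in>?H. g' x = g0 x" by blast
    have y: "y \<in> carrier B" using insert X by auto
    obtain H'' g'' where H'': "submodule H'' R B" "insert y H' \<subseteq> H''" "g'' \<in> mod_hom R (B\<lparr>carrier := H''\<rparr>) E"
      "\<And>x. x \<in> H' \<Longrightarrow> g'' x = g' x"
      using injective_extend_one[OF inj B H'(1,3) y] by blast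
    have "g'' x = g0 x" if "x \<in> ?H" for x using that H'(2,4) H''(4) by auto
    thus ?case using H'(2) H''(1,2,3) by (intro exI[of _ H''] exI[of _ g'']) auto
  qed
  from this[OF X(1)] obtain H' g' where H': "submodule H' R B" "?H \<union> X \<subseteq> H'"
    "g' \<in> mod_hom R (B\<lparr>carrier := H'\<rparr>) E" "\<And>x. x \<in> ?H \<Longrightarrow> g' x = g0 x" by blast
  have "carrier B \<subseteq> H'" using mod_span_subset[OF H'(1), of X] X(3) H'(2) by auto
  hence "H' = carrier B" using submodule_subset[OF H'(1)] by auto
  hence "g' \<in> mod_hom R B E" using H'(3) by simp
  thus ?thesis using that H'(4) g0(2) by simp
qed

text \<open>The inclusion of the kernel in the image at the middle term of
  \<open>Hom(S, N) \<rightarrow> Hom(Q, N) \<rightarrow> Hom(P, N)\<close>. It is phrased with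
  functions in \<open>mod_hom\<close>, which need not be extensional, so that composites can be used
  without restricting them.\<close>

definition hom_exact ::
  "('r, 'z) ring_scheme \<Rightarrow> ('r, 'a) module \<Rightarrow> ('a \<Rightarrow> 'b) \<Rightarrow> ('r, 'b) module \<Rightarrow> ('b \<Rightarrow> 'c) \<Rightarrow>
     ('r, 'c) module \<Rightarrow> ('r, 'n) module \<Rightarrow> bool" where
  "hom_exact R P a Q b S N \<longleftrightarrow>
     (\<forall>w\<in>mod_hom R Q N. (\<forall>x\<in>carrier P. w (a x) = \<zero>\<^bsub>N\<^esub>) \<longrightarrow>
        (\<exists>v\<in>mod_hom R S N. \<forall>y\<in>carrier Q. w y = v (b y)))"

definition hom_lifts ::
  "('r, 'z) ring_scheme \<Rightarrow> ('r, 'a) module \<Rightarrow> ('r, 'n) module \<Rightarrow> ('n \<Rightarrow> 'm) \<Rightarrow> ('r, 'm) module \<Rightarrow> bool" where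
  "hom_lifts R P N p N' \<longleftrightarrow>
     (\<forall>w\<in>mod_hom R P N'. \<exists>v\<in>mod_hom R P N. \<forall>x\<in>carrier P. p (v x) = w x)"

lemma hom_exactD:
  assumes "hom_exact R P a Q b S N" "w \<in> mod_hom R Q N" "\<And>x. x \<in> carrier P \<Longrightarrow> w (a x) = \<zero>\<^bsub>N\<^esub>"
  obtains v where "v \<in> mod_hom R S N" "\<And>y. y \<in> carrier Q \<Longrightarrow> w y = v (b y)"
  using assms unfolding hom_exact_def by blast

lemma hom_liftsD:
  assumes "hom_lifts R P N p N'" "w \<in> mod_hom R P N'"
  obtains v where "v \<in> mod_hom R P N" "\<And>x. x \<in> carrier P \<Longrightarrow> p (v x) = w x"
  using assms unfolding hom_lifts_def by blast

text \<open>A piece of a long exact sequence. A cocycle \<open>w\<close> with values in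
  \<open>K\<close> is \<open>v \<circ> b\<close> for some \<open>v\<close> into \<open>N\<close>.
  Then \<open>p \<circ> v\<close> is a cocycle one step further, hence \<open>y \<circ> c\<close>;
  subtracting from \<open>v\<close> a lift of \<open>y\<close>, composed with \<open>c\<close>,
  brings the values into \<open>K\<close> and changes nothing on the image of
  \<open>b\<close>.\<close>

lemma hom_exact_kernel:
  assumes N: "module R N" and N': "module R N'" and p: "p \<in> mod_hom R N N'"
    and K: "K = {x \<in> carrier N. p x = \<zero>\<^bsub>N'\<^esub>}"
    and P1: "module R P1" and P2: "module R P2" and P3: "module R P3"
    and b: "b \<in> mod_hom R P1 P2" and c: "c \<in> mod_hom R P2 P3"
    and cb: "\<And>x. x \<in> carrier P1 \<Longrightarrow> c (b x) = \<zero>\<^bsub>P3\<^esub>"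
    and e1: "hom_exact R P0 a P1 b P2 N" and e2: "hom_exact R P1 b P2 c P3 N'"
    and l: "hom_lifts R P3 N p N'"
  shows "hom_exact R P0 a P1 b P2 (N\<lparr>carrier := K\<rparr>)"
  unfolding hom_exact_def
proof (intro ballI impI)
  fix w assume w: "w \<in> mod_hom R P1 (N\<lparr>carrier := K\<rparr>)" and wa: "\<forall>x\<in>carrier P0. w (a x) = \<zero>\<^bsub>N\<lparr>carrier := K\<rparr>\<^esub>"
  have KN: "K \<subseteq> carrier N" using K by auto
  have wN: "w \<in> mod_hom R P1 N" by (rule mod_hom_from_into_sub[OF w KN])
  have wK: "w x \<in> K" if "x \<in> carrier P1" for x using mod_hom_closed[OF w that] by simp
  obtain v where v: "v \<in> mod_hom R P2 N" "\<And>y. y \<in> carrier P1 \<Longrightarrow> w y = v (b y)"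
    using hom_exactD[OF e1 wN] wa by auto
  obtain y where y: "y \<in> mod_hom R P3 N'" "\<And>x. x \<in> carrier P2 \<Longrightarrow> p (v x) = y (c x)"
  proof (rule hom_exactD[OF e2 mod_hom_comp[OF v(1) p]])
    fix x assume x: "x \<in> carrier P1"
    show "p (v (b x)) = \<zero>\<^bsub>N'\<^esub>" using wK[OF x] v(2)[OF x] K by simp
  qed blast
  obtain y' where y': "y' \<in> mod_hom R P3 N" "\<And>x. x \<in> carrier P3 \<Longrightarrow> p (y' x) = y x"
    using hom_liftsD[OF l y(1)] by blast
  let ?u = "\<lambda>x. v x \<ominus>\<^bsub>N\<^esub> y' (c x)"
  have u: "?u \<in> mod_hom R P2 N" by (rule mod_hom_diff[OF N v(1) mod_hom_comp[OF c y'(1)]])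
  have pu: "?u x \<in> K" if x: "x \<in> carrier P2" for x
  proof -
    have cl: "v x \<in> carrier N" "y' (c x) \<in> carrier N" "c x \<in> carrier P3"
      using mod_hom_closed[OF v(1)] mod_hom_closed[OF c] mod_hom_closed[OF y'(1)] x by auto
    have "p (?u x) = p (v x) \<ominus>\<^bsub>N'\<^esub> p (y' (c x))" by (rule mod_hom_minus[OF N N' p cl(1,2)])
    also have "\<dots> = \<zero>\<^bsub>N'\<^esub>"
      using module_minus_eq_zero_iff[OF N'] cl y(2)[OF x] y'(2) mod_hom_closed[OF y(1)] by auto
    finally show ?thesis using mod_hom_closed[OF u x] by (simp add: K)
  qed
  have "w x = ?u (b x)" if x: "x \<in> carrier P1" for x
    using v(2)[OF x] cb[OF x] mod_hom_zero[OF P3 N y'(1)] module_minus_zero[OF N]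
      mod_hom_closed[OF wN x] by simp
  thus "\<exists>v\<in>mod_hom R P2 (N\<lparr>carrier := K\<rparr>). \<forall>y\<in>carrier P1. w y = v (b y)"
    by (intro bexI[OF _ mod_hom_into_sub[OF u pu]] ballI)
qed

text \<open>A lift \<open>w'\<close> of the cocycle \<open>w\<close> has \<open>w' \<circ> a\<close>
  with values in \<open>K\<close>; exactness for \<open>K\<close> one step earlier corrects
  \<open>w'\<close> by a map into \<open>K\<close> to a cocycle with values in \<open>N\<close>. The
  conclusion retains the map \<open>y\<close> into \<open>N\<close> instead of only
  \<open>p \<circ> y\<close>: for \<open>P2\<close> the resolved module this lifts maps out of
  it.\<close>

lemma hom_exact_cokernel:
  assumes N: "module R N" and N': "module R N'" and p: "p \<in> mod_hom R N N'"
    and K: "K = {x \<in> carrier N. p x = \<zero>\<^bsub>N'\<^esub>}"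
    and P1: "module R P1" and P0: "module R P0" and P': "module R P'"
    and z: "z \<in> mod_hom R P' P0" and a: "a \<in> mod_hom R P0 P1"
    and az: "\<And>x. x \<in> carrier P' \<Longrightarrow> a (z x) = \<zero>\<^bsub>P1\<^esub>"
    and e0: "hom_exact R P' z P0 a P1 (N\<lparr>carrier := K\<rparr>)" and e1: "hom_exact R P0 a P1 b P2 N"
    and l: "hom_lifts R P1 N p N'"
    and w: "w \<in> mod_hom R P1 N'" and wa: "\<And>x. x \<in> carrier P0 \<Longrightarrow> w (a x) = \<zero>\<^bsub>N'\<^esub>"
  obtains y where "y \<in> mod_hom R P2 N" "\<And>x. x \<in> carrier P1 \<Longrightarrow> w x = p (y (b x))"
proof -
  have KN: "K \<subseteq> carrier N" using K by auto
  obtain w' where w': "w' \<in> mod_hom R P1 N" "\<And>x. x \<in> carrier P1 \<Longrightarrow> p (w' x) = w x"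
    using hom_liftsD[OF l w] by blast
  have "w' (a x) \<in> K" if "x \<in> carrier P0" for x
    using w'(2) wa that mod_hom_closed[OF a that] mod_hom_closed[OF w'(1)] by (simp add: K)
  hence w'a: "(\<lambda>x. w' (a x)) \<in> mod_hom R P0 (N\<lparr>carrier := K\<rparr>)"
    by (rule mod_hom_into_sub[OF mod_hom_comp[OF a w'(1)]])
  obtain v where v: "v \<in> mod_hom R P1 (N\<lparr>carrier := K\<rparr>)" "\<And>y. y \<in> carrier P0 \<Longrightarrow> w' (a y) = v (a y)"
    using hom_exactD[OF e0 w'a] az mod_hom_zero[OF P1 N w'(1)] by auto
  have vN: "v \<in> mod_hom R P1 N" by (rule mod_hom_from_into_sub[OF v(1) KN])
  have u: "(\<lambda>x. w' x \<ominus>\<^bsub>N\<^esub> v x) \<in> mod_hom R P1 N" by (rule mod_hom_diff[OF N w'(1) vN])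
  have cl: "w' x \<in> carrier N" "v x \<in> carrier N" if "x \<in> carrier P1" for x
    using mod_hom_closed[OF vN that] mod_hom_closed[OF w'(1) that] by auto
  have "w' (a x) \<ominus>\<^bsub>N\<^esub> v (a x) = \<zero>\<^bsub>N\<^esub>" if "x \<in> carrier P0" for x
    using module_minus_eq_zero_iff[OF N] cl mod_hom_closed[OF a that] v(2)[OF that] by simp
  then obtain y where y: "y \<in> mod_hom R P2 N" "\<And>x. x \<in> carrier P1 \<Longrightarrow> w' x \<ominus>\<^bsub>N\<^esub> v x = y (b x)"
    using hom_exactD[OF e1 u] by auto
  have "w x = p (y (b x))" if x: "x \<in> carrier P1" for x
  proof -
    have "p (y (b x)) = p (w' x) \<ominus>\<^bsub>N'\<^esub> p (v x)"
      using mod_hom_minus[OF N N' p cl[OF x]] y(2)[OF x] by simp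
    also have "p (v x) = \<zero>\<^bsub>N'\<^esub>" using mod_hom_closed[OF v(1) x] by (simp add: K)
    finally show ?thesis using w'(2)[OF x] module_minus_zero[OF N'] mod_hom_closed[OF w x] by simp
  qed
  with y(1) that show ?thesis by blast
qed

text \<open>With \<open>p \<circ> w = y \<circ> b\<close> and \<open>y'\<close> a lift of
  \<open>y\<close>, the difference \<open>w - y' \<circ> b\<close> is a cocycle with values in
  \<open>K\<close>, to which exactness for \<open>K\<close> applies.\<close>

lemma hom_exact_extension:
  assumes N: "module R N" and N': "module R N'" and p: "p \<in> mod_hom R N N'"
    and K: "K = {x \<in> carrier N. p x = \<zero>\<^bsub>N'\<^esub>}"
    and P0: "module R P0" and P1: "module R P1" and P2: "module R P2"
    and a: "a \<in> mod_hom R P0 P1" and b: "b \<in> mod_hom R P1 P2"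
    and ba: "\<And>x. x \<in> carrier P0 \<Longrightarrow> b (a x) = \<zero>\<^bsub>P2\<^esub>"
    and e: "hom_exact R P0 a P1 b P2 (N\<lparr>carrier := K\<rparr>)" and e': "hom_exact R P0 a P1 b P2 N'"
    and l: "hom_lifts R P2 N p N'"
  shows "hom_exact R P0 a P1 b P2 N"
  unfolding hom_exact_def
proof (intro ballI impI)
  fix w assume w: "w \<in> mod_hom R P1 N" and wa: "\<forall>x\<in>carrier P0. w (a x) = \<zero>\<^bsub>N\<^esub>"
  have KN: "K \<subseteq> carrier N" using K by auto
  obtain y where y: "y \<in> mod_hom R P2 N'" "\<And>x. x \<in> carrier P1 \<Longrightarrow> p (w x) = y (b x)"
    using hom_exactD[OF e' mod_hom_comp[OF w p]] wa mod_hom_zero[OF N N' p] by auto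
  obtain y' where y': "y' \<in> mod_hom R P2 N" "\<And>x. x \<in> carrier P2 \<Longrightarrow> p (y' x) = y x"
    using hom_liftsD[OF l y(1)] by blast
  let ?u = "\<lambda>x. w x \<ominus>\<^bsub>N\<^esub> y' (b x)"
  have u: "?u \<in> mod_hom R P1 N" by (rule mod_hom_diff[OF N w mod_hom_comp[OF b y'(1)]])
  have cl: "w x \<in> carrier N" "y' (b x) \<in> carrier N" "b x \<in> carrier P2" if "x \<in> carrier P1" for x
    using mod_hom_closed[OF w] mod_hom_closed[OF b] mod_hom_closed[OF y'(1)] that by auto
  have pu: "?u x \<in> K" if x: "x \<in> carrier P1" for x
  proof -
    have "p (?u x) = p (w x) \<ominus>\<^bsub>N'\<^esub> p (y' (b x))" using mod_hom_minus[OF N N' p] cl[OF x] by simp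
    also have "\<dots> = \<zero>\<^bsub>N'\<^esub>"
      using module_minus_eq_zero_iff[OF N'] cl[OF x] y(2)[OF x] y'(2) mod_hom_closed[OF y(1)] by auto
    finally show ?thesis using mod_hom_closed[OF u x] by (simp add: K)
  qed
  have "?u (a x) = \<zero>\<^bsub>N\<^esub>" if x: "x \<in> carrier P0" for x
    using wa x ba[OF x] mod_hom_zero[OF P2 N y'(1)] module_minus_zero[OF N, of "\<zero>\<^bsub>N\<^esub>"]
      mod_hom_closed[OF w mod_hom_closed[OF a x]] by simp
  then obtain v where v: "v \<in> mod_hom R P2 (N\<lparr>carrier := K\<rparr>)" "\<And>x. x \<in> carrier P1 \<Longrightarrow> ?u x = v (b x)"
    using hom_exactD[OF e mod_hom_into_sub[OF u pu]] by auto
  have vN: "v \<in> mod_hom R P2 N" by (rule mod_hom_from_into_sub[OF v(1) KN])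
  interpret N: module R N by fact
  have "w x = v (b x) \<oplus>\<^bsub>N\<^esub> y' (b x)" if x: "x \<in> carrier P1" for x
    unfolding v(2)[OF x, symmetric] using cl[OF x] by (simp add: a_minus_def N.a_assoc N.l_neg)
  thus "\<exists>v\<in>mod_hom R P2 N. \<forall>y\<in>carrier P1. w y = v (b y)"
    by (intro bexI[OF _ mod_hom_plus[OF N vN y'(1)]] ballI)
qed

lemma power_hom_component:
  assumes "f \<in> mod_hom R P (power_module N n)" "i < n"
  shows "(\<lambda>x. f x i) \<in> mod_hom R P N"
  by (rule mod_homI)
    (use assms in \<open>auto simp: power_module_simps PiE_iff mod_hom_add[OF assms(1)] mod_hom_smult[OF assms(1)]
      dest!: mod_hom_closed[OF assms(1)]\<close>)

lemma power_hom_intro: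
  assumes "\<And>i. i < n \<Longrightarrow> f i \<in> mod_hom R P N"
  shows "(\<lambda>x. \<lambda>i\<in>{..<n}. f i x) \<in> mod_hom R P (power_module N n)"
  by (rule mod_homI)
    (auto simp: power_module_simps PiE_iff fun_eq_iff intro!: mod_hom_closed[OF assms] mod_hom_add[OF assms]
      mod_hom_smult[OF assms])

lemma hom_exact_power:
  assumes e: "hom_exact R P0 a P1 b P2 N" and a: "a \<in> mod_hom R P0 P1"
  shows "hom_exact R P0 a P1 b P2 (power_module N n)"
  unfolding hom_exact_def
proof (intro ballI impI)
  fix w assume w: "w \<in> mod_hom R P1 (power_module N n)"
    and wa: "\<forall>x\<in>carrier P0. w (a x) = \<zero>\<^bsub>power_module N n\<^esub>"
  have "\<forall>i<n. \<exists>v. v \<in> mod_hom R P2 N \<and> (\<forall>y\<in>carrier P1. w y i = v (b y))"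
  proof (intro allI impI)
    fix i assume i: "i < n"
    have "w (a x) i = \<zero>\<^bsub>N\<^esub>" if "x \<in> carrier P0" for x
      using wa that i by (simp add: power_module_simps)
    then obtain v where "v \<in> mod_hom R P2 N" "\<And>y. y \<in> carrier P1 \<Longrightarrow> w y i = v (b y)"
      using hom_exactD[OF e power_hom_component[OF w i]] by auto
    thus "\<exists>v. v \<in> mod_hom R P2 N \<and> (\<forall>y\<in>carrier P1. w y i = v (b y))" by blast
  qed
  then obtain v where v: "\<And>i. i < n \<Longrightarrow> v i \<in> mod_hom R P2 N"
    "\<And>i y. i < n \<Longrightarrow> y \<in> carrier P1 \<Longrightarrow> w y i = v i (b y)" by metis
  have "w y = (\<lambda>i\<in>{..<n}. v i (b y))" if y: "y \<in> carrier P1" for y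
    using mod_hom_closed[OF w y] v(2) y
    by (auto simp: power_module_simps PiE_iff fun_eq_iff extensional_def)
  thus "\<exists>v\<in>mod_hom R P2 (power_module N n). \<forall>y\<in>carrier P1. w y = v (b y)"
    using power_hom_intro[of n v, OF v(1)] by (intro bexI[of _ "\<lambda>x. \<lambda>i\<in>{..<n}. v i x"]) auto
qed

lemma hom_exact_injective:
  assumes inj: "injective_module R E" and Q: "module R Q" and S: "module R S" and fg: "fin_gen R S"
    and b: "b \<in> mod_hom R Q S"
    and ex: "\<And>y. y \<in> carrier Q \<Longrightarrow> b y = \<zero>\<^bsub>S\<^esub> \<Longrightarrow> y \<in> a ` carrier P"
  shows "hom_exact R P a Q b S E"
  unfolding hom_exact_def
proof (intro ballI impI)
  fix w assume w: "w \<in> mod_hom R Q E" and wa: "\<forall>x\<in>carrier P. w (a x) = \<zero>\<^bsub>E\<^esub>"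
  obtain h where "h \<in> mod_hom R S E" "\<And>x. x \<in> carrier Q \<Longrightarrow> h (b x) = w x"
    by (rule injective_extend[OF inj Q S fg b w]) (use ex wa in auto)
  thus "\<exists>v\<in>mod_hom R S E. \<forall>y\<in>carrier Q. w y = v (b y)" by (intro bexI[of _ h]) auto
qed

lemma hom_exact_zero_module:
  assumes "module R N" "zero_module N"
  shows "hom_exact R P a Q b S N"
  unfolding hom_exact_def
proof (intro ballI impI)
  fix w assume "w \<in> mod_hom R Q N"
  hence "\<And>y. y \<in> carrier Q \<Longrightarrow> w y = \<zero>\<^bsub>N\<^esub>" using assms(2) mod_hom_closed by (fastforce simp: zero_module_def)
  thus "\<exists>v\<in>mod_hom R S N. \<forall>y\<in>carrier Q. w y = v (b y)"
    using mod_hom_const_zero[OF assms(1)] by (intro bexI[of _ "\<lambda>_. \<zero>\<^bsub>N\<^esub>"]) auto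
qed

lemma fin_gen_free_module:
  assumes "cring R" "finite S"
  shows "fin_gen R (free_module R S)"
proof -
  have sub: "free_gen R ` S \<subseteq> carrier (free_module R S)" using free_gen_closed[OF assms(1)] by auto
  note sp = submodule_mod_span[OF module_free_module[OF assms(1)] sub]
  have "carrier (free_module R S) \<subseteq> mod_span R (free_module R S) (free_gen R ` S)"
  proof
    fix u assume "u \<in> carrier (free_module R S)"
    thus "u \<in> mod_span R (free_module R S) (free_gen R ` S)"
      by (rule free_module_generated[OF assms(1) sp, rotated])
        (rule subsetD[OF mod_span_base], rule imageI)
  qed
  thus ?thesis
    unfolding fin_gen_def using assms(2) sub submodule_subset[OF sp]
    by (intro exI[of _ "free_gen R ` S"]) auto
qed


section \<open>Comparison of free resolutions\<close>

lemma nat_resolutionD: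
  assumes "nat_resolution R A S d \<epsilon>"
  shows "d n \<in> mod_hom R (free_module R (S (Suc n))) (free_module R (S n))"
    and "\<epsilon> \<in> mod_hom R (free_module R (S 0)) A"
    and "\<epsilon> ` carrier (free_module R (S 0)) = carrier A"
    and "x \<in> carrier (free_module R (S 0)) \<Longrightarrow>
      \<epsilon> x = \<zero>\<^bsub>A\<^esub> \<longleftrightarrow> x \<in> d 0 ` carrier (free_module R (S (Suc 0)))"
    and "y \<in> carrier (free_module R (S (Suc n))) \<Longrightarrow>
      d n y = \<zero>\<^bsub>free_module R (S n)\<^esub> \<longleftrightarrow> y \<in> d (Suc n) ` carrier (free_module R (S (Suc (Suc n))))"
proof -
  have ex0: "{x \<in> carrier (free_module R (S 0)). \<epsilon> x = \<zero>\<^bsub>A\<^esub>} = d 0 ` carrier (free_module R (S (Suc 0)))"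
    and ex: "{x \<in> carrier (free_module R (S (Suc n))). d n x = \<zero>\<^bsub>free_module R (S n)\<^esub>} =
        d (Suc n) ` carrier (free_module R (S (Suc (Suc n))))"
    using assms unfolding nat_resolution_def by auto
  show "d n \<in> mod_hom R (free_module R (S (Suc n))) (free_module R (S n))"
    "\<epsilon> \<in> mod_hom R (free_module R (S 0)) A" "\<epsilon> ` carrier (free_module R (S 0)) = carrier A"
    using assms unfolding nat_resolution_def by auto
  show "x \<in> carrier (free_module R (S 0)) \<Longrightarrow>
      \<epsilon> x = \<zero>\<^bsub>A\<^esub> \<longleftrightarrow> x \<in> d 0 ` carrier (free_module R (S (Suc 0)))"
    using ex0 by blast
  show "y \<in> carrier (free_module R (S (Suc n))) \<Longrightarrow>
      d n y = \<zero>\<^bsub>free_module R (S n)\<^esub> \<longleftrightarrow> y \<in> d (Suc n) ` carrier (free_module R (S (Suc (Suc n))))"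
    using ex by blast
qed

lemma resolution_chain_map:
  assumes R: "cring R" and A: "module R A"
    and r: "nat_resolution R A S d \<epsilon>" and r': "nat_resolution R A S' d' \<epsilon>'"
  obtains \<phi> where "\<And>n. \<phi> n \<in> mod_hom R (free_module R (S n)) (free_module R (S' n))"
    "\<And>x. x \<in> carrier (free_module R (S 0)) \<Longrightarrow> \<epsilon>' (\<phi> 0 x) = \<epsilon> x"
    "\<And>n x. x \<in> carrier (free_module R (S (Suc n))) \<Longrightarrow> d' n (\<phi> (Suc n) x) = \<phi> n (d n x)"
proof -
  let ?F = "\<lambda>n. free_module R (S n)" and ?G = "\<lambda>n. free_module R (S' n)"
  note F = module_free_module[OF R]
  note D = nat_resolutionD[OF r] and D' = nat_resolutionD[OF r']
  \<comment> \<open>The second conjunct is what the lifting in the next degree asks for; the third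
    pins down the component in degree 0.\<close>
  define P where "P n f \<longleftrightarrow> f \<in> mod_hom R (?F n) (?G n) \<and>
      (\<forall>x\<in>carrier (?F (Suc n)). f (d n x) \<in> d' n ` carrier (?G (Suc n))) \<and>
      (n = 0 \<longrightarrow> (\<forall>x\<in>carrier (?F 0). \<epsilon>' (f x) = \<epsilon> x))" for n f
  define Q where "Q n f f' \<longleftrightarrow> (\<forall>x\<in>carrier (?F (Suc n)). d' n (f' x) = f (d n x))" for n f f'
  have "\<exists>\<phi>. \<forall>n. P n (\<phi> n) \<and> Q n (\<phi> n) (\<phi> (Suc n))"
  proof (rule dependent_nat_choice)
    obtain f where f: "f \<in> mod_hom R (?F 0) (?G 0)" "\<And>x. x \<in> carrier (?F 0) \<Longrightarrow> \<epsilon>' (f x) = \<epsilon> x"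
      using free_module_lift[OF R F A D'(2) D(2)] D(3) D'(3) by blast
    have "f (d 0 x) \<in> d' 0 ` carrier (?G (Suc 0))" if x: "x \<in> carrier (?F (Suc 0))" for x
    proof -
      have c: "d 0 x \<in> carrier (?F 0)" by (rule mod_hom_closed[OF D(1) x])
      have "\<epsilon>' (f (d 0 x)) = \<zero>\<^bsub>A\<^esub>" using f(2)[OF c] D(4)[OF c] x by simp
      thus ?thesis using D'(4)[OF mod_hom_closed[OF f(1) c]] by simp
    qed
    thus "\<exists>f. P 0 f" using f by (auto simp: P_def)
  next
    fix f n assume P: "P n f"
    hence f: "f \<in> mod_hom R (?F n) (?G n)" "\<And>x. x \<in> carrier (?F (Suc n)) \<Longrightarrow> f (d n x) \<in> d' n ` carrier (?G (Suc n))"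
      by (auto simp: P_def)
    obtain f' where f': "f' \<in> mod_hom R (?F (Suc n)) (?G (Suc n))"
      "\<And>x. x \<in> carrier (?F (Suc n)) \<Longrightarrow> d' n (f' x) = f (d n x)"
      using free_module_lift[OF R F F D'(1) mod_hom_comp[OF D(1) f(1)]] f(2) by blast
    have "f' (d (Suc n) x) \<in> d' (Suc n) ` carrier (?G (Suc (Suc n)))"
      if x: "x \<in> carrier (?F (Suc (Suc n)))" for x
    proof -
      have c: "d (Suc n) x \<in> carrier (?F (Suc n))" by (rule mod_hom_closed[OF D(1) x])
      have "d n (d (Suc n) x) = \<zero>\<^bsub>?F n\<^esub>" using D(5)[OF c] x by simp
      hence "d' n (f' (d (Suc n) x)) = \<zero>\<^bsub>?G n\<^esub>" using f'(2)[OF c] mod_hom_zero[OF F F f(1)] by simp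
      thus ?thesis using D'(5)[OF mod_hom_closed[OF f'(1) c]] by simp
    qed
    thus "\<exists>f'. P (Suc n) f' \<and> Q n f f'" using f' by (auto simp: P_def Q_def)
  qed
  then obtain \<phi> where "\<And>n. P n (\<phi> n)" "\<And>n. Q n (\<phi> n) (\<phi> (Suc n))" by blast
  thus ?thesis using that[of \<phi>] by (auto simp: P_def Q_def)
qed

text \<open>A chain map inducing zero on the resolved module is null-homotopic. The equation is
  recorded in degrees \<open>Suc n\<close> only, because Ext and Tor are compared in positive
  degrees.\<close>

lemma resolution_homotopy:
  assumes R: "cring R" and A: "module R A" and r: "nat_resolution R A S d \<epsilon>"
    and \<theta>: "\<And>n. \<theta> n \<in> mod_hom R (free_module R (S n)) (free_module R (S n))"
    and \<theta>0: "\<And>x. x \<in> carrier (free_module R (S 0)) \<Longrightarrow> \<epsilon> (\<theta> 0 x) = \<zero>\<^bsub>A\<^esub>"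
    and \<theta>d: "\<And>n x. x \<in> carrier (free_module R (S (Suc n))) \<Longrightarrow> d n (\<theta> (Suc n) x) = \<theta> n (d n x)"
  obtains s where "\<And>n. s n \<in> mod_hom R (free_module R (S n)) (free_module R (S (Suc n)))"
    "\<And>n x. x \<in> carrier (free_module R (S (Suc n))) \<Longrightarrow>
       \<theta> (Suc n) x = d (Suc n) (s (Suc n) x) \<oplus>\<^bsub>free_module R (S (Suc n))\<^esub> s n (d n x)"
proof -
  let ?F = "\<lambda>n. free_module R (S n)"
  note F = module_free_module[OF R]
  note D = nat_resolutionD[OF r]
  \<comment> \<open>What remains of \<open>\<theta> (Suc n)\<close> after subtracting
    \<open>f \<circ> d n\<close>; the homotopy continues to the next degree if its values are
    boundaries.\<close>
  let ?u = "\<lambda>n f x. \<theta> (Suc n) x \<ominus>\<^bsub>?F (Suc n)\<^esub> f (d n x)"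
  define P where "P n f \<longleftrightarrow> f \<in> mod_hom R (?F n) (?F (Suc n)) \<and>
      (\<forall>x\<in>carrier (?F (Suc n)). ?u n f x \<in> d (Suc n) ` carrier (?F (Suc (Suc n))))" for n f
  define Q where "Q n f f' \<longleftrightarrow> (\<forall>x\<in>carrier (?F (Suc n)). d (Suc n) (f' x) = ?u n f x)" for n f f'
  have im: "?u n f x \<in> d (Suc n) ` carrier (?F (Suc (Suc n)))"
    if f: "f \<in> mod_hom R (?F n) (?F (Suc n))" and x: "x \<in> carrier (?F (Suc n))"
      and h: "d n (f (d n x)) = \<theta> n (d n x)" for n f x
  proof -
    have c: "\<theta> (Suc n) x \<in> carrier (?F (Suc n))" "f (d n x) \<in> carrier (?F (Suc n))"
      using mod_hom_closed[OF \<theta> x] mod_hom_closed[OF f mod_hom_closed[OF D(1) x]] by auto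
    interpret F: module R "?F (Suc n)" by (rule F)
    have "d n (?u n f x) = d n (\<theta> (Suc n) x) \<ominus>\<^bsub>?F n\<^esub> d n (f (d n x))"
      by (rule mod_hom_minus[OF F F D(1) c])
    also have "\<dots> = \<zero>\<^bsub>?F n\<^esub>"
      using h \<theta>d[OF x] mod_hom_closed[OF D(1) c(1)] by (simp add: module_minus_eq_zero_iff[OF F])
    finally show ?thesis using D(5)[OF F.minus_closed[OF c]] by simp
  qed
  have u: "?u n f \<in> mod_hom R (?F (Suc n)) (?F (Suc n))" if "f \<in> mod_hom R (?F n) (?F (Suc n))" for n f
    by (rule mod_hom_diff[OF F \<theta> mod_hom_comp[OF D(1) that]])
  have "\<exists>s. \<forall>n. P n (s n) \<and> Q n (s n) (s (Suc n))"
  proof (rule dependent_nat_choice)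
    have "\<theta> 0 x \<in> d 0 ` carrier (?F (Suc 0))" if x: "x \<in> carrier (?F 0)" for x
      using D(4)[OF mod_hom_closed[OF \<theta> x]] \<theta>0[OF x] by simp
    then obtain f where f: "f \<in> mod_hom R (?F 0) (?F (Suc 0))"
      "\<And>x. x \<in> carrier (?F 0) \<Longrightarrow> d 0 (f x) = \<theta> 0 x"
      using free_module_lift[OF R F F D(1) \<theta>[of 0]] by blast
    have "P 0 f" unfolding P_def using f(1) im[OF f(1)] f(2) mod_hom_closed[OF D(1)] by blast
    thus "\<exists>f. P 0 f" by blast
  next
    fix f n assume P: "P n f"
    hence f: "f \<in> mod_hom R (?F n) (?F (Suc n))"
      "\<And>x. x \<in> carrier (?F (Suc n)) \<Longrightarrow> ?u n f x \<in> d (Suc n) ` carrier (?F (Suc (Suc n)))"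
      by (auto simp: P_def)
    obtain f' where f': "f' \<in> mod_hom R (?F (Suc n)) (?F (Suc (Suc n)))"
      "\<And>x. x \<in> carrier (?F (Suc n)) \<Longrightarrow> d (Suc n) (f' x) = ?u n f x"
      using free_module_lift[OF R F F D(1) u[OF f(1)]] f(2) by blast
    have "?u (Suc n) f' x \<in> d (Suc (Suc n)) ` carrier (?F (Suc (Suc (Suc n))))"
      if x: "x \<in> carrier (?F (Suc (Suc n)))" for x
    proof (rule im[OF f'(1) x])
      have c: "d (Suc n) x \<in> carrier (?F (Suc n))" by (rule mod_hom_closed[OF D(1) x])
      have "d n (d (Suc n) x) = \<zero>\<^bsub>?F n\<^esub>" using D(5)[OF c] x by simp
      thus "d (Suc n) (f' (d (Suc n) x)) = \<theta> (Suc n) (d (Suc n) x)"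
        using f'(2)[OF c] mod_hom_zero[OF F F f(1)] module_minus_zero[OF F mod_hom_closed[OF \<theta> c]] by simp
    qed
    thus "\<exists>f'. P (Suc n) f' \<and> Q n f f'" using f' by (auto simp: P_def Q_def)
  qed
  then obtain s where s: "\<And>n. P n (s n)" "\<And>n. Q n (s n) (s (Suc n))" by blast
  have sh: "s n \<in> mod_hom R (?F n) (?F (Suc n))" for n using s(1) by (auto simp: P_def)
  have "\<theta> (Suc n) x = d (Suc n) (s (Suc n) x) \<oplus>\<^bsub>?F (Suc n)\<^esub> s n (d n x)" if x: "x \<in> carrier (?F (Suc n))" for n x
  proof -
    interpret F: module R "?F (Suc n)" by (rule F)
    have "d (Suc n) (s (Suc n) x) = ?u n (s n) x" using s(2)[of n] x by (simp add: Q_def)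
    thus ?thesis
      using mod_hom_closed[OF \<theta> x] mod_hom_closed[OF sh mod_hom_closed[OF D(1) x]]
      by (simp add: a_minus_def F.a_assoc F.l_neg)
  qed
  with sh that show ?thesis by blast
qed

text \<open>The homotopy between \<open>\<phi> \<circ> \<psi>\<close> and the identity on the second
  resolution, solved for \<open>x\<close>: in this form an additive functor can be applied to it
  without handling differences.\<close>

lemma resolution_comparison:
  assumes R: "cring R" and A: "module R A"
    and r: "nat_resolution R A S d \<epsilon>" and r': "nat_resolution R A S' d' \<epsilon>'"
  obtains \<phi> \<psi> s where
    "\<And>n. \<phi> n \<in> mod_hom R (free_module R (S n)) (free_module R (S' n))"
    "\<And>n x. x \<in> carrier (free_module R (S (Suc n))) \<Longrightarrow> d' n (\<phi> (Suc n) x) = \<phi> n (d n x)"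
    "\<And>n. \<psi> n \<in> mod_hom R (free_module R (S' n)) (free_module R (S n))"
    "\<And>n x. x \<in> carrier (free_module R (S' (Suc n))) \<Longrightarrow> d n (\<psi> (Suc n) x) = \<psi> n (d' n x)"
    "\<And>n. s n \<in> mod_hom R (free_module R (S' n)) (free_module R (S' (Suc n)))"
    "\<And>n x. x \<in> carrier (free_module R (S' (Suc n))) \<Longrightarrow>
       x = (d' (Suc n) (s (Suc n) x) \<oplus>\<^bsub>free_module R (S' (Suc n))\<^esub> s n (d' n x))
         \<oplus>\<^bsub>free_module R (S' (Suc n))\<^esub> \<phi> (Suc n) (\<psi> (Suc n) x)"
proof -
  let ?F = "\<lambda>n. free_module R (S n)" and ?G = "\<lambda>n. free_module R (S' n)"
  note F = module_free_module[OF R]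
  note D = nat_resolutionD[OF r] and D' = nat_resolutionD[OF r']
  obtain \<phi> where \<phi>: "\<And>n. \<phi> n \<in> mod_hom R (?F n) (?G n)"
    "\<And>x. x \<in> carrier (?F 0) \<Longrightarrow> \<epsilon>' (\<phi> 0 x) = \<epsilon> x"
    "\<And>n x. x \<in> carrier (?F (Suc n)) \<Longrightarrow> d' n (\<phi> (Suc n) x) = \<phi> n (d n x)"
    using resolution_chain_map[OF R A r r'] by blast
  obtain \<psi> where \<psi>: "\<And>n. \<psi> n \<in> mod_hom R (?G n) (?F n)"
    "\<And>x. x \<in> carrier (?G 0) \<Longrightarrow> \<epsilon> (\<psi> 0 x) = \<epsilon>' x"
    "\<And>n x. x \<in> carrier (?G (Suc n)) \<Longrightarrow> d n (\<psi> (Suc n) x) = \<psi> n (d' n x)"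
    using resolution_chain_map[OF R A r' r] by blast
  define \<theta> where "\<theta> n x = x \<ominus>\<^bsub>?G n\<^esub> \<phi> n (\<psi> n x)" for n x
  have cl: "\<phi> n (\<psi> n x) \<in> carrier (?G n)" if "x \<in> carrier (?G n)" for n x
    using mod_hom_closed[OF \<phi>(1) mod_hom_closed[OF \<psi>(1) that]] .
  have \<theta>: "\<theta> n \<in> mod_hom R (?G n) (?G n)" for n
    unfolding \<theta>_def by (rule mod_hom_diff[OF F mod_hom_id mod_hom_comp[OF \<psi>(1) \<phi>(1)]])
  have \<theta>0: "\<epsilon>' (\<theta> 0 x) = \<zero>\<^bsub>A\<^esub>" if x: "x \<in> carrier (?G 0)" for x
    using mod_hom_minus[OF F A D'(2) x cl[OF x]] \<phi>(2)[OF mod_hom_closed[OF \<psi>(1) x]] \<psi>(2)[OF x]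
      module_minus_eq_zero_iff[OF A] mod_hom_closed[OF D'(2) x] by (simp add: \<theta>_def)
  have \<theta>d: "d' n (\<theta> (Suc n) x) = \<theta> n (d' n x)" if x: "x \<in> carrier (?G (Suc n))" for n x
    using mod_hom_minus[OF F F D'(1) x cl[OF x]] \<phi>(3)[OF mod_hom_closed[OF \<psi>(1) x]] \<psi>(3)[OF x]
    by (simp add: \<theta>_def)
  obtain s where s: "\<And>n. s n \<in> mod_hom R (?G n) (?G (Suc n))"
    "\<And>n x. x \<in> carrier (?G (Suc n)) \<Longrightarrow>
       \<theta> (Suc n) x = d' (Suc n) (s (Suc n) x) \<oplus>\<^bsub>?G (Suc n)\<^esub> s n (d' n x)"
    using resolution_homotopy[OF R A r' \<theta> \<theta>0 \<theta>d] by blast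
  have "x = (d' (Suc n) (s (Suc n) x) \<oplus>\<^bsub>?G (Suc n)\<^esub> s n (d' n x)) \<oplus>\<^bsub>?G (Suc n)\<^esub> \<phi> (Suc n) (\<psi> (Suc n) x)"
    if x: "x \<in> carrier (?G (Suc n))" for n x
  proof -
    interpret G: module R "?G (Suc n)" by (rule F)
    show ?thesis unfolding s(2)[OF x, symmetric] \<theta>_def
      using x cl[OF x] by (simp add: a_minus_def G.a_assoc G.l_neg)
  qed
  from that[OF \<phi>(1,3) \<psi>(1,3) s(1) this] show ?thesis .
qed

text \<open>A cocycle \<open>w\<close> on the second resolution is pulled back along
  \<open>\<phi>\<close>, where it becomes \<open>v \<circ> d n\<close>. Pulling this back along
  \<open>\<psi>\<close> and adding the homotopy term \<open>w \<circ> s n\<close> writes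
  \<open>w\<close> itself as a coboundary.\<close>

lemma hom_exact_change_resolution:
  assumes R: "cring R" and A: "module R A"
    and r: "nat_resolution R A S d \<epsilon>" and r': "nat_resolution R A S' d' \<epsilon>'" and N: "module R N"
    and ex: "hom_exact R (free_module R (S (Suc (Suc n)))) (d (Suc n)) (free_module R (S (Suc n))) (d n)
        (free_module R (S n)) N"
  shows "hom_exact R (free_module R (S' (Suc (Suc n)))) (d' (Suc n)) (free_module R (S' (Suc n))) (d' n)
        (free_module R (S' n)) N"
  unfolding hom_exact_def
proof (intro ballI impI)
  let ?F = "\<lambda>n. free_module R (S n)" and ?G = "\<lambda>n. free_module R (S' n)"
  note F = module_free_module[OF R]
  note D = nat_resolutionD[OF r] and D' = nat_resolutionD[OF r']
  obtain \<phi> \<psi> s where c: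
    "\<And>n. \<phi> n \<in> mod_hom R (?F n) (?G n)"
    "\<And>n x. x \<in> carrier (?F (Suc n)) \<Longrightarrow> d' n (\<phi> (Suc n) x) = \<phi> n (d n x)"
    "\<And>n. \<psi> n \<in> mod_hom R (?G n) (?F n)"
    "\<And>n x. x \<in> carrier (?G (Suc n)) \<Longrightarrow> d n (\<psi> (Suc n) x) = \<psi> n (d' n x)"
    "\<And>n. s n \<in> mod_hom R (?G n) (?G (Suc n))"
    "\<And>n x. x \<in> carrier (?G (Suc n)) \<Longrightarrow>
       x = (d' (Suc n) (s (Suc n) x) \<oplus>\<^bsub>?G (Suc n)\<^esub> s n (d' n x)) \<oplus>\<^bsub>?G (Suc n)\<^esub> \<phi> (Suc n) (\<psi> (Suc n) x)"
    by (rule resolution_comparison[OF R A r r']) (rule that)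
  fix w assume w: "w \<in> mod_hom R (?G (Suc n)) N" and wd: "\<forall>x\<in>carrier (?G (Suc (Suc n))). w (d' (Suc n) x) = \<zero>\<^bsub>N\<^esub>"
  have "w (\<phi> (Suc n) (d (Suc n) x)) = \<zero>\<^bsub>N\<^esub>" if x: "x \<in> carrier (?F (Suc (Suc n)))" for x
    using wd c(2)[OF x, symmetric] mod_hom_closed[OF c(1) x] by simp
  then obtain v where v: "v \<in> mod_hom R (?F n) N" "\<And>y. y \<in> carrier (?F (Suc n)) \<Longrightarrow> w (\<phi> (Suc n) y) = v (d n y)"
    using hom_exactD[OF ex mod_hom_comp[OF c(1) w]] by auto
  let ?v = "\<lambda>x. w (s n x) \<oplus>\<^bsub>N\<^esub> v (\<psi> n x)"
  have h: "?v \<in> mod_hom R (?G n) N"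
    by (rule mod_hom_plus[OF N mod_hom_comp[OF c(5) w] mod_hom_comp[OF c(3) v(1)]])
  interpret N: module R N by (rule N)
  have "w y = ?v (d' n y)" if y: "y \<in> carrier (?G (Suc n))" for y
  proof -
    have 1: "s (Suc n) y \<in> carrier (?G (Suc (Suc n)))" by (rule mod_hom_closed[OF c(5) y])
    have 2: "s n (d' n y) \<in> carrier (?G (Suc n))" by (rule mod_hom_closed[OF c(5) mod_hom_closed[OF D'(1) y]])
    have 3: "\<psi> (Suc n) y \<in> carrier (?F (Suc n))" by (rule mod_hom_closed[OF c(3) y])
    have 4: "d' (Suc n) (s (Suc n) y) \<in> carrier (?G (Suc n))" by (rule mod_hom_closed[OF D'(1) 1])
    interpret G: module R "?G (Suc n)" by (rule F)
    have "w y = (w (d' (Suc n) (s (Suc n) y)) \<oplus>\<^bsub>N\<^esub> w (s n (d' n y))) \<oplus>\<^bsub>N\<^esub> w (\<phi> (Suc n) (\<psi> (Suc n) y))"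
      using c(6)[OF y] mod_hom_add[OF w, symmetric] 2 4 mod_hom_closed[OF c(1) 3] by simp
    thus ?thesis
      using wd 1 v(2)[OF 3] c(4)[OF y] mod_hom_closed[OF w 2] by simp
  qed
  thus "\<exists>v\<in>mod_hom R (?G n) N. \<forall>y\<in>carrier (?G (Suc n)). w y = v (d' n y)"
    by (intro bexI[OF _ h] ballI)
qed

text \<open>The covariant counterpart for cycles: \<open>\<psi>\<close> carries \<open>t\<close> to
  a boundary, \<open>\<phi>\<close> carries that back to a boundary, and the homotopy accounts for
  the difference from \<open>t\<close>.\<close>

lemma tensor_exact_change_resolution:
  assumes R: "cring R" and A: "module R A"
    and r: "nat_resolution R A S d \<epsilon>" and r': "nat_resolution R A S' d' \<epsilon>'" and N: "module R N"
    and ex: "\<And>t. t \<in> carrier (tensor R (free_module R (S (Suc n))) N) \<Longrightarrow>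
        tensor_left R N (free_module R (S (Suc n))) (free_module R (S n)) (d n) t =
          \<zero>\<^bsub>tensor R (free_module R (S n)) N\<^esub> \<Longrightarrow>
        t \<in> tensor_left R N (free_module R (S (Suc (Suc n)))) (free_module R (S (Suc n))) (d (Suc n)) `
          carrier (tensor R (free_module R (S (Suc (Suc n)))) N)"
    and t: "t \<in> carrier (tensor R (free_module R (S' (Suc n))) N)"
      "tensor_left R N (free_module R (S' (Suc n))) (free_module R (S' n)) (d' n) t =
          \<zero>\<^bsub>tensor R (free_module R (S' n)) N\<^esub>"
  shows "t \<in> tensor_left R N (free_module R (S' (Suc (Suc n)))) (free_module R (S' (Suc n))) (d' (Suc n)) `
          carrier (tensor R (free_module R (S' (Suc (Suc n)))) N)"
proof -
  let ?F = "\<lambda>n. free_module R (S n)" and ?G = "\<lambda>n. free_module R (S' n)"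
  note F = module_free_module[OF R]
  note D = nat_resolutionD[OF r] and D' = nat_resolutionD[OF r']
  obtain \<phi> \<psi> s where c:
    "\<And>n. \<phi> n \<in> mod_hom R (?F n) (?G n)"
    "\<And>n x. x \<in> carrier (?F (Suc n)) \<Longrightarrow> d' n (\<phi> (Suc n) x) = \<phi> n (d n x)"
    "\<And>n. \<psi> n \<in> mod_hom R (?G n) (?F n)"
    "\<And>n x. x \<in> carrier (?G (Suc n)) \<Longrightarrow> d n (\<psi> (Suc n) x) = \<psi> n (d' n x)"
    "\<And>n. s n \<in> mod_hom R (?G n) (?G (Suc n))"
    "\<And>n x. x \<in> carrier (?G (Suc n)) \<Longrightarrow>
       x = (d' (Suc n) (s (Suc n) x) \<oplus>\<^bsub>?G (Suc n)\<^esub> s n (d' n x)) \<oplus>\<^bsub>?G (Suc n)\<^esub> \<phi> (Suc n) (\<psi> (Suc n) x)"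
    by (rule resolution_comparison[OF R A r r']) (rule that)
  let ?n = "Suc n" and ?m = "Suc (Suc n)"
  let ?L = "tensor_left R N"
  note T = tensor_module[OF F N]
  note com = tensor_left_comp[OF F N F F] and hom = tensor_left_hom[OF F N F]
  note cl = mod_hom_closed[OF hom]
  have "?L (?F ?n) (?F n) (d n) (?L (?G ?n) (?F ?n) (\<psi> ?n) t) = ?L (?G ?n) (?F n) (\<lambda>x. d n (\<psi> ?n x)) t"
    by (rule com[OF c(3) D(1) t(1), symmetric])
  also have "\<dots> = ?L (?G ?n) (?F n) (\<lambda>x. \<psi> n (d' n x)) t"
    by (rule tensor_left_cong[OF F N F mod_hom_comp[OF c(3) D(1)] mod_hom_comp[OF D'(1) c(3)] c(4) t(1)])
  also have "\<dots> = ?L (?G n) (?F n) (\<psi> n) (?L (?G ?n) (?G n) (d' n) t)"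
    by (rule com[OF D'(1) c(3) t(1)])
  also have "\<dots> = \<zero>\<^bsub>tensor R (?F n) N\<^esub>" unfolding t(2) by (rule mod_hom_zero[OF T T hom[OF c(3)]])
  finally obtain u where u: "u \<in> carrier (tensor R (?F ?m) N)"
    "?L (?G ?n) (?F ?n) (\<psi> ?n) t = ?L (?F ?m) (?F ?n) (d ?n) u"
    using ex[OF cl[OF c(3) t(1)]] by auto
  have "?L (?G ?n) (?G ?n) (\<lambda>x. \<phi> ?n (\<psi> ?n x)) t = ?L (?F ?n) (?G ?n) (\<phi> ?n) (?L (?G ?n) (?F ?n) (\<psi> ?n) t)"
    by (rule com[OF c(3) c(1) t(1)])
  also have "\<dots> = ?L (?F ?m) (?G ?n) (\<lambda>x. \<phi> ?n (d ?n x)) u"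
    unfolding u(2) by (rule com[OF D(1) c(1) u(1), symmetric])
  also have "\<dots> = ?L (?F ?m) (?G ?n) (\<lambda>x. d' ?n (\<phi> ?m x)) u"
    by (rule tensor_left_cong[OF F N F mod_hom_comp[OF D(1) c(1)] mod_hom_comp[OF c(1) D'(1)] c(2)[symmetric] u(1)])
  also have "\<dots> = ?L (?G ?m) (?G ?n) (d' ?n) (?L (?F ?m) (?G ?m) (\<phi> ?m) u)"
    by (rule com[OF c(1) D'(1) u(1)])
  finally have e1: "?L (?G ?n) (?G ?n) (\<lambda>x. \<phi> ?n (\<psi> ?n x)) t = \<dots>" .
  have e2: "?L (?G ?n) (?G ?n) (\<lambda>x. d' ?n (s ?n x)) t = ?L (?G ?m) (?G ?n) (d' ?n) (?L (?G ?n) (?G ?m) (s ?n) t)"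
    by (rule com[OF c(5) D'(1) t(1)])
  have e3: "?L (?G ?n) (?G ?n) (\<lambda>x. s n (d' n x)) t = \<zero>\<^bsub>tensor R (?G ?n) N\<^esub>"
    using com[OF D'(1) c(5) t(1)] mod_hom_zero[OF T T hom[OF c(5)]] t(2) by simp
  note h1 = mod_hom_comp[OF c(5)[of ?n] D'(1)] and h2 = mod_hom_comp[OF D'(1)[of n] c(5)]
    and h3 = mod_hom_comp[OF c(3)[of ?n] c(1)]
  note h12 = mod_hom_plus[OF F h1 h2]
  have "t = ?L (?G ?n) (?G ?n) (\<lambda>x. (d' ?n (s ?n x) \<oplus>\<^bsub>?G ?n\<^esub> s n (d' n x)) \<oplus>\<^bsub>?G ?n\<^esub> \<phi> ?n (\<psi> ?n x)) t"
    by (rule tensor_left_id[OF F N mod_hom_plus[OF F h12 h3] c(6)[symmetric] t(1), symmetric])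
  also have "\<dots> = (?L (?G ?m) (?G ?n) (d' ?n) (?L (?G ?n) (?G ?m) (s ?n) t) \<oplus>\<^bsub>tensor R (?G ?n) N\<^esub>
      \<zero>\<^bsub>tensor R (?G ?n) N\<^esub>) \<oplus>\<^bsub>tensor R (?G ?n) N\<^esub> ?L (?G ?m) (?G ?n) (d' ?n) (?L (?F ?m) (?G ?m) (\<phi> ?m) u)"
    unfolding tensor_left_plus[OF F N F h12 h3 t(1)] tensor_left_plus[OF F N F h1 h2 t(1)] e1 e2 e3 ..
  finally have "t \<in> {x \<in> carrier (tensor R (?G ?n) N). x \<in> ?L (?G ?m) (?G ?n) (d' ?n) ` carrier (tensor R (?G ?m) N)}"
    using T submodule_image[OF T T hom[OF D'(1)], of ?n] module.submoduleE(5)[OF T submodule_image[OF T T hom[OF D'(1)], of ?n]]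
      cl[OF c(5) t(1)] cl[OF c(1) u(1)] submodule_zero_mem[OF submodule_image[OF T T hom[OF D'(1)], of ?n]] t(1)
    by (metis (no_types, lifting) imageI mem_Collect_eq)
  thus ?thesis by simp
qed

section \<open>The coresolution of the ring by powers of a semidualizing module\<close>

text \<open>The image of \<open>l \<otimes> c\<close> under
  \<open>Hom(A, R) \<otimes> C \<rightarrow> Hom(A, C)\<close>. For free \<open>A\<close> and
  \<open>l\<close> the coordinate at \<open>x\<close>, that is for \<open>coord_form\<close>, it is
  the inclusion of the copy of \<open>C\<close> with index \<open>x\<close> in
  \<open>Hom(A, C)\<close>.\<close>

definition scaled_form ::
  "('r, 'z) ring_scheme \<Rightarrow> ('r, 'c) module \<Rightarrow> ('r, 'a) module \<Rightarrow> ('a \<Rightarrow> 'r) \<Rightarrow> 'c \<Rightarrow> 'a \<Rightarrow> 'c" where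
  "scaled_form R C A l c = (\<lambda>u\<in>carrier A. l u \<odot>\<^bsub>C\<^esub> c)"

abbreviation coord_form ::
  "('r, 'z) ring_scheme \<Rightarrow> ('r, 'c) module \<Rightarrow> 'x set \<Rightarrow> 'x \<Rightarrow> 'c \<Rightarrow> ('x \<Rightarrow> 'r) \<Rightarrow> 'c" where
  "coord_form R C S x c \<equiv> scaled_form R C (free_module R S) (\<lambda>u. u x) c"

lemma ring_module_simps [simp]:
  "carrier (ring_module R) = carrier R" "\<zero>\<^bsub>ring_module R\<^esub> = \<zero>\<^bsub>R\<^esub>"
  "r \<oplus>\<^bsub>ring_module R\<^esub> s = r \<oplus>\<^bsub>R\<^esub> s" "r \<odot>\<^bsub>ring_module R\<^esub> s = r \<otimes>\<^bsub>R\<^esub> s"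
  by (simp_all add: ring_module_def)

lemma Hom_module_evaluate:
  assumes "a \<in> carrier A"
  shows "(\<lambda>f. f a) \<in> mod_hom R (Hom_module R A N) N"
  by (rule mod_homI) (use assms in \<open>auto simp: Hom_module_simps mod_hom_closed\<close>)

lemma Hom_module_eqI:
  assumes "f \<in> carrier (Hom_module R A N)" "g \<in> carrier (Hom_module R A N)"
    "\<And>a. a \<in> carrier A \<Longrightarrow> f a = g a"
  shows "f = g"
  by (rule extensionalityI[where A = "carrier A"]) (use assms in \<open>auto simp: Hom_module_simps\<close>)

lemma coord_hom:
  "(\<lambda>u. u x) \<in> mod_hom R (free_module R S) (ring_module R)"
  by (rule mod_homI) (auto simp: free_module_simps)

lemma scaled_form_closed:
  assumes "module R C" "module R A" "l \<in> mod_hom R A (ring_module R)" "c \<in> carrier C"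
  shows "scaled_form R C A l c \<in> carrier (Hom_module R A C)"
  unfolding scaled_form_def
  by (rule Hom_module_restrict[OF assms(2) mod_hom_comp[OF assms(3) smult_hom[OF assms(1,4)]]])

lemma scaled_form_hom:
  assumes C: "module R C" and A: "module R A" and l: "l \<in> mod_hom R A (ring_module R)"
  shows "scaled_form R C A l \<in> mod_hom R C (Hom_module R A C)"
proof -
  interpret C: module R C by fact
  have lc: "l u \<in> carrier R" if "u \<in> carrier A" for u using mod_hom_closed[OF l that] by simp
  have "l u \<otimes>\<^bsub>R\<^esub> r = r \<otimes>\<^bsub>R\<^esub> l u" if "u \<in> carrier A" "r \<in> carrier R" for u r
    using lc that C.m_comm by simp
  thus ?thesis
    by (intro mod_homI scaled_form_closed[OF C A l])
      (auto simp: scaled_form_def Hom_module_simps fun_eq_iff lc C.smult_r_distr C.smult_assoc1[symmetric])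
qed

lemma scaled_form_hom_left:
  assumes C: "module R C" and A: "module R A" and c: "c \<in> carrier C"
  shows "(\<lambda>l. scaled_form R C A l c) \<in> mod_hom R (Hom_module R A (ring_module R)) (Hom_module R A C)"
proof -
  interpret C: module R C by fact
  have lc: "l u \<in> carrier R" if "l \<in> mod_hom R A (ring_module R)" "u \<in> carrier A" for l u
    using mod_hom_closed[OF that] by simp
  show ?thesis
  proof (rule mod_homI)
    fix l assume "l \<in> carrier (Hom_module R A (ring_module R))"
    thus "scaled_form R C A l c \<in> carrier (Hom_module R A C)"
      by (intro scaled_form_closed[OF C A _ c]) (simp add: Hom_module_simps)
  qed (auto simp: scaled_form_def Hom_module_simps fun_eq_iff lc c C.smult_l_distr C.smult_assoc1)
qed

lemma coord_form_gen:
  assumes "module R C" "c \<in> carrier C" "x \<in> S" "y \<in> S"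
  shows "coord_form R C S x c (free_gen R y) = (if x = y then c else \<zero>\<^bsub>C\<^esub>)"
proof -
  interpret C: module R C by fact
  show ?thesis using assms free_gen_closed[OF C.is_cring, of y S]
    by (simp add: scaled_form_def free_gen_def)
qed

section \<open>The dual \<open>Hom(F, C)\<close> of a finite free module as a power of
  \<open>C\<close>\<close>

context
  fixes R :: "('r, 'z) ring_scheme" and C :: "('r, 'c) module" and S :: "'x set"
  assumes C: "module R C" and fin: "finite S"
begin

interpretation C: module R C by (rule C)

private abbreviation "F \<equiv> free_module R S"
private abbreviation "D \<equiv> Hom_module R F C"

private lemma F: "module R F" by (rule module_free_module[OF C.is_cring])
private lemma D: "module R D" by (rule module_Hom_module[OF F C])

text \<open>\<open>f\<close> is the sum over \<open>x \<in> S\<close> of the coordinate forms with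
  values \<open>f (free_gen R x)\<close>. This is a finite sum only because \<open>S\<close> is
  finite, which is why a resolution by finite free modules is required.\<close>

lemma dual_generated:
  assumes H: "submodule H R D" and gen: "\<And>x c. x \<in> S \<Longrightarrow> c \<in> carrier C \<Longrightarrow> coord_form R C S x c \<in> H"
    and f: "f \<in> carrier D"
  shows "f \<in> H"
proof -
  have fh: "f \<in> mod_hom R F C" using f by (simp add: Hom_module_simps)
  have "restrict (\<lambda>u. f (free_part R T u)) (carrier F) \<in> H" if "finite T" "T \<subseteq> S" for T
    using that
  proof (induction rule: finite_induct)
    case empty
    have "restrict (\<lambda>u. f (free_part R {} u)) (carrier F) = \<zero>\<^bsub>D\<^esub>"
      using mod_hom_zero[OF F C fh] by (simp add: Hom_module_simps free_part_empty[of R _ S])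
    thus ?case using submodule_zero_mem[OF H] by simp
  next
    case (insert x T)
    have x: "x \<in> S" "f (free_gen R x) \<in> carrier C"
      using insert mod_hom_closed[OF fh free_gen_closed[OF C.is_cring]] by auto
    interpret F: module R F by (rule F)
    have "f (free_part R (insert x T) u) = f (free_part R T u) \<oplus>\<^bsub>C\<^esub> u x \<odot>\<^bsub>C\<^esub> f (free_gen R x)"
      if u: "u \<in> carrier F" for u
      using x(1) free_part_insert[OF C.is_cring u insert.hyps(2)] free_coeff_closed[OF u]
        free_gen_closed[OF C.is_cring x(1)] mod_hom_closed[OF free_part_hom[OF C.is_cring] u]
      by (simp add: mod_hom_add[OF fh] mod_hom_smult[OF fh])
    hence eq: "restrict (\<lambda>u. f (free_part R (insert x T) u)) (carrier F) =
        restrict (\<lambda>u. f (free_part R T u)) (carrier F) \<oplus>\<^bsub>D\<^esub> coord_form R C S x (f (free_gen R x))"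
      by (auto simp: Hom_module_simps fun_eq_iff scaled_form_def)
    show ?case
      unfolding eq using insert by (intro module.submoduleE(5)[OF D H _ gen[OF x]]) blast
  qed
  from this[OF fin order_refl] have "restrict (\<lambda>u. f (free_part R S u)) (carrier F) \<in> H" .
  also have "restrict (\<lambda>u. f (free_part R S u)) (carrier F) = f"
    by (rule extensionalityI[where A = "carrier F"])
      (use f in \<open>auto simp: Hom_module_simps free_part_full[of _ R S] free_module_simps\<close>)
  finally show ?thesis .
qed

lemma dual_hom_eqI:
  assumes N: "module R N" and "v \<in> mod_hom R D N" "w \<in> mod_hom R D N"
    and "\<And>x c. x \<in> S \<Longrightarrow> c \<in> carrier C \<Longrightarrow> v (coord_form R C S x c) = w (coord_form R C S x c)"
    and f: "f \<in> carrier D"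
  shows "v f = w f"
proof -
  have "f \<in> {f \<in> carrier D. v f = w f}"
    by (rule dual_generated[OF submodule_equalizer[OF D N assms(2,3)] _ f])
      (use assms(4) scaled_form_closed[OF C F coord_hom] in auto)
  thus ?thesis by simp
qed

text \<open>Together with \<open>dual_hom_eqI\<close> this identifies
  \<open>Hom(Hom(F, C), N)\<close> with the families in \<open>Hom(C, N)\<close> indexed by
  \<open>S\<close>. The map is \<open>h \<mapsto> \<Sum> f x (h (free_gen R x))\<close>, built up
  one basis element at a time.\<close>

lemma dual_hom_exists:
  assumes N: "module R N" and f: "\<And>x. x \<in> S \<Longrightarrow> f x \<in> mod_hom R C N"
  obtains v where "v \<in> mod_hom R D N"
    "\<And>x c. x \<in> S \<Longrightarrow> c \<in> carrier C \<Longrightarrow> v (coord_form R C S x c) = f x c"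
proof -
  interpret N: module R N by fact
  have "\<exists>v\<in>mod_hom R D N. \<forall>x\<in>S. \<forall>c\<in>carrier C.
      v (coord_form R C S x c) = (if x \<in> T then f x c else \<zero>\<^bsub>N\<^esub>)" if "finite T" "T \<subseteq> S" for T
    using that
  proof (induction rule: finite_induct)
    case empty
    show ?case using mod_hom_const_zero[OF N] by (intro bexI[of _ "\<lambda>_. \<zero>\<^bsub>N\<^esub>"]) auto
  next
    case (insert x T)
    then obtain v where v: "v \<in> mod_hom R D N"
      "\<And>y c. y \<in> S \<Longrightarrow> c \<in> carrier C \<Longrightarrow> v (coord_form R C S y c) = (if y \<in> T then f y c else \<zero>\<^bsub>N\<^esub>)"
      by auto
    have x: "x \<in> S" using insert by simp
    let ?v = "\<lambda>h. v h \<oplus>\<^bsub>N\<^esub> f x (h (free_gen R x))"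
    have h: "?v \<in> mod_hom R D N"
      by (rule mod_hom_plus[OF N v(1) mod_hom_comp[OF Hom_module_evaluate[OF free_gen_closed[OF C.is_cring x]] f[OF x]]])
    have "?v (coord_form R C S y c) = (if y \<in> insert x T then f y c else \<zero>\<^bsub>N\<^esub>)"
      if "y \<in> S" "c \<in> carrier C" for y c
      using insert.hyps(2) v(2)[OF that] coord_form_gen[OF C that(2,1) x] mod_hom_zero[OF C N f[OF x]]
        mod_hom_closed[OF f[OF that(1)] that(2)] by (cases "y = x") simp_all
    thus ?case by (intro bexI[OF _ h] ballI)
  qed
  from this[OF fin order_refl] show ?thesis using that by auto
qed

lemma fin_gen_dual:
  assumes "fin_gen R C"
  shows "fin_gen R D"
proof -
  obtain X where X: "finite X" "X \<subseteq> carrier C" "mod_span R C X = carrier C"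
    using assms by (auto simp: fin_gen_def)
  let ?Y = "(\<lambda>(x, c). coord_form R C S x c) ` (S \<times> X)"
  note cl = scaled_form_closed[OF C F coord_hom]
  have Y: "?Y \<subseteq> carrier D" using X(2) cl by auto
  note sp = submodule_mod_span[OF D Y]
  have "f \<in> mod_span R D ?Y" if f: "f \<in> carrier D" for f
  proof (rule dual_generated[OF sp _ f])
    fix x c assume x: "x \<in> S" and c: "c \<in> carrier C"
    have "X \<subseteq> {c \<in> carrier C. coord_form R C S x c \<in> mod_span R D ?Y}"
      using X(2) x mod_span_base[of ?Y R D] by auto
    from mod_span_subset[OF submodule_preimage[OF C D scaled_form_hom[OF C F coord_hom] sp] this]
    show "coord_form R C S x c \<in> mod_span R D ?Y" using X(3) c by auto
  qed
  hence "mod_span R D ?Y = carrier D" using submodule_subset[OF sp] by auto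
  thus ?thesis unfolding fin_gen_def using fin X(1) Y by (intro exI[of _ ?Y]) auto
qed

text \<open>Lifting out of a finite power of \<open>C\<close> is lifting in each coordinate.\<close>

lemma hom_lifts_dual:
  assumes N: "module R N" and N': "module R N'" and p: "p \<in> mod_hom R N N'"
    and l: "hom_lifts R C N p N'"
  shows "hom_lifts R D N p N'"
  unfolding hom_lifts_def
proof
  fix w assume w: "w \<in> mod_hom R D N'"
  have "\<forall>x\<in>S. \<exists>g. g \<in> mod_hom R C N \<and> (\<forall>c\<in>carrier C. p (g c) = w (coord_form R C S x c))"
    using hom_liftsD[OF l mod_hom_comp[OF scaled_form_hom[OF C F coord_hom] w]] by metis
  then obtain g where g: "\<And>x. x \<in> S \<Longrightarrow> g x \<in> mod_hom R C N"
    "\<And>x c. x \<in> S \<Longrightarrow> c \<in> carrier C \<Longrightarrow> p (g x c) = w (coord_form R C S x c)" by metis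
  obtain v where v: "v \<in> mod_hom R D N"
    "\<And>x c. x \<in> S \<Longrightarrow> c \<in> carrier C \<Longrightarrow> v (coord_form R C S x c) = g x c"
    using dual_hom_exists[OF N, of g] g(1) by blast
  have "p (v h) = w h" if "h \<in> carrier D" for h
    by (rule dual_hom_eqI[OF N' mod_hom_comp[OF v(1) p] w _ that]) (simp add: v(2) g(2))
  thus "\<exists>v\<in>mod_hom R D N. \<forall>x\<in>carrier D. p (v x) = w x" using v(1) by blast
qed

end

lemma hom_lifts_free:
  assumes "cring R" "module R N" "module R N'" "p \<in> mod_hom R N N'" "p ` carrier N = carrier N'"
  shows "hom_lifts R (free_module R S) N p N'"
  unfolding hom_lifts_def
proof
  fix w assume w: "w \<in> mod_hom R (free_module R S) N'"
  have "w u \<in> p ` carrier N" if "u \<in> carrier (free_module R S)" for u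
    using mod_hom_closed[OF w that] assms(5) by simp
  from free_module_lift[OF assms(1-4) w this]
  show "\<exists>v\<in>mod_hom R (free_module R S) N. \<forall>x\<in>carrier (free_module R S). p (v x) = w x" by metis
qed

lemma Hom_precompose:
  assumes "module R A" "module R A'" "d \<in> mod_hom R A' A"
  shows "(\<lambda>f. compose (carrier A') f d) \<in> mod_hom R (Hom_module R A N) (Hom_module R A' N)"
proof (rule mod_homI)
  fix f assume "f \<in> carrier (Hom_module R A N)"
  hence "f \<in> mod_hom R A N" by (simp add: Hom_module_simps)
  thus "compose (carrier A') f d \<in> carrier (Hom_module R A' N)"
    unfolding compose_def by (rule Hom_module_restrict[OF assms(2) mod_hom_comp[OF assms(3)]])
qed (auto simp: Hom_module_simps compose_def fun_eq_iff mod_hom_closed[OF assms(3)])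

text \<open>The assumption \<open>ext\<close> is the vanishing of \<open>Ext^i(C, C)\<close> for
  \<open>i > 0\<close>, read off the finite resolution itself instead of
  \<open>chosen_resolution\<close>.\<close>

locale semidualizing_resolution =
  fixes R :: "('r, 'z) ring_scheme" and C :: "('r, 'c) module" and S :: "nat \<Rightarrow> 'x set"
    and d :: "nat \<Rightarrow> ('x \<Rightarrow> 'r) \<Rightarrow> 'x \<Rightarrow> 'r" and \<epsilon> :: "('x \<Rightarrow> 'r) \<Rightarrow> 'c"
  assumes C: "module R C" and fg: "fin_gen R C"
    and res: "nat_resolution R C S d \<epsilon>" and fin: "\<And>n. finite (S n)"
    and homothety: "homothety R C \<in> mod_iso R (ring_module R) (Hom_module R C C)"
    and ext: "\<And>n. hom_exact R (free_module R (S (Suc (Suc n)))) (d (Suc n)) (free_module R (S (Suc n)))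
      (d n) (free_module R (S n)) C"
begin

lemma cring_R: "cring R" using C by (simp add: module_def)

abbreviation "G n \<equiv> free_module R (S n)"
abbreviation "D n \<equiv> Hom_module R (G n) C"

definition \<delta> :: "nat \<Rightarrow> (('x \<Rightarrow> 'r) \<Rightarrow> 'c) \<Rightarrow> ('x \<Rightarrow> 'r) \<Rightarrow> 'c" where
  "\<delta> n f = compose (carrier (G (Suc n))) f (d n)"

text \<open>The augmentation as an element of \<open>Hom(G_0, C)\<close>, equivalently the image of
  1 under \<open>R \<rightarrow> Hom(C, C) \<rightarrow> Hom(G_0, C)\<close>. The coresolution
  begins with \<open>r \<mapsto> r e\<close>.\<close>

definition e :: "('x \<Rightarrow> 'r) \<Rightarrow> 'c" where "e = restrict \<epsilon> (carrier (G 0))"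

lemmas d_hom = nat_resolutionD(1)[OF res] and \<epsilon>_hom = nat_resolutionD(2)[OF res]
  and \<epsilon>_surj = nat_resolutionD(3)[OF res]
  and \<epsilon>_ker = nat_resolutionD(4)[OF res] and d_ker = nat_resolutionD(5)[OF res]

lemma module_G: "module R (G n)" by (rule module_free_module[OF cring_R])
lemma module_D: "module R (D n)" by (rule module_Hom_module[OF module_G C])
lemma module_R: "module R (ring_module R)" by (rule module_ring_module[OF cring_R])

lemma d_d: "x \<in> carrier (G (Suc (Suc n))) \<Longrightarrow> d n (d (Suc n) x) = \<zero>\<^bsub>G n\<^esub>"
  by (subst d_ker[OF mod_hom_closed[OF d_hom]]) auto

lemma \<epsilon>_d: "x \<in> carrier (G (Suc 0)) \<Longrightarrow> \<epsilon> (d 0 x) = \<zero>\<^bsub>C\<^esub>"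
  by (subst \<epsilon>_ker[OF mod_hom_closed[OF d_hom]]) auto

lemma \<delta>_hom: "\<delta> n \<in> mod_hom R (D n) (D (Suc n))"
  using Hom_precompose[OF module_G module_G d_hom] by (simp add: \<delta>_def[abs_def])

lemma e_closed: "e \<in> carrier (D 0)"
  unfolding e_def by (rule Hom_module_restrict[OF module_G \<epsilon>_hom])

lemma smult_e_hom: "(\<lambda>r. r \<odot>\<^bsub>D 0\<^esub> e) \<in> mod_hom R (ring_module R) (D 0)"
  by (rule smult_hom[OF module_D e_closed])

lemma \<delta>_apply: "u \<in> carrier (G (Suc n)) \<Longrightarrow> \<delta> n f u = f (d n u)"
  by (simp add: \<delta>_def compose_def)

lemma \<delta>_zero_iff:
  assumes "f \<in> carrier (D n)"
  shows "\<delta> n f = \<zero>\<^bsub>D (Suc n)\<^esub> \<longleftrightarrow> (\<forall>u\<in>carrier (G (Suc n)). f (d n u) = \<zero>\<^bsub>C\<^esub>)"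
  by (auto simp: \<delta>_def compose_def Hom_module_simps fun_eq_iff)

lemma \<delta>_\<delta>:
  assumes "f \<in> carrier (D n)"
  shows "\<delta> (Suc n) (\<delta> n f) = \<zero>\<^bsub>D (Suc (Suc n))\<^esub>"
proof -
  have "f \<in> mod_hom R (G n) C" using assms by (simp add: Hom_module_simps)
  thus ?thesis
    unfolding \<delta>_zero_iff[OF mod_hom_closed[OF \<delta>_hom assms]]
    by (simp add: \<delta>_apply mod_hom_closed[OF d_hom] d_d mod_hom_zero[OF module_G C])
qed

lemma \<delta>_smult_e:
  assumes "r \<in> carrier R"
  shows "\<delta> 0 (r \<odot>\<^bsub>D 0\<^esub> e) = \<zero>\<^bsub>D (Suc 0)\<^esub>"
proof -
  interpret C: module R C by (rule C)
  show ?thesis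
    unfolding \<delta>_zero_iff[OF module.smult_closed[OF module_D assms e_closed]] using assms
    by (simp add: Hom_module_simps e_def mod_hom_closed[OF d_hom] \<epsilon>_d)
qed

lemma homothety_bij: "bij_betw (homothety R C) (carrier R) (carrier (Hom_module R C C))"
  using homothety by (simp add: mod_iso_def)

text \<open>Since \<open>\<epsilon>\<close> is onto, \<open>r e = 0\<close> says that
  \<open>r\<close> annihilates \<open>C\<close>, and the homothety map is injective.\<close>

lemma e_torsion_free:
  assumes r: "r \<in> carrier R" and z: "r \<odot>\<^bsub>D 0\<^esub> e = \<zero>\<^bsub>D 0\<^esub>"
  shows "r = \<zero>\<^bsub>R\<^esub>"
proof -
  interpret C: module R C by (rule C)
  have "r \<odot>\<^bsub>C\<^esub> c = \<zero>\<^bsub>C\<^esub>" if c: "c \<in> carrier C" for c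
  proof -
    obtain u where u: "u \<in> carrier (G 0)" "c = \<epsilon> u" using c \<epsilon>_surj by auto
    show ?thesis using fun_cong[OF z, of u] u by (simp add: Hom_module_simps e_def)
  qed
  hence "homothety R C r = homothety R C \<zero>\<^bsub>R\<^esub>" by (auto simp: homothety_def fun_eq_iff)
  thus ?thesis using homothety_bij r by (auto simp: bij_betw_def inj_on_def)
qed

text \<open>\<open>f\<close> kills the image of \<open>d 0\<close>, so it descends to an
  endomorphism of \<open>C\<close>; this is multiplication by a scalar because the homothety map is
  onto.\<close>

lemma dual_exact_zero:
  assumes f: "f \<in> carrier (D 0)" and z: "\<delta> 0 f = \<zero>\<^bsub>D (Suc 0)\<^esub>"
  shows "f \<in> (\<lambda>r. r \<odot>\<^bsub>D 0\<^esub> e) ` carrier R"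
proof -
  have fh: "f \<in> mod_hom R (G 0) C" using f by (simp add: Hom_module_simps)
  have ker: "f u = \<zero>\<^bsub>C\<^esub>" if u: "u \<in> carrier (G 0)" "\<epsilon> u = \<zero>\<^bsub>C\<^esub>" for u
    using \<epsilon>_ker[OF u(1)] u(2) z[unfolded \<delta>_zero_iff[OF f]] by auto
  obtain g where g: "g \<in> mod_hom R C C" "\<And>u. u \<in> carrier (G 0) \<Longrightarrow> g (\<epsilon> u) = f u"
    by (rule mod_hom_factor[OF module_G C \<epsilon>_hom C _ fh ker]) (use \<epsilon>_surj in auto)
  have "restrict g (carrier C) \<in> homothety R C ` carrier R"
    using Hom_module_restrict[OF C g(1)] homothety_bij by (simp add: bij_betw_def)
  then obtain r where r: "r \<in> carrier R" "restrict g (carrier C) = homothety R C r" by blast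
  have "f u = (r \<odot>\<^bsub>D 0\<^esub> e) u" if u: "u \<in> carrier (G 0)" for u
    using fun_cong[OF r(2), of "\<epsilon> u"] g(2)[OF u] u mod_hom_closed[OF \<epsilon>_hom u]
    by (simp add: Hom_module_simps e_def homothety_def)
  hence "f = r \<odot>\<^bsub>D 0\<^esub> e" by (rule Hom_module_eqI[OF f module.smult_closed[OF module_D r(1) e_closed]])
  thus ?thesis using r(1) by blast
qed

lemma dual_exact_Suc:
  assumes f: "f \<in> carrier (D (Suc n))" and z: "\<delta> (Suc n) f = \<zero>\<^bsub>D (Suc (Suc n))\<^esub>"
  shows "f \<in> \<delta> n ` carrier (D n)"
proof -
  have fh: "f \<in> mod_hom R (G (Suc n)) C" using f by (simp add: Hom_module_simps)
  obtain v where v: "v \<in> mod_hom R (G n) C" "\<And>y. y \<in> carrier (G (Suc n)) \<Longrightarrow> f y = v (d n y)"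
    using hom_exactD[OF ext fh] z[unfolded \<delta>_zero_iff[OF f]] by blast
  have v': "restrict v (carrier (G n)) \<in> carrier (D n)" by (rule Hom_module_restrict[OF module_G v(1)])
  have "f = \<delta> n (restrict v (carrier (G n)))"
    by (rule Hom_module_eqI[OF f mod_hom_closed[OF \<delta>_hom v']]) (simp add: \<delta>_apply mod_hom_closed[OF d_hom] v(2))
  thus ?thesis using v' by blast
qed

text \<open>
  The module \<open>N\<close> is \<^emph>\<open>dual exact\<close> if \<open>Hom(-, N)\<close> is exact on the coresolution
  \<open>0 \<rightarrow> R \<rightarrow> Hom(G\<^sub>0, C) \<rightarrow> Hom(G\<^sub>1, C) \<rightarrow> \<dots>\<close> of \<open>R\<close>. As \<open>Hom(Hom(G\<^sub>n, C), N)\<close> is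
  \<open>G\<^sub>n \<otimes> Hom(C, N)\<close>, this says that \<open>C \<otimes> Hom(C, N) \<rightarrow> N\<close> is an isomorphism and that
  \<open>Tor\<^sub>i(C, Hom(C, N)) = 0\<close> for \<open>i > 0\<close>.
\<close>

definition dual_exact :: "('r, 'n) module \<Rightarrow> bool" where
  "dual_exact N \<longleftrightarrow>
     hom_exact R (ring_module R) (\<lambda>_. \<zero>\<^bsub>R\<^esub>) (ring_module R) (\<lambda>r. r \<odot>\<^bsub>D 0\<^esub> e) (D 0) N \<and>
     hom_exact R (ring_module R) (\<lambda>r. r \<odot>\<^bsub>D 0\<^esub> e) (D 0) (\<delta> 0) (D (Suc 0)) N \<and>
     (\<forall>n. hom_exact R (D n) (\<delta> n) (D (Suc n)) (\<delta> (Suc n)) (D (Suc (Suc n))) N)"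

text \<open>The coresolution is exact by \<open>e_torsion_free\<close>,
  \<open>dual_exact_zero\<close> and \<open>dual_exact_Suc\<close>. Extension into injectives was
  established for finitely generated targets only, and \<open>fin_gen_dual\<close> provides
  these.\<close>

lemma dual_exact_injective:
  assumes "injective_module R N"
  shows "dual_exact N"
  unfolding dual_exact_def
proof (intro conjI allI)
  note fgD = fin_gen_dual[OF C fin fg]
  show "hom_exact R (ring_module R) (\<lambda>_. \<zero>\<^bsub>R\<^esub>) (ring_module R) (\<lambda>r. r \<odot>\<^bsub>D 0\<^esub> e) (D 0) N"
    by (rule hom_exact_injective[OF assms module_R module_D fgD smult_e_hom])
      (use e_torsion_free cring.cring_simprules(2)[OF cring_R] in auto)
  show "hom_exact R (ring_module R) (\<lambda>r. r \<odot>\<^bsub>D 0\<^esub> e) (D 0) (\<delta> 0) (D (Suc 0)) N"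
    by (rule hom_exact_injective[OF assms module_D module_D fgD \<delta>_hom]) (use dual_exact_zero in auto)
  show "hom_exact R (D n) (\<delta> n) (D (Suc n)) (\<delta> (Suc n)) (D (Suc (Suc n))) N" for n
    by (rule hom_exact_injective[OF assms module_D module_D fgD \<delta>_hom dual_exact_Suc])
qed

text \<open>Each clause for the kernel uses the same clause for \<open>N\<close>, the next clause
  for \<open>N'\<close>, and lifting out of the term after that, which is a finite power of
  \<open>C\<close>.\<close>

lemma dual_exact_kernel:
  assumes N: "module R N" and N': "module R N'" and p: "p \<in> mod_hom R N N'"
    and K: "K = {x \<in> carrier N. p x = \<zero>\<^bsub>N'\<^esub>}"
    and ex: "dual_exact N" "dual_exact N'" and l: "hom_lifts R C N p N'"
  shows "dual_exact (N\<lparr>carrier := K\<rparr>)"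
  unfolding dual_exact_def
proof (intro conjI allI)
  note lD = hom_lifts_dual[OF C fin N N' p l]
  show "hom_exact R (ring_module R) (\<lambda>_. \<zero>\<^bsub>R\<^esub>) (ring_module R) (\<lambda>r. r \<odot>\<^bsub>D 0\<^esub> e) (D 0) (N\<lparr>carrier := K\<rparr>)"
    by (rule hom_exact_kernel[where c = "\<delta> 0" and ?P3.0 = "D (Suc 0)", OF N N' p K module_R module_D module_D smult_e_hom \<delta>_hom _ _ _ lD])
      (use ex \<delta>_smult_e in \<open>auto simp: dual_exact_def\<close>)
  show "hom_exact R (ring_module R) (\<lambda>r. r \<odot>\<^bsub>D 0\<^esub> e) (D 0) (\<delta> 0) (D (Suc 0)) (N\<lparr>carrier := K\<rparr>)"
    by (rule hom_exact_kernel[where c = "\<delta> (Suc 0)" and ?P3.0 = "D (Suc (Suc 0))",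
          OF N N' p K module_D module_D module_D \<delta>_hom \<delta>_hom _ _ _ lD])
      (use ex \<delta>_\<delta> in \<open>auto simp: dual_exact_def\<close>)
  show "hom_exact R (D n) (\<delta> n) (D (Suc n)) (\<delta> (Suc n)) (D (Suc (Suc n))) (N\<lparr>carrier := K\<rparr>)" for n
    by (rule hom_exact_kernel[where c = "\<delta> (Suc (Suc n))" and ?P3.0 = "D (Suc (Suc (Suc n)))",
          OF N N' p K module_D module_D module_D \<delta>_hom \<delta>_hom _ _ _ lD])
      (use ex \<delta>_\<delta> in \<open>auto simp: dual_exact_def\<close>)
qed

lemma dual_exact_power:
  assumes "dual_exact N"
  shows "dual_exact (power_module N n)"
  using assms unfolding dual_exact_def
  by (auto intro!: hom_exact_power smult_e_hom \<delta>_hom mod_hom_const_zero[OF module_R, simplified])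

lemma dual_exact_zero_module: "module R N \<Longrightarrow> zero_module N \<Longrightarrow> dual_exact N"
  by (simp add: dual_exact_def hom_exact_zero_module)

text \<open>The first clause of \<open>dual_exact\<close>, read through
  \<open>Hom(R, N) = N\<close>: evaluation at \<open>e\<close> maps \<open>Hom(D 0, N)\<close> onto
  \<open>N\<close>.\<close>

lemma dual_exact_value:
  assumes N: "module R N" and ex: "dual_exact N" and z: "z \<in> carrier N"
  obtains v where "v \<in> mod_hom R (D 0) N" "v e = z"
proof -
  have h: "(\<lambda>r. r \<odot>\<^bsub>N\<^esub> z) \<in> mod_hom R (ring_module R) N" by (rule smult_hom[OF N z])
  interpret N: module R N by (rule N)
  obtain v where v: "v \<in> mod_hom R (D 0) N" "\<And>r. r \<in> carrier R \<Longrightarrow> r \<odot>\<^bsub>N\<^esub> z = v (r \<odot>\<^bsub>D 0\<^esub> e)"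
    using hom_exactD[OF ex[unfolded dual_exact_def, THEN conjunct1] h] z by auto
  have "v e = z" using v(2)[OF N.one_closed] z e_closed module.smult_one[OF module_D e_closed] by simp
  with v(1) that show ?thesis by blast
qed

text \<open>An induction rule expressing that \<open>C \<otimes> Hom(C, N) \<rightarrow> N\<close>
  is onto. Every \<open>z\<close> is \<open>v e\<close> for some \<open>v\<close>, and
  \<open>e\<close> is a sum of elements in the copies of \<open>C\<close> inside
  \<open>D 0\<close>.\<close>

lemma dual_exact_generated:
  assumes N: "module R N" and ex: "dual_exact N" and H: "submodule H R N"
    and gen: "\<And>f c. f \<in> mod_hom R C N \<Longrightarrow> c \<in> carrier C \<Longrightarrow> f c \<in> H" and z: "z \<in> carrier N"
  shows "z \<in> H"
proof -
  obtain v where v: "v \<in> mod_hom R (D 0) N" "v e = z" by (rule dual_exact_value[OF N ex z])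
  have "e \<in> {h \<in> carrier (D 0). v h \<in> H}"
    by (rule dual_generated[OF C fin submodule_preimage[OF module_D N v(1) H] _ e_closed])
      (use gen[OF mod_hom_comp[OF scaled_form_hom[OF C module_G coord_hom] v(1)]]
        scaled_form_closed[OF C module_G coord_hom] in auto)
  thus ?thesis using v(2) by simp
qed

text \<open>
  A linear map \<open>\<rho>: Hom(C, N) \<rightarrow> Hom(C, N')\<close> induces \<open>Hom(Hom(G\<^sub>n, C), N) \<rightarrow> Hom(Hom(G\<^sub>n, C), N')\<close>
  coordinatewise, for \<open>n = 0, 1\<close>, and hence a map on the cokernels.
\<close>

lemma dual_exact_induced:
  fixes N :: "('r, 'n) module"
  assumes N: "module R N" and ex: "dual_exact N" and N': "module R N'"
    and \<rho>: "\<rho> \<in> mod_hom R (Hom_module R C N) (Hom_module R C N')"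
  obtains p where "p \<in> mod_hom R N N'"
    "\<And>f c. f \<in> carrier (Hom_module R C N) \<Longrightarrow> c \<in> carrier C \<Longrightarrow> p (f c) = \<rho> f c"
proof -
  interpret C: module R C by (rule C)
  interpret N: module R N by (rule N)
  interpret N': module R N' by (rule N')
  let ?H = "Hom_module R C N" and ?H' = "Hom_module R C N'"
  note mH = module_Hom_module[OF C N] and mH' = module_Hom_module[OF C N']
  note cf = scaled_form_hom[OF C module_G coord_hom]
  \<comment> \<open>The components of \<open>v\<close> under the identification of
    \<open>Hom(Hom(G_n, C), N)\<close> with families in \<open>Hom(C, N)\<close>. The relation
    \<open>Rel\<close> below then says that \<open>v'\<close> is the coordinatewise image of
    \<open>v\<close> under \<open>\<rho>\<close>.\<close>
  define comp where "comp n v x = restrict (\<lambda>c. v (coord_form R C (S n) x c)) (carrier C)"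
    for n x and v :: "(('x \<Rightarrow> 'r) \<Rightarrow> 'c) \<Rightarrow> 'n"
  have comp: "comp n v x \<in> carrier ?H" if "v \<in> mod_hom R (D n) N" for n v x
    unfolding comp_def by (rule Hom_module_restrict[OF C mod_hom_comp[OF cf that]])
  have \<rho>h: "\<rho> f \<in> mod_hom R C N'" if "f \<in> carrier ?H" for f
    using mod_hom_closed[OF \<rho> that] by (simp add: Hom_module_simps)
  define Rel where "Rel n v v' \<longleftrightarrow> v' \<in> mod_hom R (D n) N' \<and>
      (\<forall>x\<in>S n. \<forall>c\<in>carrier C. v' (coord_form R C (S n) x c) = \<rho> (comp n v x) c)" for n v v'
  have Rel_ex: "\<exists>v'. Rel n v v'" if "v \<in> mod_hom R (D n) N" for n v
    using dual_hom_exists[OF C fin N', of n "\<lambda>x. \<rho> (comp n v x)"] \<rho>h[OF comp[OF that]]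
    unfolding Rel_def by metis
  have uniq: "v' h = v'' h" if "Rel n v v'" "Rel n v v''" "h \<in> carrier (D n)" for n v v' v'' h
    by (rule dual_hom_eqI[OF C fin N' _ _ _ that(3)]) (use that(1,2) in \<open>auto simp: Rel_def\<close>)
  \<comment> \<open>\<open>Rel\<close> prescribes \<open>y'\<close> on coordinate forms only. The
    rule is extended to every linear form \<open>l\<close>, since compatibility with
    \<open>\<delta> 0\<close> involves the coordinates of \<open>d 0\<close>.\<close>
  have Rel_form: "y' (scaled_form R C (G n) l c) = \<rho> (restrict (\<lambda>c. y (scaled_form R C (G n) l c)) (carrier C)) c"
    if y: "y \<in> mod_hom R (D n) N" and rel: "Rel n y y'" and l: "l \<in> mod_hom R (G n) (ring_module R)"
      and c: "c \<in> carrier C" for n y y' l c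
  proof -
    have y': "y' \<in> mod_hom R (D n) N'" using rel by (simp add: Rel_def)
    let ?L = "Hom_module R (G n) (ring_module R)"
    note sl = scaled_form_hom_left[OF C module_G]
    have lh: "k \<in> mod_hom R (G n) (ring_module R)" if "k \<in> carrier ?L" for k
      using that by (simp add: Hom_module_simps)
    define A where "A k = restrict (\<lambda>c. y (scaled_form R C (G n) k c)) (carrier C)" for k
    have Ah: "A \<in> mod_hom R ?L ?H"
    proof (rule mod_homI)
      fix k assume k: "k \<in> carrier ?L"
      show "A k \<in> carrier ?H" unfolding A_def
        by (rule Hom_module_restrict[OF C mod_hom_comp[OF scaled_form_hom[OF C module_G lh[OF k]] y]])
    qed (auto simp: A_def Hom_module_simps(3,4)[of R C N] fun_eq_iff mod_hom_add[OF sl] mod_hom_smult[OF sl]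
        mod_hom_add[OF y] mod_hom_smult[OF y] mod_hom_closed[OF sl])
    define k where "k = restrict l (carrier (G n))"
    have k: "k \<in> carrier ?L" unfolding k_def by (rule Hom_module_restrict[OF module_G l])
    \<comment> \<open>Both sides are linear in the form \<open>k\<close>, and forms on
      \<open>G n\<close> are generated by multiples of coordinates: \<open>dual_hom_eqI\<close> is
      applied with the ring in place of \<open>C\<close>.\<close>
    have "y' (scaled_form R C (G n) k c) = \<rho> (A k) c"
    proof (rule dual_hom_eqI[OF module_R fin N' mod_hom_comp[OF sl[OF c] y']
          mod_hom_comp[OF mod_hom_comp[OF Ah \<rho>] Hom_module_evaluate[OF c]] _ k])
      fix x r assume x: "x \<in> S n" and "r \<in> carrier (ring_module R)"
      hence r: "r \<in> carrier R" by simp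
      have sf: "scaled_form R C (G n) (coord_form R (ring_module R) (S n) x r) b = coord_form R C (S n) x (r \<odot>\<^bsub>C\<^esub> b)"
        if "b \<in> carrier C" for b
        using that r by (auto simp: scaled_form_def fun_eq_iff C.smult_assoc1 free_coeff_closed)
      have "A (coord_form R (ring_module R) (S n) x r) = r \<odot>\<^bsub>?H\<^esub> comp n y x"
        using r by (auto simp: A_def sf comp_def Hom_module_simps(4)[of R C N] fun_eq_iff
            mod_hom_smult[OF cf] mod_hom_smult[OF y] mod_hom_closed[OF cf])
      hence "\<rho> (A (coord_form R (ring_module R) (S n) x r)) c = r \<odot>\<^bsub>N'\<^esub> \<rho> (comp n y x) c"
        using r c by (simp add: mod_hom_smult[OF \<rho> r comp[OF y]] Hom_module_simps(4)[of R C N'])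
      also have "\<dots> = \<rho> (comp n y x) (r \<odot>\<^bsub>C\<^esub> c)"
        using mod_hom_smult[OF \<rho>h[OF comp[OF y]] r c] by simp
      also have "\<dots> = y' (coord_form R C (S n) x (r \<odot>\<^bsub>C\<^esub> c))"
        using rel x r c by (simp add: Rel_def)
      finally show "y' (scaled_form R C (G n) (coord_form R (ring_module R) (S n) x r) c) =
          \<rho> (A (coord_form R (ring_module R) (S n) x r)) c"
        by (simp add: sf c)
    qed
    moreover have "scaled_form R C (G n) k b = scaled_form R C (G n) l b" for b
      by (auto simp: scaled_form_def k_def fun_eq_iff)
    ultimately show ?thesis by (simp add: A_def)
  qed
  let ?V = "Hom_module R (D 0) N"
  note mV = module_Hom_module[OF module_D N, of 0]
  have Vh: "v \<in> mod_hom R (D 0) N" if "v \<in> carrier ?V" for v using that by (simp add: Hom_module_simps)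
  define \<Phi> where "\<Phi> v = (SOME v'. Rel 0 v v')" for v
  have \<Phi>: "Rel 0 v (\<Phi> v)" if "v \<in> mod_hom R (D 0) N" for v
    unfolding \<Phi>_def by (rule someI_ex[OF Rel_ex[OF that]])
  have \<Phi>h: "\<Phi> v \<in> mod_hom R (D 0) N'" if "v \<in> mod_hom R (D 0) N" for v
    using \<Phi>[OF that] by (simp add: Rel_def)
  \<comment> \<open>\<open>\<Phi>\<close> is picked by \<open>SOME\<close>, yet its values on
    \<open>D 0\<close> are determined by \<open>Rel\<close>; this makes \<open>\<Phi> v e\<close>
    linear in \<open>v\<close>.\<close>
  have Fh: "(\<lambda>v. \<Phi> v e) \<in> mod_hom R ?V N'"
  proof (rule mod_homI)
    fix v assume v: "v \<in> carrier ?V"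
    show "\<Phi> v e \<in> carrier N'" by (rule mod_hom_closed[OF \<Phi>h[OF Vh[OF v]] e_closed])
    fix w assume w: "w \<in> carrier ?V"
    have c0: "comp 0 (v \<oplus>\<^bsub>?V\<^esub> w) x = comp 0 v x \<oplus>\<^bsub>?H\<^esub> comp 0 w x" for x
      by (auto simp: comp_def Hom_module_simps(3) fun_eq_iff mod_hom_closed[OF cf])
    have "Rel 0 (v \<oplus>\<^bsub>?V\<^esub> w) (\<lambda>h. \<Phi> v h \<oplus>\<^bsub>N'\<^esub> \<Phi> w h)"
      unfolding Rel_def c0 mod_hom_add[OF \<rho> comp[OF Vh[OF v]] comp[OF Vh[OF w]]]
      using \<Phi>[OF Vh[OF v]] \<Phi>[OF Vh[OF w]]
      by (auto simp: Rel_def Hom_module_simps(3)[of R C N'] intro!: mod_hom_plus N')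
    from uniq[OF \<Phi> this e_closed] show "\<Phi> (v \<oplus>\<^bsub>?V\<^esub> w) e = \<Phi> v e \<oplus>\<^bsub>N'\<^esub> \<Phi> w e"
      using Vh abelian_monoid.a_closed[OF abelian_group.axioms(1)[OF module.axioms(2)[OF mV]] v w] by blast
  next
    fix r v assume r: "r \<in> carrier R" and v: "v \<in> carrier ?V"
    have c0: "comp 0 (r \<odot>\<^bsub>?V\<^esub> v) x = r \<odot>\<^bsub>?H\<^esub> comp 0 v x" for x
      by (auto simp: comp_def Hom_module_simps(4) fun_eq_iff mod_hom_closed[OF cf])
    have "Rel 0 (r \<odot>\<^bsub>?V\<^esub> v) (\<lambda>h. r \<odot>\<^bsub>N'\<^esub> \<Phi> v h)"
      unfolding Rel_def c0 mod_hom_smult[OF \<rho> r comp[OF Vh[OF v]]]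
      using \<Phi>[OF Vh[OF v]] r
      by (auto simp: Rel_def Hom_module_simps(4)[of R C N'] intro!: mod_hom_scale N')
    from uniq[OF \<Phi> this e_closed] show "\<Phi> (r \<odot>\<^bsub>?V\<^esub> v) e = r \<odot>\<^bsub>N'\<^esub> \<Phi> v e"
      using Vh module.smult_closed[OF mV r v] by blast
  qed
  \<comment> \<open>By the second clause of \<open>dual_exact\<close>, \<open>v\<close> is
    \<open>y \<circ> \<delta> 0\<close>. Hence \<open>\<Phi> v\<close> agrees with
    \<open>y' \<circ> \<delta> 0\<close> for the image \<open>y'\<close> of \<open>y\<close>, and
    \<open>\<delta> 0 e = 0\<close>.\<close>
  have ker: "\<Phi> v e = \<zero>\<^bsub>N'\<^esub>" if v: "v \<in> carrier ?V" and ve: "v e = \<zero>\<^bsub>N\<^esub>" for v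
  proof -
    note vh = Vh[OF v]
    have "v (r \<odot>\<^bsub>D 0\<^esub> e) = \<zero>\<^bsub>N\<^esub>" if "r \<in> carrier (ring_module R)" for r
      using that mod_hom_smult[OF vh _ e_closed] ve by simp
    then obtain y where y: "y \<in> mod_hom R (D (Suc 0)) N" "\<And>f. f \<in> carrier (D 0) \<Longrightarrow> v f = y (\<delta> 0 f)"
      using hom_exactD[OF ex[unfolded dual_exact_def, THEN conjunct2, THEN conjunct1] vh] by blast
    obtain y' where y': "Rel (Suc 0) y y'" using Rel_ex[OF y(1)] by blast
    hence y'h: "y' \<in> mod_hom R (D (Suc 0)) N'" by (simp add: Rel_def)
    have "Rel 0 v (\<lambda>f. y' (\<delta> 0 f))"
      unfolding Rel_def
    proof (intro conjI ballI)
      show "(\<lambda>f. y' (\<delta> 0 f)) \<in> mod_hom R (D 0) N'" by (rule mod_hom_comp[OF \<delta>_hom y'h])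
      fix x c assume x: "x \<in> S 0" and c: "c \<in> carrier C"
      have sf: "\<delta> 0 (coord_form R C (S 0) x b) = scaled_form R C (G (Suc 0)) (\<lambda>u. d 0 u x) b" for b
        by (auto simp: \<delta>_def compose_def scaled_form_def fun_eq_iff mod_hom_closed[OF d_hom])
      have "comp 0 v x = restrict (\<lambda>c. y (scaled_form R C (G (Suc 0)) (\<lambda>u. d 0 u x) c)) (carrier C)"
        by (auto simp: comp_def fun_eq_iff y(2) mod_hom_closed[OF cf] sf)
      thus "y' (\<delta> 0 (coord_form R C (S 0) x c)) = \<rho> (comp 0 v x) c"
        unfolding sf using Rel_form[OF y(1) y' mod_hom_comp[OF d_hom coord_hom] c] by simp
    qed
    from uniq[OF \<Phi>[OF vh] this e_closed] have "\<Phi> v e = y' (\<delta> 0 e)" .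
    also have "\<delta> 0 e = \<zero>\<^bsub>D (Suc 0)\<^esub>" using \<delta>_smult_e[OF C.one_closed] module.smult_one[OF module_D e_closed] by simp
    also have "y' \<zero>\<^bsub>D (Suc 0)\<^esub> = \<zero>\<^bsub>N'\<^esub>" by (rule mod_hom_zero[OF module_D N' y'h])
    finally show ?thesis .
  qed
  have surj: "carrier N \<subseteq> (\<lambda>v. v e) ` carrier ?V"
  proof
    fix z assume z: "z \<in> carrier N"
    obtain v where v: "v \<in> mod_hom R (D 0) N" "v e = z" by (rule dual_exact_value[OF N ex z])
    have "restrict v (carrier (D 0)) e = z" using v(2) e_closed by simp
    thus "z \<in> (\<lambda>v. v e) ` carrier ?V" using Hom_module_restrict[OF module_D v(1)] by blast
  qed
  obtain p where p: "p \<in> mod_hom R N N'" "\<And>v. v \<in> carrier ?V \<Longrightarrow> p (v e) = \<Phi> v e"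
    by (rule mod_hom_factor[OF mV N' Hom_module_evaluate[OF e_closed] N surj Fh ker]) (assumption | rule that)+
  have "p (f c) = \<rho> f c" if f: "f \<in> carrier ?H" and c: "c \<in> carrier C" for f c
  proof -
    obtain g where g: "g \<in> carrier (G 0)" "c = \<epsilon> g" using c \<epsilon>_surj by auto
    have fh: "f \<in> mod_hom R C N" using f by (simp add: Hom_module_simps)
    \<comment> \<open>As \<open>\<epsilon> g = c\<close>, the map \<open>h \<mapsto> f (h g)\<close>
      takes \<open>e\<close> to \<open>f c\<close>. Its components are the multiples
      \<open>g x \<cdot> f\<close>, so its coordinatewise image is
      \<open>h \<mapsto> \<rho> f (h g)\<close>.\<close>
    define v where "v = restrict (\<lambda>h. f (h g)) (carrier (D 0))"
    have v: "v \<in> carrier ?V" unfolding v_def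
      by (rule Hom_module_restrict[OF module_D mod_hom_comp[OF Hom_module_evaluate[OF g(1)] fh]])
    have eg: "e g = c" using g by (simp add: e_def)
    have "Rel 0 v (\<lambda>h. \<rho> f (h g))"
      unfolding Rel_def
    proof (intro conjI ballI)
      show "(\<lambda>h. \<rho> f (h g)) \<in> mod_hom R (D 0) N'"
        by (rule mod_hom_comp[OF Hom_module_evaluate[OF g(1)] \<rho>h[OF f]])
      fix x b assume x: "x \<in> S 0" and b: "b \<in> carrier C"
      have gx: "g x \<in> carrier R" by (rule free_coeff_closed[OF g(1)])
      have cg: "coord_form R C (S 0) x b g = g x \<odot>\<^bsub>C\<^esub> b" for b using g(1) by (simp add: scaled_form_def)
      have "comp 0 v x = g x \<odot>\<^bsub>?H\<^esub> f"
        by (auto simp: comp_def v_def mod_hom_closed[OF cf] cg Hom_module_simps(4) fun_eq_iff mod_hom_smult[OF fh gx])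
      hence "\<rho> (comp 0 v x) b = g x \<odot>\<^bsub>N'\<^esub> \<rho> f b"
        using b by (simp add: mod_hom_smult[OF \<rho> gx f] Hom_module_simps(4)[of R C N'])
      thus "\<rho> f (coord_form R C (S 0) x b g) = \<rho> (comp 0 v x) b"
        by (simp add: cg mod_hom_smult[OF \<rho>h[OF f] gx b])
    qed
    from uniq[OF \<Phi>[OF Vh[OF v]] this e_closed] have "\<Phi> v e = \<rho> f c" by (simp add: eg)
    thus ?thesis using p(2)[OF v] e_closed by (simp add: v_def eg)
  qed
  with p(1) that show ?thesis by blast
qed

text \<open>\<open>Ext^i(C, N) = 0\<close> for all \<open>i > 0\<close>, computed with the finite
  resolution \<open>G\<close>.\<close>

definition ext_acyclic :: "('r, 'n) module \<Rightarrow> bool" where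
  "ext_acyclic N \<longleftrightarrow> (\<forall>n. hom_exact R (G (Suc (Suc n))) (d (Suc n)) (G (Suc n)) (d n) (G n) N)"

lemma ext_acyclic_injective:
  assumes "injective_module R N"
  shows "ext_acyclic N"
  unfolding ext_acyclic_def
  by (intro allI hom_exact_injective[OF assms module_G module_G fin_gen_free_module[OF cring_R fin] d_hom])
    (use d_ker in blast)

lemma ext_acyclic_power: "ext_acyclic N \<Longrightarrow> ext_acyclic (power_module N n)"
  unfolding ext_acyclic_def by (auto intro!: hom_exact_power d_hom)

lemma ext_acyclic_zero_module: "module R N \<Longrightarrow> zero_module N \<Longrightarrow> ext_acyclic N"
  by (simp add: ext_acyclic_def hom_exact_zero_module)

text \<open>\<open>Ext^i(C, N')\<close> lies between \<open>Ext^i(C, N)\<close> and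
  \<open>Ext^(i+1)(C, K)\<close>, which vanish for \<open>i > 0\<close>.\<close>

lemma ext_acyclic_cokernel:
  assumes N: "module R N" and N': "module R N'" and p: "p \<in> mod_hom R N N'"
    and surj: "p ` carrier N = carrier N'" and K: "K = {x \<in> carrier N. p x = \<zero>\<^bsub>N'\<^esub>}"
    and "ext_acyclic (N\<lparr>carrier := K\<rparr>)" "ext_acyclic N"
  shows "ext_acyclic N'"
  unfolding ext_acyclic_def hom_exact_def
proof (intro allI ballI impI)
  fix n w assume w: "w \<in> mod_hom R (G (Suc n)) N'"
    and wd: "\<forall>x\<in>carrier (G (Suc (Suc n))). w (d (Suc n) x) = \<zero>\<^bsub>N'\<^esub>"
  obtain y where y: "y \<in> mod_hom R (G n) N" "\<And>x. x \<in> carrier (G (Suc n)) \<Longrightarrow> w x = p (y (d n x))"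
    by (rule hom_exact_cokernel[OF N N' p K module_G module_G module_G d_hom d_hom _ _ _ hom_lifts_free[OF cring_R N N' p surj] w])
      (use assms(6,7) wd in \<open>auto simp: ext_acyclic_def d_d\<close>)
  show "\<exists>v\<in>mod_hom R (G n) N'. \<forall>x\<in>carrier (G (Suc n)). w x = v (d n x)"
    by (intro bexI[OF _ mod_hom_comp[OF y(1) p]] ballI) (rule y(2))
qed

lemma ext_acyclic_extension:
  assumes N: "module R N" and N': "module R N'" and p: "p \<in> mod_hom R N N'"
    and surj: "p ` carrier N = carrier N'" and K: "K = {x \<in> carrier N. p x = \<zero>\<^bsub>N'\<^esub>}"
    and "ext_acyclic (N\<lparr>carrier := K\<rparr>)" "ext_acyclic N'"
  shows "ext_acyclic N"
  unfolding ext_acyclic_def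
  by (intro allI hom_exact_extension[OF N N' p K module_G module_G module_G d_hom d_hom _ _ _ hom_lifts_free[OF cring_R N N' p surj]])
    (use assms(6,7) in \<open>auto simp: ext_acyclic_def d_d\<close>)

text \<open>\<open>Ext^1(C, K) = 0\<close> makes \<open>Hom(C, N) \<rightarrow> Hom(C, N')\<close>
  onto. This is \<open>hom_exact_cokernel\<close> at the end
  \<open>G 1 \<rightarrow> G 0 \<rightarrow> C\<close> of the resolution, where the exactness needed
  for \<open>N\<close> says that maps killing the kernel of \<open>\<epsilon>\<close> factor through
  \<open>C\<close>.\<close>

lemma ext_acyclic_lifts:
  assumes N: "module R N" and N': "module R N'" and p: "p \<in> mod_hom R N N'"
    and surj: "p ` carrier N = carrier N'" and K: "K = {x \<in> carrier N. p x = \<zero>\<^bsub>N'\<^esub>}"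
    and a: "ext_acyclic (N\<lparr>carrier := K\<rparr>)"
  shows "hom_lifts R C N p N'"
  unfolding hom_lifts_def
proof
  fix w assume w: "w \<in> mod_hom R C N'"
  have ex: "hom_exact R (G (Suc 0)) (d 0) (G 0) \<epsilon> C N"
    unfolding hom_exact_def
  proof (intro ballI impI)
    fix f assume f: "f \<in> mod_hom R (G 0) N" and fd: "\<forall>x\<in>carrier (G (Suc 0)). f (d 0 x) = \<zero>\<^bsub>N\<^esub>"
    have ker: "f u = \<zero>\<^bsub>N\<^esub>" if "u \<in> carrier (G 0)" "\<epsilon> u = \<zero>\<^bsub>C\<^esub>" for u
      using \<epsilon>_ker[OF that(1)] that(2) fd by auto
    obtain g where "g \<in> mod_hom R C N" "\<And>u. u \<in> carrier (G 0) \<Longrightarrow> g (\<epsilon> u) = f u"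
      by (rule mod_hom_factor[OF module_G N \<epsilon>_hom C _ f ker]) (use \<epsilon>_surj in auto)
    thus "\<exists>g\<in>mod_hom R C N. \<forall>u\<in>carrier (G 0). f u = g (\<epsilon> u)" by (intro bexI[of _ g]) auto
  qed
  obtain y where y: "y \<in> mod_hom R C N" "\<And>x. x \<in> carrier (G 0) \<Longrightarrow> w (\<epsilon> x) = p (y (\<epsilon> x))"
    by (rule hom_exact_cokernel[OF N N' p K module_G module_G module_G d_hom d_hom _ _ ex hom_lifts_free[OF cring_R N N' p surj] mod_hom_comp[OF \<epsilon>_hom w]])
      (use a in \<open>auto simp: ext_acyclic_def d_d \<epsilon>_d mod_hom_zero[OF C N' w]\<close>)
  have "p (y c) = w c" if "c \<in> carrier C" for c
    using that y(2) \<epsilon>_surj by (metis imageE)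
  thus "\<exists>v\<in>mod_hom R C N. \<forall>x\<in>carrier C. p (v x) = w x" using y(1) by blast
qed

end

section \<open>The Auslander class\<close>

lemma pure_tensor_zero_right:
  assumes A: "module R A" and B: "module R B" and a: "a \<in> carrier A"
  shows "pure_tensor R A B a \<zero>\<^bsub>B\<^esub> = \<zero>\<^bsub>tensor R A B\<^esub>"
    and "(\<lambda>b. pure_tensor R A B a b) \<in> mod_hom R B (tensor R A B)"
proof -
  show h: "(\<lambda>b. pure_tensor R A B a b) \<in> mod_hom R B (tensor R A B)"
    by (rule mod_homI) (use a in \<open>auto simp: pure_tensor_closed[OF A B] pure_tensor_add_right[OF A B]
      pure_tensor_smult_right[OF A B]\<close>)
  show "pure_tensor R A B a \<zero>\<^bsub>B\<^esub> = \<zero>\<^bsub>tensor R A B\<^esub>"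
    by (rule mod_hom_zero[OF B tensor_module[OF A B] h])
qed

text \<open>For \<open>A = G n\<close>, \<open>A' = C\<close> and \<open>B = M\<close> this sends an
  element of \<open>G_n \<otimes> M\<close> to a map
  \<open>Hom(G_n, C) \<rightarrow> C \<otimes> M\<close>.\<close>

lemma tensor_left_evaluate:
  assumes A: "module R A" and B: "module R B" and A': "module R A'"
    and t: "t \<in> carrier (tensor R A B)"
  shows "(\<lambda>h. tensor_left R B A A' h t) \<in> mod_hom R (Hom_module R A A') (tensor R A' B)"
proof (rule mod_homI)
  note H = module_Hom_module[OF A A']
  have hom: "h \<in> mod_hom R A A'" if "h \<in> carrier (Hom_module R A A')" for h
    using that by (simp add: Hom_module_simps)
  fix h assume h: "h \<in> carrier (Hom_module R A A')"
  show "tensor_left R B A A' h t \<in> carrier (tensor R A' B)"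
    by (rule mod_hom_closed[OF tensor_left_hom[OF A B A' hom[OF h]] t])
  show "tensor_left R B A A' (r \<odot>\<^bsub>Hom_module R A A'\<^esub> h) t = r \<odot>\<^bsub>tensor R A' B\<^esub> tensor_left R B A A' h t"
    if r: "r \<in> carrier R" for r
    unfolding tensor_left_scale[OF A B A' hom[OF h] r t, symmetric]
    by (rule tensor_left_cong[OF A B A' hom[OF module.smult_closed[OF H r h]] mod_hom_scale[OF A' hom[OF h] r] _ t])
      (simp add: Hom_module_simps)
  fix k assume k: "k \<in> carrier (Hom_module R A A')"
  have "h \<oplus>\<^bsub>Hom_module R A A'\<^esub> k \<in> carrier (Hom_module R A A')"
    using module.submoduleE(5)[OF H module.carrier_is_submodule[OF H] h k] .
  from tensor_left_cong[OF A B A' hom[OF this] mod_hom_plus[OF A' hom[OF h] hom[OF k]] _ t]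
  show "tensor_left R B A A' (h \<oplus>\<^bsub>Hom_module R A A'\<^esub> k) t =
      tensor_left R B A A' h t \<oplus>\<^bsub>tensor R A' B\<^esub> tensor_left R B A A' k t"
    unfolding tensor_left_plus[OF A B A' hom[OF h] hom[OF k] t, symmetric]
    by (simp add: Hom_module_simps)
qed

section \<open>Isomorphisms and zero modules\<close>

lemma mod_iso_inverse:
  assumes A: "module R A" and B: "module R B" and f: "f \<in> mod_iso R A B"
  obtains g where "g \<in> mod_hom R B A" "\<And>x. x \<in> carrier A \<Longrightarrow> g (f x) = x"
    "\<And>y. y \<in> carrier B \<Longrightarrow> f (g y) = y"
proof -
  have fh: "f \<in> mod_hom R A B" and bij: "inj_on f (carrier A)" "f ` carrier A = carrier B"
    using f by (auto simp: mod_iso_def bij_betw_def)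
  have ker: "x = \<zero>\<^bsub>A\<^esub>" if "x \<in> carrier A" "f x = \<zero>\<^bsub>B\<^esub>" for x
    using inj_onD[OF bij(1), of x "\<zero>\<^bsub>A\<^esub>"] that mod_hom_zero[OF A B fh]
      module_zero_closed[OF A] by simp
  obtain g where g: "g \<in> mod_hom R B A" "\<And>x. x \<in> carrier A \<Longrightarrow> g (f x) = x"
    by (rule mod_hom_factor[OF A A fh B _ mod_hom_id ker]) (use bij(2) in auto)
  have "f (g y) = y" if "y \<in> carrier B" for y
  proof -
    obtain x where "x \<in> carrier A" "y = f x" using \<open>y \<in> carrier B\<close> bij(2) by auto
    thus ?thesis using g(2) by simp
  qed
  with g that show ?thesis by blast
qed

lemma isomorphic_zero_module_iff:
  assumes A: "module R A" and B: "module R B" and "isomorphic R A B"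
  shows "zero_module A \<longleftrightarrow> zero_module B"
proof -
  obtain f where f: "f \<in> mod_iso R A B" using assms(3) by (auto simp: isomorphic_def)
  obtain g where g: "g \<in> mod_hom R B A" "\<And>x. x \<in> carrier A \<Longrightarrow> g (f x) = x"
    "\<And>y. y \<in> carrier B \<Longrightarrow> f (g y) = y"
    by (rule mod_iso_inverse[OF A B f]) (rule that)
  have fh: "f \<in> mod_hom R A B" using f by (simp add: mod_iso_def)
  note z = module_zero_closed[OF A]
    module_zero_closed[OF B]
  note fc = mod_hom_closed[OF fh] and gc = mod_hom_closed[OF g(1)]
  note fz = mod_hom_zero[OF A B fh] and gz = mod_hom_zero[OF B A g(1)]
  show ?thesis
  proof
    assume "zero_module A"
    hence "y = \<zero>\<^bsub>B\<^esub>" if "y \<in> carrier B" for y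
      using gc[OF that] g(3)[OF that] fz by (simp add: zero_module_def)
    thus "zero_module B" unfolding zero_module_def using z by blast
  next
    assume "zero_module B"
    hence "x = \<zero>\<^bsub>A\<^esub>" if "x \<in> carrier A" for x
      using fc[OF that] g(2)[OF that] gz by (simp add: zero_module_def)
    thus "zero_module A" unfolding zero_module_def using z by blast
  qed
qed

lemma zero_module_power_iff:
  assumes "module R L"
  shows "zero_module (power_module L n) \<longleftrightarrow> n = 0 \<or> zero_module L"
proof -
  have z: "\<zero>\<^bsub>L\<^esub> \<in> carrier L" by (rule module_zero_closed[OF assms])
  show ?thesis
  proof (cases "n = 0 \<or> zero_module L")
    case True
    have "f = \<zero>\<^bsub>power_module L n\<^esub>" if f: "f \<in> carrier (power_module L n)" for f
      unfolding power_module_simps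
      by (rule extensionalityI[where A = "{..<n}"])
        (use f True in \<open>auto simp: power_module_simps zero_module_def dest: PiE_mem\<close>)
    moreover have "\<zero>\<^bsub>power_module L n\<^esub> \<in> carrier (power_module L n)"
      by (rule module_zero_closed[OF module_power_module[OF assms]])
    ultimately have "zero_module (power_module L n)" unfolding zero_module_def by blast
    thus ?thesis using True by simp
  next
    case False
    then obtain x where x: "x \<in> carrier L" "x \<noteq> \<zero>\<^bsub>L\<^esub>" "0 < n" using z by (auto simp: zero_module_def)
    have "(\<lambda>i\<in>{..<n}. x) \<in> carrier (power_module L n)" using x by (simp add: power_module_simps)
    moreover have "(\<lambda>i\<in>{..<n}. x) \<noteq> \<zero>\<^bsub>power_module L n\<^esub>"
      using x by (auto simp: power_module_simps fun_eq_iff intro!: exI[of _ 0])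
    ultimately show ?thesis using False by (auto simp: zero_module_def)
  qed
qed

lemma zero_module_imp_isomorphic:
  assumes A: "module R A" and B: "module R B" and "zero_module A" "zero_module B"
  shows "isomorphic R A B"
proof -
  have "(\<lambda>_. \<zero>\<^bsub>B\<^esub>) \<in> mod_iso R A B"
    unfolding mod_iso_def using mod_hom_const_zero[OF B] assms(3,4)
    by (auto simp: zero_module_def bij_betw_def)
  thus ?thesis by (auto simp: isomorphic_def)
qed

lemma module_homology:
  assumes "is_complex R X"
  shows "module R (homology X i)"
  using quot_module(1)[OF module_cycle_module[OF assms] submodule_boundaries[OF assms]]
  by (simp add: homology_def cycle_module_def)

lemma zero_module_homology:
  assumes X: "is_complex R X" and z: "zero_module (obj X i)"
  shows "zero_module (homology X i)"
proof -
  have "\<zero>\<^bsub>obj X i\<^esub> \<in> boundaries X i"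
    using submodule_zero_mem[OF submodule_boundaries[OF X]] by (simp add: cycle_module_def)
  hence "cycles X i \<subseteq> boundaries X i" using z by (auto simp: zero_module_def cycles_def)
  thus ?thesis using boundaries_subset_cycles[OF X, of i] by (auto simp: zero_homology_iff[OF X])
qed

lemma Hom_cpx_simps [simp]:
  "obj (Hom_cpx R A X) i = Hom_module R A (obj X i)"
  "diff (Hom_cpx R A X) i f = compose (carrier A) (diff X i) f"
  by (simp_all add: Hom_cpx_def)

lemma is_complexD:
  assumes "is_complex R X"
  shows "module R (obj X i)" "diff X i \<in> mod_hom R (obj X i) (obj X (i - 1))"
    "diff X (i + 1) \<in> mod_hom R (obj X (i + 1)) (obj X i)"
    "x \<in> carrier (obj X i) \<Longrightarrow> diff X (i - 1) (diff X i x) = \<zero>\<^bsub>obj X (i - 2)\<^esub>"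
proof -
  show "module R (obj X i)" "diff X i \<in> mod_hom R (obj X i) (obj X (i - 1))"
    "x \<in> carrier (obj X i) \<Longrightarrow> diff X (i - 1) (diff X i x) = \<zero>\<^bsub>obj X (i - 2)\<^esub>"
    using assms unfolding is_complex_def by blast+
  have "diff X (i + 1) \<in> mod_hom R (obj X (i + 1)) (obj X (i + 1 - 1))"
    using assms unfolding is_complex_def by blast
  thus "diff X (i + 1) \<in> mod_hom R (obj X (i + 1)) (obj X i)" by simp
qed

lemma is_complex_Hom_cpx:
  assumes A: "module R A" and X: "is_complex R X"
  shows "is_complex R (Hom_cpx R A X)"
  unfolding is_complex_def
proof (intro allI conjI ballI)
  fix i
  note mX = is_complexD(1)[OF X] and dX = is_complexD(2)[OF X, of i]
  show "module R (obj (Hom_cpx R A X) i)" by (simp add: module_Hom_module[OF A mX])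
  have hom: "f \<in> mod_hom R A (obj X i)" if "f \<in> carrier (Hom_module R A (obj X i))" for f
    using that by (simp add: Hom_module_simps)
  show "diff (Hom_cpx R A X) i \<in> mod_hom R (obj (Hom_cpx R A X) i) (obj (Hom_cpx R A X) (i - 1))"
  proof (rule mod_homI)
    fix f assume "f \<in> carrier (obj (Hom_cpx R A X) i)"
    hence "f \<in> mod_hom R A (obj X i)" by (simp add: hom)
    thus "diff (Hom_cpx R A X) i f \<in> carrier (obj (Hom_cpx R A X) (i - 1))"
      using Hom_module_restrict[OF A mod_hom_comp[OF _ dX]] by (simp add: compose_def)
  qed (auto simp: Hom_module_simps compose_def fun_eq_iff mod_hom_closed mod_hom_add[OF dX] mod_hom_smult[OF dX])
  fix f assume "f \<in> carrier (obj (Hom_cpx R A X) i)"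
  hence "f \<in> mod_hom R A (obj X i)" by (simp add: hom)
  thus "diff (Hom_cpx R A X) (i - 1) (diff (Hom_cpx R A X) i f) = \<zero>\<^bsub>obj (Hom_cpx R A X) (i - 2)\<^esub>"
    by (auto simp: compose_def Hom_module_simps fun_eq_iff mod_hom_closed is_complexD(4)[OF X])
qed

text \<open>Left exactness of \<open>Hom(A, -)\<close>. The two sides are equal and not just
  isomorphic, because \<open>Hom_module\<close> takes only the carrier, zero, addition and scalar
  action from its target.\<close>

lemma cycle_module_Hom_cpx:
  assumes X: "is_complex R X"
  shows "cycle_module (Hom_cpx R A X) i = Hom_module R A (cycle_module X i)"
proof -
  have "cycles (Hom_cpx R A X) i = carrier (Hom_module R A (cycle_module X i))"
    unfolding cycles_def cycle_module_def
    by (auto simp: Hom_module_simps compose_def fun_eq_iff mod_hom_closed dest: mod_hom_closed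
        intro: mod_hom_into_sub mod_hom_from_into_sub)
  thus ?thesis by (simp add: cycle_module_def[of "Hom_cpx R A X"])
    (simp add: Hom_module_def cycle_module_def)
qed

definition boundary_module :: "('r, 'i) cpx \<Rightarrow> int \<Rightarrow> ('r, 'i) module" where
  "boundary_module X i = (cycle_module X i)\<lparr>carrier := boundaries X i\<rparr>"

text \<open>The short exact sequence \<open>Z_(i+1) \<rightarrow> I_(i+1) \<rightarrow> B_i\<close>,
  with its facts in the order in which the cokernel and lifting lemmas take them.\<close>

lemma boundary_module:
  assumes X: "is_complex R X"
  shows "module R (boundary_module X i)"
    and "diff X (i + 1) \<in> mod_hom R (obj X (i + 1)) (boundary_module X i)"
    and "diff X (i + 1) ` carrier (obj X (i + 1)) = carrier (boundary_module X i)"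
    and "cycles X (i + 1) = {x \<in> carrier (obj X (i + 1)). diff X (i + 1) x = \<zero>\<^bsub>boundary_module X i\<^esub>}"
proof -
  show "module R (boundary_module X i)"
    unfolding boundary_module_def
    by (rule submodule_module[OF submodule_boundaries[OF X] module_cycle_module[OF X]])
  show im: "diff X (i + 1) ` carrier (obj X (i + 1)) = carrier (boundary_module X i)"
    by (simp add: boundary_module_def boundaries_def)
  have eq: "boundary_module X i = (obj X i)\<lparr>carrier := boundaries X i\<rparr>"
    by (simp add: boundary_module_def cycle_module_def)
  show "diff X (i + 1) \<in> mod_hom R (obj X (i + 1)) (boundary_module X i)"
    unfolding eq by (rule mod_hom_into_sub[OF is_complexD(3)[OF X]]) (auto simp: boundaries_def)
  show "cycles X (i + 1) = {x \<in> carrier (obj X (i + 1)). diff X (i + 1) x = \<zero>\<^bsub>boundary_module X i\<^esub>}"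
    by (simp add: cycles_def eq)
qed

lemma boundaries_Hom_cpx_iff:
  assumes A: "module R A" and f: "f \<in> carrier (Hom_module R A N)"
  shows "f \<in> boundaries (Hom_cpx R A X) i \<longleftrightarrow>
    (\<exists>g\<in>mod_hom R A (obj X (i + 1)). \<forall>a\<in>carrier A. f a = diff X (i + 1) (g a))" (is "?l \<longleftrightarrow> ?r")
proof
  assume ?l
  then obtain g where "g \<in> carrier (Hom_module R A (obj X (i + 1)))" "f = compose (carrier A) (diff X (i + 1)) g"
    by (auto simp: boundaries_def)
  thus ?r by (intro bexI[of _ g]) (auto simp: compose_def Hom_module_simps)
next
  assume ?r
  then obtain g where g: "g \<in> mod_hom R A (obj X (i + 1))" "\<And>a. a \<in> carrier A \<Longrightarrow> f a = diff X (i + 1) (g a)"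
    by blast
  have "f = compose (carrier A) (diff X (i + 1)) (restrict g (carrier A))"
    by (rule extensionalityI[where A = "carrier A"]) (use f g(2) in \<open>auto simp: Hom_module_simps compose_def\<close>)
  thus ?l using Hom_module_restrict[OF A g(1)] by (simp add: boundaries_def)
qed

text \<open>Cohomological degree \<open>n + 1\<close> is homological degree
  \<open>- int (Suc n)\<close>; there the incoming differential is composition with
  \<open>diff F (n + 1)\<close> and the outgoing one composition with
  \<open>diff F (n + 2)\<close>.\<close>

lemma zero_Ext_imp_hom_exact:
  assumes N: "module R N" and A: "module R A" and F: "is_complex R F"
    and z: "zero_module (homology (Hom_cpx_into R F N) (- int (Suc n)))"
  shows "hom_exact R (obj F (int n + 2)) (diff F (int n + 2)) (obj F (int n + 1)) (diff F (int n + 1))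
    (obj F (int n)) N"
  unfolding hom_exact_def
proof (intro ballI impI)
  fix w assume w: "w \<in> mod_hom R (obj F (int n + 1)) N"
    and wd: "\<forall>x\<in>carrier (obj F (int n + 2)). w (diff F (int n + 2) x) = \<zero>\<^bsub>N\<^esub>"
  note mF = is_complexD(1)[OF F]
  have dF: "diff F (int n + 1) \<in> mod_hom R (obj F (int n + 1)) (obj F (int n))"
    by (rule is_complexD(3)[OF F])
  have dF2: "diff F (int n + 2) \<in> mod_hom R (obj F (int n + 2)) (obj F (int n + 1))"
    using is_complexD(2)[OF F, of "int n + 2"] by (simp add: add.commute[of 1])
  let ?X = "Hom_cpx_into R F N" and ?j = "- int (Suc n)"
  have idx: "- ?j = int n + 1" "1 - ?j = int n + 2" "- (?j + 1) = int n" "1 - (?j + 1) = int n + 1"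
    "- (?j - 1) = int n + 2" by simp_all
  have zb: "\<zero>\<^bsub>obj ?X ?j\<^esub> \<in> boundaries ?X ?j"
  proof -
    have "\<zero>\<^bsub>obj ?X ?j\<^esub> = diff ?X (?j + 1) \<zero>\<^bsub>obj ?X (?j + 1)\<^esub>"
      unfolding Hom_cpx_into_def cpx.simps idx
      by (auto simp: Hom_module_simps compose_def fun_eq_iff mod_hom_closed[OF dF])
    moreover have "\<zero>\<^bsub>obj ?X (?j + 1)\<^esub> \<in> carrier (obj ?X (?j + 1))"
      unfolding Hom_cpx_into_def cpx.simps
      by (rule module_zero_closed[OF module_Hom_module[OF mF N]])
    ultimately show ?thesis unfolding boundaries_def by blast
  qed
  have sub: "cycles ?X ?j \<subseteq> boundaries ?X ?j"
    by (rule zero_homology_cycles_subset[where R = R, OF _ zb z]) (simp add: Hom_cpx_into_def module_Hom_module[OF mF N])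
  let ?w = "restrict w (carrier (obj F (int n + 1)))"
  have "?w \<in> cycles ?X ?j"
    unfolding cycles_def Hom_cpx_into_def cpx.simps idx
    using Hom_module_restrict[OF mF w] wd
    by (auto simp: Hom_module_simps compose_def fun_eq_iff mod_hom_closed[OF dF2])
  hence "?w \<in> boundaries ?X ?j" using sub by blast
  then obtain v where v: "v \<in> carrier (Hom_module R (obj F (int n)) N)"
    "?w = compose (carrier (obj F (int n + 1))) v (diff F (int n + 1))"
    unfolding boundaries_def Hom_cpx_into_def cpx.simps idx by blast
  have "w y = v (diff F (int n + 1) y)" if "y \<in> carrier (obj F (int n + 1))" for y
    using fun_cong[OF v(2), of y] that by (simp add: compose_def)
  thus "\<exists>v\<in>mod_hom R (obj F (int n)) N. \<forall>y\<in>carrier (obj F (int n + 1)). w y = v (diff F (int n + 1) y)"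
    using v(1) by (intro bexI[of _ v]) (auto simp: Hom_module_simps)
qed

lemma zero_Tor_imp_tensor_exact:
  assumes N: "module R N" and F: "is_complex R F"
    and z: "zero_module (homology (tensor_cpx R F N) (int (Suc n)))"
    and t: "t \<in> carrier (tensor R (obj F (int n + 1)) N)"
      "tensor_left R N (obj F (int n + 1)) (obj F (int n)) (diff F (int n + 1)) t = \<zero>\<^bsub>tensor R (obj F (int n)) N\<^esub>"
  shows "t \<in> tensor_left R N (obj F (int n + 2)) (obj F (int n + 1)) (diff F (int n + 2)) `
    carrier (tensor R (obj F (int n + 2)) N)"
proof -
  note mF = is_complexD(1)[OF F]
  have dF2: "diff F (int n + 2) \<in> mod_hom R (obj F (int n + 2)) (obj F (int n + 1))"
    using is_complexD(2)[OF F, of "int n + 2"] by (simp add: add.commute[of 1])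
  let ?X = "tensor_cpx R F N" and ?j = "int (Suc n)"
  have idx: "?j = int n + 1" "int n + 1 + 1 = int n + 2" "int n + 1 - 1 = int n" "int n + 2 - 1 = int n + 1" by simp_all
  have b: "boundaries ?X ?j = tensor_left R N (obj F (int n + 2)) (obj F (int n + 1)) (diff F (int n + 2)) `
      carrier (tensor R (obj F (int n + 2)) N)"
    unfolding boundaries_def tensor_cpx_def cpx.simps idx ..
  have zb: "\<zero>\<^bsub>obj ?X ?j\<^esub> \<in> boundaries ?X ?j"
    unfolding b using submodule_zero_mem[OF submodule_image[OF tensor_module[OF mF N] tensor_module[OF mF N]
      tensor_left_hom[OF mF N mF dF2]]]
    by (simp add: tensor_cpx_def add.commute[of 1])
  have "cycles ?X ?j \<subseteq> boundaries ?X ?j"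
    by (rule zero_homology_cycles_subset[where R = R, OF _ zb z]) (simp add: tensor_cpx_def tensor_module[OF mF N])
  moreover have "t \<in> cycles ?X ?j"
    unfolding cycles_def tensor_cpx_def cpx.simps idx using t by simp
  ultimately show ?thesis unfolding b by blast
qed

text \<open>\<open>ext_T\<close> and \<open>tor\<close> state the Ext and Tor conditions of the
  Auslander class for the finite resolution, as exactness at single places.\<close>

locale auslander_situation = semidualizing_resolution +
  fixes M :: "('a, 'm) module"
  assumes M: "module R M"
    and unit: "tensor_unit R C M \<in> mod_iso R M (Hom_module R C (tensor R C M))"
    and ext_T: "\<And>n. hom_exact R (free_module R (S (Suc (Suc n)))) (d (Suc n)) (free_module R (S (Suc n)))
      (d n) (free_module R (S n)) (tensor R C M)"
    and tor: "\<And>n t. t \<in> carrier (tensor R (free_module R (S (Suc n))) M) \<Longrightarrow>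
      tensor_left R M (free_module R (S (Suc n))) (free_module R (S n)) (d n) t =
        \<zero>\<^bsub>tensor R (free_module R (S n)) M\<^esub> \<Longrightarrow>
      t \<in> tensor_left R M (free_module R (S (Suc (Suc n)))) (free_module R (S (Suc n))) (d (Suc n)) `
        carrier (tensor R (free_module R (S (Suc (Suc n)))) M)"
begin

abbreviation "T \<equiv> tensor R C M"

lemma module_T: "module R T" by (rule tensor_module[OF C M])

lemma ext_acyclic_T: "ext_acyclic T"
  using ext_T by (simp add: ext_acyclic_def)

lemma unit_bij: "bij_betw (tensor_unit R C M) (carrier M) (carrier (Hom_module R C T))"
  using unit by (simp add: mod_iso_def)

lemma unit_surj:
  assumes "f \<in> mod_hom R C T"
  obtains m where "m \<in> carrier M" "\<And>c. c \<in> carrier C \<Longrightarrow> f c = pure_tensor R C M c m"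
proof -
  have "restrict f (carrier C) \<in> tensor_unit R C M ` carrier M"
    using Hom_module_restrict[OF C assms] unit_bij by (simp add: bij_betw_def)
  then obtain m where m: "m \<in> carrier M" "restrict f (carrier C) = tensor_unit R C M m" by blast
  have "f c = pure_tensor R C M c m" if "c \<in> carrier C" for c
    using fun_cong[OF m(2), of c] that by (simp add: tensor_unit_def)
  with m(1) that show ?thesis by blast
qed

lemma unit_inj:
  assumes "m \<in> carrier M" "m' \<in> carrier M"
    "\<And>c. c \<in> carrier C \<Longrightarrow> pure_tensor R C M c m = pure_tensor R C M c m'"
  shows "m = m'"
proof -
  have "tensor_unit R C M m = tensor_unit R C M m'" using assms(3) by (auto simp: tensor_unit_def fun_eq_iff)
  thus ?thesis using unit_bij assms(1,2) by (auto simp: bij_betw_def inj_on_def)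
qed

text \<open>Half of \<open>Hom(Hom(G_n, C), C \<otimes> M) = G_n \<otimes> M\<close>. Each component
  of \<open>w\<close> is a map \<open>C \<rightarrow> C \<otimes> M\<close>, hence
  \<open>c \<mapsto> c \<otimes> m x\<close> for some \<open>m x\<close> by surjectivity of the
  unit, and \<open>t\<close> is the sum of \<open>free_gen R x \<otimes> m x\<close>.\<close>

lemma dual_hom_is_tensor:
  assumes w: "w \<in> mod_hom R (D n) T"
  obtains t where "t \<in> carrier (tensor R (G n) M)" "\<And>h. h \<in> carrier (D n) \<Longrightarrow> w h = tensor_left R M (G n) C h t"
proof -
  note cf = scaled_form_closed[OF C module_G coord_hom] and cfh = scaled_form_hom[OF C module_G coord_hom]
  have hom: "h \<in> mod_hom R (G n) C" if "h \<in> carrier (D n)" for h using that by (simp add: Hom_module_simps)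
  have "\<forall>x\<in>S n. \<exists>m. m \<in> carrier M \<and> (\<forall>c\<in>carrier C. w (coord_form R C (S n) x c) = pure_tensor R C M c m)"
    using unit_surj[OF mod_hom_comp[OF cfh w]] by metis
  then obtain m where m: "\<And>x. x \<in> S n \<Longrightarrow> m x \<in> carrier M"
    "\<And>x c. x \<in> S n \<Longrightarrow> c \<in> carrier C \<Longrightarrow> w (coord_form R C (S n) x c) = pure_tensor R C M c (m x)"
    by metis
  interpret GM: module R "tensor R (G n) M" by (rule tensor_module[OF module_G M])
  interpret T: module R T by (rule module_T)
  have "\<exists>t\<in>carrier (tensor R (G n) M). \<forall>x\<in>S n. \<forall>c\<in>carrier C.
      tensor_left R M (G n) C (coord_form R C (S n) x c) t =
        (if x \<in> X then pure_tensor R C M c (m x) else \<zero>\<^bsub>T\<^esub>)" if "finite X" "X \<subseteq> S n" for X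
    using that
  proof (induction rule: finite_induct)
    case empty
    show ?case
      using mod_hom_zero[OF GM.module_axioms module_T tensor_left_hom[OF module_G M C hom[OF cf]]]
      by (intro bexI[OF _ GM.zero_closed]) auto
  next
    case (insert x X)
    then obtain t where t: "t \<in> carrier (tensor R (G n) M)"
      "\<And>y c. y \<in> S n \<Longrightarrow> c \<in> carrier C \<Longrightarrow> tensor_left R M (G n) C (coord_form R C (S n) y c) t =
        (if y \<in> X then pure_tensor R C M c (m y) else \<zero>\<^bsub>T\<^esub>)" by auto
    have x: "x \<in> S n" using insert by simp
    note gx = free_gen_closed[OF cring_R x]
    let ?p = "pure_tensor R (G n) M (free_gen R x) (m x)"
    have p: "?p \<in> carrier (tensor R (G n) M)" by (rule pure_tensor_closed[OF module_G M gx m(1)[OF x]])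
    have "tensor_left R M (G n) C (coord_form R C (S n) y c) (t \<oplus>\<^bsub>tensor R (G n) M\<^esub> ?p) =
        (if y \<in> insert x X then pure_tensor R C M c (m y) else \<zero>\<^bsub>T\<^esub>)" if y: "y \<in> S n" and c: "c \<in> carrier C" for y c
      using insert.hyps(2) t(2)[OF y c] mod_hom_add[OF tensor_left_hom[OF module_G M C hom[OF cf[OF c]]] t(1) p]
        tensor_left_pure[OF module_G M C hom[OF cf[OF c]] gx m(1)[OF x]] coord_form_gen[OF C c y x]
        pure_tensor_closed[OF C M c m(1)[OF y]] pure_tensor_zero_left[OF C M m(1)[OF x]]
      by (cases "y = x") simp_all
    thus ?case using t(1) p by (intro bexI[of _ "t \<oplus>\<^bsub>tensor R (G n) M\<^esub> ?p"]) auto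
  qed
  from this[OF fin order_refl] obtain t where t: "t \<in> carrier (tensor R (G n) M)"
    "\<And>x c. x \<in> S n \<Longrightarrow> c \<in> carrier C \<Longrightarrow>
      tensor_left R M (G n) C (coord_form R C (S n) x c) t = pure_tensor R C M c (m x)" by auto
  have "w h = tensor_left R M (G n) C h t" if "h \<in> carrier (D n)" for h
    by (rule dual_hom_eqI[OF C fin module_T w tensor_left_evaluate[OF module_G M C t(1)] _ that]) (simp add: t(2) m(2))
  with t(1) that show ?thesis by blast
qed

text \<open>The other half. Projecting \<open>t\<close> to the coordinate \<open>x\<close> gives
  some \<open>free_gen R x \<otimes> m\<close>; testing against the coordinate forms at
  \<open>x\<close> shows \<open>c \<otimes> m = 0\<close> for all \<open>c\<close>, so
  \<open>m = 0\<close> by injectivity of the unit. The projections add up to the identity since the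
  basis is finite.\<close>

lemma tensor_eq_zeroI:
  assumes t: "t \<in> carrier (tensor R (G n) M)"
    and z: "\<And>h. h \<in> carrier (D n) \<Longrightarrow> tensor_left R M (G n) C h t = \<zero>\<^bsub>T\<^esub>"
  shows "t = \<zero>\<^bsub>tensor R (G n) M\<^esub>"
proof -
  note cf = scaled_form_closed[OF C module_G coord_hom]
  have hom: "h \<in> mod_hom R (G n) C" if "h \<in> carrier (D n)" for h using that by (simp add: Hom_module_simps)
  interpret GM: module R "tensor R (G n) M" by (rule tensor_module[OF module_G M])
  interpret G: module R "G n" by (rule module_G)
  note TG = GM.module_axioms
  note fp = free_part_hom[OF cring_R]
  have px: "tensor_left R M (G n) (G n) (\<lambda>u. u x \<odot>\<^bsub>G n\<^esub> free_gen R x) t = \<zero>\<^bsub>tensor R (G n) M\<^esub>"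
    if x: "x \<in> S n" for x
  proof -
    note gx = free_gen_closed[OF cring_R x]
    have ph: "(\<lambda>u. u x \<odot>\<^bsub>G n\<^esub> free_gen R x) \<in> mod_hom R (G n) (G n)"
      by (rule mod_hom_comp[OF coord_hom smult_hom[OF module_G gx]])
    note L = tensor_left_hom[OF module_G M module_G ph]
    note I = submodule_image[OF M TG pure_tensor_zero_right(2)[OF module_G M gx]]
    have "t \<in> {t \<in> carrier (tensor R (G n) M). tensor_left R M (G n) (G n) (\<lambda>u. u x \<odot>\<^bsub>G n\<^esub> free_gen R x) t
        \<in> (\<lambda>m. pure_tensor R (G n) M (free_gen R x) m) ` carrier M}"
    proof (rule tensor_generated[OF module_G M submodule_preimage[OF TG TG L I] _ t], rule CollectI, rule conjI)
      fix a b assume a: "a \<in> carrier (G n)" and b: "b \<in> carrier M"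
      have ax: "a x \<in> carrier R" by (rule free_coeff_closed[OF a])
      show "pure_tensor R (G n) M a b \<in> carrier (tensor R (G n) M)" by (rule pure_tensor_closed[OF module_G M a b])
      have "tensor_left R M (G n) (G n) (\<lambda>u. u x \<odot>\<^bsub>G n\<^esub> free_gen R x) (pure_tensor R (G n) M a b) =
          pure_tensor R (G n) M (free_gen R x) (a x \<odot>\<^bsub>M\<^esub> b)"
        using tensor_left_pure[OF module_G M module_G ph a b] pure_tensor_smult_left[OF module_G M ax gx b]
          pure_tensor_smult_right[OF module_G M ax gx b] by simp
      thus "tensor_left R M (G n) (G n) (\<lambda>u. u x \<odot>\<^bsub>G n\<^esub> free_gen R x) (pure_tensor R (G n) M a b) \<in>
          (\<lambda>m. pure_tensor R (G n) M (free_gen R x) m) ` carrier M"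
        using module.smult_closed[OF M ax b] by blast
    qed
    then obtain m where m: "m \<in> carrier M" "tensor_left R M (G n) (G n) (\<lambda>u. u x \<odot>\<^bsub>G n\<^esub> free_gen R x) t =
        pure_tensor R (G n) M (free_gen R x) m" by blast
    have "pure_tensor R C M c m = \<zero>\<^bsub>T\<^esub>" if c: "c \<in> carrier C" for c
    proof -
      let ?h = "coord_form R C (S n) x c"
      note h = hom[OF cf[OF c, of n x]]
      have "\<zero>\<^bsub>T\<^esub> = tensor_left R M (G n) C ?h t" using z[OF cf[OF c]] by simp
      also have "\<dots> = tensor_left R M (G n) C (\<lambda>u. ?h (u x \<odot>\<^bsub>G n\<^esub> free_gen R x)) t"
      proof (rule tensor_left_cong[OF module_G M C h mod_hom_comp[OF ph h] _ t])
        fix u assume u: "u \<in> carrier (G n)"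
        have ux: "u x \<in> carrier R" by (rule free_coeff_closed[OF u])
        have "?h (u x \<odot>\<^bsub>G n\<^esub> free_gen R x) = u x \<odot>\<^bsub>C\<^esub> ?h (free_gen R x)"
          by (rule mod_hom_smult[OF h ux gx])
        thus "?h u = ?h (u x \<odot>\<^bsub>G n\<^esub> free_gen R x)"
          using coord_form_gen[OF C c x x] u by (simp add: scaled_form_def)
      qed
      also have "\<dots> = tensor_left R M (G n) C ?h (pure_tensor R (G n) M (free_gen R x) m)"
        using tensor_left_comp[OF module_G M module_G C ph h t] m(2) by simp
      also have "\<dots> = pure_tensor R C M c m"
        using tensor_left_pure[OF module_G M C h gx m(1)] coord_form_gen[OF C c x x] by simp
      finally show ?thesis by simp
    qed
    hence "m = \<zero>\<^bsub>M\<^esub>"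
      using unit_inj[OF m(1) module_zero_closed[OF M]]
        pure_tensor_zero_right(1)[OF C M] by simp
    thus ?thesis using m(2) pure_tensor_zero_right(1)[OF module_G M gx] by simp
  qed
  have "tensor_left R M (G n) (G n) (free_part R X) t = \<zero>\<^bsub>tensor R (G n) M\<^esub>" if "finite X" "X \<subseteq> S n" for X
    using that
  proof (induction rule: finite_induct)
    case empty
    show ?case by (rule tensor_left_zero[OF module_G M module_G fp _ t]) (simp add: free_part_empty[of R _ "S n"])
  next
    case (insert x X)
    have ph: "(\<lambda>u. u x \<odot>\<^bsub>G n\<^esub> free_gen R x) \<in> mod_hom R (G n) (G n)"
      by (rule mod_hom_comp[OF coord_hom smult_hom[OF module_G free_gen_closed[OF cring_R]]]) (use insert in simp)
    have "tensor_left R M (G n) (G n) (free_part R (insert x X)) t =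
        tensor_left R M (G n) (G n) (\<lambda>u. free_part R X u \<oplus>\<^bsub>G n\<^esub> u x \<odot>\<^bsub>G n\<^esub> free_gen R x) t"
      by (rule tensor_left_cong[OF module_G M module_G fp mod_hom_plus[OF module_G fp ph] free_part_insert[OF cring_R _ insert.hyps(2)] t])
    also have "\<dots> = \<zero>\<^bsub>tensor R (G n) M\<^esub>"
      unfolding tensor_left_plus[OF module_G M module_G fp ph t] using insert px by simp
    finally show ?case .
  qed
  from this[OF fin order_refl]
  have "tensor_left R M (G n) (G n) (free_part R (S n)) t = \<zero>\<^bsub>tensor R (G n) M\<^esub>" .
  moreover have "tensor_left R M (G n) (G n) (free_part R (S n)) t = t"
    by (rule tensor_left_id[OF module_G M fp _ t]) (rule free_part_full, auto simp: free_module_simps)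
  ultimately show ?thesis by simp
qed

text \<open>Under the identification just obtained, \<open>Hom(-, C \<otimes> M)\<close> turns the
  coresolution into \<open>\<dots> \<rightarrow> G_1 \<otimes> M \<rightarrow> G_0 \<otimes> M
  \<rightarrow> C \<otimes> M \<rightarrow> 0\<close>. Right exactness of the tensor product gives
  the first two clauses, vanishing of Tor the third.\<close>

lemma dual_exact_T: "dual_exact T"
proof -
  have hom: "h \<in> mod_hom R (G n) C" if "h \<in> carrier (D n)" for h n using that by (simp add: Hom_module_simps)
  have e_left: "tensor_left R M (G 0) C e t = tensor_left R M (G 0) C \<epsilon> t" if "t \<in> carrier (tensor R (G 0) M)" for t
    by (rule tensor_left_cong[OF module_G M C hom[OF e_closed] \<epsilon>_hom _ that]) (simp add: e_def)
  have \<delta>_left: "tensor_left R M (G (Suc n)) C (\<delta> n h) t = tensor_left R M (G n) C h (tensor_left R M (G (Suc n)) (G n) (d n) t)"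
    if "h \<in> carrier (D n)" "t \<in> carrier (tensor R (G (Suc n)) M)" for n h t
    unfolding tensor_left_comp[OF module_G M module_G C d_hom hom[OF that(1)] that(2), symmetric]
    by (rule tensor_left_cong[OF module_G M C hom[OF mod_hom_closed[OF \<delta>_hom that(1)]] mod_hom_comp[OF d_hom hom[OF that(1)]] _ that(2)])
      (simp add: \<delta>_apply)
  note ev = tensor_left_evaluate[OF module_G M C]
  interpret T: module R T by (rule module_T)
  show ?thesis
    unfolding dual_exact_def
  proof (intro conjI allI)
    show "hom_exact R (ring_module R) (\<lambda>_. \<zero>\<^bsub>R\<^esub>) (ring_module R) (\<lambda>r. r \<odot>\<^bsub>D 0\<^esub> e) (D 0) T"
      unfolding hom_exact_def
    proof (intro ballI impI)
      fix w assume w: "w \<in> mod_hom R (ring_module R) T"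
      have one: "\<one>\<^bsub>R\<^esub> \<in> carrier (ring_module R)" using T.one_closed by simp
      obtain t where t: "t \<in> carrier (tensor R (G 0) M)" "w \<one>\<^bsub>R\<^esub> = tensor_left R M (G 0) C \<epsilon> t"
        using mod_hom_closed[OF w one] tensor_left_surj[OF module_G M C \<epsilon>_hom \<epsilon>_surj] by blast
      have "w r = tensor_left R M (G 0) C (r \<odot>\<^bsub>D 0\<^esub> e) t" if "r \<in> carrier (ring_module R)" for r
        using mod_hom_smult[OF w _ one, of r] mod_hom_smult[OF ev[OF t(1)] _ e_closed, of r] that t e_left by simp
      thus "\<exists>v\<in>mod_hom R (D 0) T. \<forall>r\<in>carrier (ring_module R). w r = v (r \<odot>\<^bsub>D 0\<^esub> e)"
        by (intro bexI[OF _ ev[OF t(1)]] ballI)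
    qed
  next
    show "hom_exact R (ring_module R) (\<lambda>r. r \<odot>\<^bsub>D 0\<^esub> e) (D 0) (\<delta> 0) (D (Suc 0)) T"
      unfolding hom_exact_def
    proof (intro ballI impI)
      fix w assume w: "w \<in> mod_hom R (D 0) T"
        and we: "\<forall>r\<in>carrier (ring_module R). w (r \<odot>\<^bsub>D 0\<^esub> e) = \<zero>\<^bsub>T\<^esub>"
      obtain t where t: "t \<in> carrier (tensor R (G 0) M)" "\<And>h. h \<in> carrier (D 0) \<Longrightarrow> w h = tensor_left R M (G 0) C h t"
        by (rule dual_hom_is_tensor[OF w]) (rule that)
      have "w (\<one>\<^bsub>R\<^esub> \<odot>\<^bsub>D 0\<^esub> e) = \<zero>\<^bsub>T\<^esub>" using we T.one_closed by simp
      hence "tensor_left R M (G 0) C \<epsilon> t = \<zero>\<^bsub>T\<^esub>"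
        using t(2)[OF e_closed] module.smult_one[OF module_D e_closed] e_left[OF t(1)] by simp
      then obtain t' where t': "t' \<in> carrier (tensor R (G (Suc 0)) M)"
        "t = tensor_left R M (G (Suc 0)) (G 0) (d 0) t'"
        using tensor_right_exact[OF module_G M module_G C d_hom \<epsilon>_hom \<epsilon>_surj _ t(1)] \<epsilon>_ker by blast
      have "w h = tensor_left R M (G (Suc 0)) C (\<delta> 0 h) t'" if "h \<in> carrier (D 0)" for h
        using t(2)[OF that] \<delta>_left[OF that t'(1)] t'(2) by simp
      thus "\<exists>v\<in>mod_hom R (D (Suc 0)) T. \<forall>h\<in>carrier (D 0). w h = v (\<delta> 0 h)"
        by (intro bexI[OF _ ev[OF t'(1)]] ballI)
    qed
  next
    fix n
    show "hom_exact R (D n) (\<delta> n) (D (Suc n)) (\<delta> (Suc n)) (D (Suc (Suc n))) T"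
      unfolding hom_exact_def
    proof (intro ballI impI)
      fix w assume w: "w \<in> mod_hom R (D (Suc n)) T" and w\<delta>: "\<forall>h\<in>carrier (D n). w (\<delta> n h) = \<zero>\<^bsub>T\<^esub>"
      obtain t where t: "t \<in> carrier (tensor R (G (Suc n)) M)"
        "\<And>h. h \<in> carrier (D (Suc n)) \<Longrightarrow> w h = tensor_left R M (G (Suc n)) C h t"
        by (rule dual_hom_is_tensor[OF w]) (rule that)
      have "tensor_left R M (G (Suc n)) (G n) (d n) t = \<zero>\<^bsub>tensor R (G n) M\<^esub>"
        by (rule tensor_eq_zeroI[OF mod_hom_closed[OF tensor_left_hom[OF module_G M module_G d_hom] t(1)]])
          (use w\<delta> t(2)[OF mod_hom_closed[OF \<delta>_hom]] \<delta>_left[OF _ t(1)] in simp)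
      then obtain t' where t': "t' \<in> carrier (tensor R (G (Suc (Suc n))) M)"
        "t = tensor_left R M (G (Suc (Suc n))) (G (Suc n)) (d (Suc n)) t'"
        using tor[OF t(1)] by blast
      have "w h = tensor_left R M (G (Suc (Suc n))) C (\<delta> (Suc n) h) t'" if "h \<in> carrier (D (Suc n))" for h
        using t(2)[OF that] \<delta>_left[OF that t'(1)] t'(2) by simp
      thus "\<exists>v\<in>mod_hom R (D (Suc (Suc n))) T. \<forall>h\<in>carrier (D (Suc n)). w h = v (\<delta> (Suc n) h)"
        by (intro bexI[OF _ ev[OF t'(1)]] ballI)
    qed
  qed
qed

end

section \<open>Quasi-injective resolutions\<close>

lemma isomorphic_power_zero_iff:
  assumes "module R X" "module R L" "isomorphic R X (power_module L n)" "\<not> zero_module L"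
  shows "zero_module X \<longleftrightarrow> n = 0"
  using isomorphic_zero_module_iff[OF assms(1) module_power_module[OF assms(2)] assms(3)]
    zero_module_power_iff[OF assms(2)] assms(4) by simp

context auslander_situation
begin

text \<open>A dual exact module is generated by the images of maps from \<open>C\<close>, so it
  vanishes if all these maps do.\<close>

lemma Hom_zero_module_iff:
  assumes N: "module R N" and ex: "dual_exact N"
  shows "zero_module (Hom_module R C N) \<longleftrightarrow> zero_module N"
proof
  assume z: "zero_module (Hom_module R C N)"
  have gen: "f c \<in> {\<zero>\<^bsub>N\<^esub>}" if f: "f \<in> mod_hom R C N" and c: "c \<in> carrier C" for f c
  proof -
    have "restrict f (carrier C) = \<zero>\<^bsub>Hom_module R C N\<^esub>"
      using Hom_module_restrict[OF C f] z by (simp add: zero_module_def)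
    from fun_cong[OF this, of c] show ?thesis using c by (simp add: Hom_module_simps)
  qed
  have "carrier N \<subseteq> {\<zero>\<^bsub>N\<^esub>}"
    by (rule subsetI, rule dual_exact_generated[OF N ex submodule_zero[OF N]]) (rule gen)
  thus "zero_module N"
    using module_zero_closed[OF N] unfolding zero_module_def by blast
next
  assume z: "zero_module N"
  have "f = \<zero>\<^bsub>Hom_module R C N\<^esub>" if f: "f \<in> carrier (Hom_module R C N)" for f
  proof (rule Hom_module_eqI[OF f module_zero_closed[OF module_Hom_module[OF C N]]])
    fix c assume c: "c \<in> carrier C"
    have "f c \<in> carrier N" using f c by (auto simp: Hom_module_simps intro: mod_hom_closed)
    thus "f c = \<zero>\<^bsub>Hom_module R C N\<^esub> c" using z c by (simp add: zero_module_def Hom_module_simps)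
  qed
  thus "zero_module (Hom_module R C N)"
    using module_zero_closed[OF module_Hom_module[OF C N]]
    unfolding zero_module_def by blast
qed

lemma zero_module_T_iff: "zero_module T \<longleftrightarrow> zero_module M"
  using Hom_zero_module_iff[OF module_T dual_exact_T] isomorphic_zero_module_iff[OF M module_Hom_module[OF C module_T]] unit
  by (auto simp: isomorphic_def)

text \<open>The unit on powers: \<open>M^b \<rightarrow> Hom(C, T)^b = Hom(C, T^b)\<close>.\<close>

definition \<tau> :: "nat \<Rightarrow> (nat \<Rightarrow> 'm) \<Rightarrow> 'c \<Rightarrow> nat \<Rightarrow> ('c \<times> 'm \<Rightarrow> 'a) set" where
  "\<tau> b m = (\<lambda>c\<in>carrier C. \<lambda>j\<in>{..<b}. pure_tensor R C M c (m j))"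

lemma \<tau>_iso: "\<tau> b \<in> mod_iso R (power_module M b) (Hom_module R C (power_module T b))"
proof -
  note Tb = module_power_module[OF module_T, of b]
  have mc: "m j \<in> carrier M" if "m \<in> carrier (power_module M b)" "j < b" for m j
    using that by (auto simp: power_module_simps)
  have cl: "\<tau> b m \<in> carrier (Hom_module R C (power_module T b))" if m: "m \<in> carrier (power_module M b)" for m
    unfolding \<tau>_def
  proof (rule Hom_module_restrict[OF C power_hom_intro])
    fix j assume "j < b"
    hence j: "m j \<in> carrier M" by (rule mc[OF m])
    show "(\<lambda>c. pure_tensor R C M c (m j)) \<in> mod_hom R C T"
      by (rule mod_homI) (use j in \<open>auto simp: pure_tensor_closed[OF C M] pure_tensor_add_left[OF C M]
        pure_tensor_smult_left[OF C M]\<close>)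
  qed
  have hom: "\<tau> b \<in> mod_hom R (power_module M b) (Hom_module R C (power_module T b))"
    by (rule mod_homI[OF cl])
      (auto simp: \<tau>_def Hom_module_simps(3,4) power_module_simps(3,4) fun_eq_iff mc
        pure_tensor_add_right[OF C M] pure_tensor_smult_right[OF C M])
  have "inj_on (\<tau> b) (carrier (power_module M b))"
  proof (rule inj_onI)
    fix m m' assume m: "m \<in> carrier (power_module M b)" "m' \<in> carrier (power_module M b)" and eq: "\<tau> b m = \<tau> b m'"
    show "m = m'"
    proof (rule extensionalityI[where A = "{..<b}"])
      fix j assume "j \<in> {..<b}"
      hence j: "j < b" by simp
      show "m j = m' j"
      proof (rule unit_inj[OF mc[OF m(1) j] mc[OF m(2) j]])
        fix c assume "c \<in> carrier C"
        thus "pure_tensor R C M c (m j) = pure_tensor R C M c (m' j)"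
          using fun_cong[OF fun_cong[OF eq], of c j] j by (simp add: \<tau>_def)
      qed
    qed (use m in \<open>auto simp: power_module_simps PiE_iff\<close>)
  qed
  moreover have "f \<in> \<tau> b ` carrier (power_module M b)" if f: "f \<in> carrier (Hom_module R C (power_module T b))" for f
  proof -
    have fh: "f \<in> mod_hom R C (power_module T b)" using f by (simp add: Hom_module_simps)
    have "\<forall>j<b. \<exists>m. m \<in> carrier M \<and> (\<forall>c\<in>carrier C. f c j = pure_tensor R C M c m)"
      using unit_surj[OF power_hom_component[OF fh]] by metis
    then obtain m where m: "\<And>j. j < b \<Longrightarrow> m j \<in> carrier M"
      "\<And>j c. j < b \<Longrightarrow> c \<in> carrier C \<Longrightarrow> f c j = pure_tensor R C M c (m j)" by metis
    have m': "restrict m {..<b} \<in> carrier (power_module M b)" using m(1) by (simp add: power_module_simps)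
    have "f = \<tau> b (restrict m {..<b})"
    proof (rule Hom_module_eqI[OF f cl[OF m']])
      fix c assume c: "c \<in> carrier C"
      have "f c \<in> carrier (power_module T b)" by (rule mod_hom_closed[OF fh c])
      thus "f c = \<tau> b (restrict m {..<b}) c"
        using c m(2) by (intro extensionalityI[where A = "{..<b}"]) (auto simp: \<tau>_def power_module_simps PiE_iff)
    qed
    thus ?thesis using m' by blast
  qed
  ultimately show ?thesis using hom mod_hom_closed[OF hom] by (auto simp: mod_iso_def bij_betw_def)
qed

section \<open>A complex of injectives \<open>I\<close> and its image \<open>J\<close> under
  \<open>Hom(C, -)\<close>\<close>

context
  fixes I :: "('a, 'i) cpx"
  assumes inj: "injective_cpx R I"
begin

lemma cpx: "is_complex R I" using inj by (simp add: injective_cpx_def)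
lemma injective_obj: "injective_module R (obj I i)" using inj by (simp add: injective_cpx_def)

abbreviation (input) "Z \<equiv> cycle_module I"
abbreviation (input) "B \<equiv> boundary_module I"
abbreviation (input) "J \<equiv> Hom_cpx R C I"

lemmas cpx_module = is_complexD(1)[OF cpx] and Z_module = module_cycle_module[OF cpx]
  and B_facts = boundary_module[OF cpx] and J_complex = is_complex_Hom_cpx[OF C cpx]

lemma cycle_module_eq: "(obj I i)\<lparr>carrier := cycles I i\<rparr> = Z i" "carrier (Z i) = cycles I i"
  by (simp_all add: cycle_module_def)

lemma boundary_module_eq: "(Z i)\<lparr>carrier := boundaries I i\<rparr> = B i" "carrier (B i) = boundaries I i"
  by (simp_all add: boundary_module_def)

lemma zero_obj_imp_zero_cycles:
  assumes "zero_module (obj I i)"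
  shows "zero_module (Z i)"
  using assms submodule_subset[OF submodule_cycles[OF cpx, of i]] submodule_zero_mem[OF submodule_cycles[OF cpx, of i]]
  unfolding zero_module_def by (auto simp: cycle_module_def)

lemma hom_into_boundary:
  assumes "f \<in> mod_hom R C (Z i)" "\<And>c. c \<in> carrier C \<Longrightarrow> f c \<in> boundaries I i"
  shows "f \<in> mod_hom R C (B i)"
  using mod_hom_into_sub[OF assms] by (simp add: boundary_module_def)

text \<open>Describes the homology of \<open>J\<close> inside \<open>I\<close>: it is
  \<open>Hom(C, Z i)\<close> modulo the maps that lift through the differential.\<close>

lemma J_homology_iff:
  assumes P: "module R P"
  shows "isomorphic R (homology J i) P \<longleftrightarrow>
    (\<exists>q\<in>mod_hom R (Hom_module R C (Z i)) P. q ` carrier (Hom_module R C (Z i)) = carrier P \<and>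
       (\<forall>f\<in>carrier (Hom_module R C (Z i)). q f = \<zero>\<^bsub>P\<^esub> \<longleftrightarrow>
          (\<exists>g\<in>mod_hom R C (obj I (i + 1)). \<forall>c\<in>carrier C. f c = diff I (i + 1) (g c))))"
proof -
  have c: "cycles J i = carrier (Hom_module R C (Z i))"
    unfolding cycle_module_Hom_cpx[OF cpx, symmetric] by (simp add: cycle_module_def)
  have "f \<in> boundaries J i \<longleftrightarrow> (\<exists>g\<in>mod_hom R C (obj I (i + 1)). \<forall>c\<in>carrier C. f c = diff I (i + 1) (g c))"
    if "f \<in> carrier (Hom_module R C (Z i))" for f
  proof (rule boundaries_Hom_cpx_iff[OF C])
    show "f \<in> carrier (Hom_module R C (obj I i))"
      using that submodule_subset[OF submodule_cycles[OF cpx, of i]]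
      by (auto simp: Hom_module_simps cycle_module_def intro: mod_hom_from_into_sub)
  qed
  thus ?thesis
    unfolding homology_iso_iff[OF J_complex P] cycle_module_Hom_cpx[OF cpx] c by (auto cong: ball_cong)
qed

text \<open>The given isomorphism amounts to a surjection
  \<open>q: Hom(C, Z i) \<rightarrow> M^b\<close>. Composed with \<open>\<tau> b\<close> it is
  induced by a map \<open>p: Z i \<rightarrow> T^b\<close>, as \<open>Z i\<close> is dual exact.
  This \<open>p\<close> is onto because \<open>T^b\<close> is generated by maps from
  \<open>C\<close>, which all lift. Its kernel is dual exact and turns out to be \<open>B i\<close>,
  which carries the induction to \<open>Z (i + 1)\<close>.\<close>

lemma homology_dual_step:
  assumes Z: "dual_exact (Z i)" and iso: "isomorphic R (homology J i) (power_module M b)"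
  shows "isomorphic R (homology I i) (power_module T b) \<and> dual_exact (Z (i + 1))"
proof -
  let ?Tb = "power_module T b" and ?Mb = "power_module M b"
  note mTb = module_power_module[OF module_T, of b] and mMb = module_power_module[OF M, of b]
  let ?H = "Hom_module R C (Z i)"
  obtain q where q0: "q \<in> mod_hom R ?H ?Mb" "q ` carrier ?H = carrier ?Mb \<and>
    (\<forall>f\<in>carrier ?H. q f = \<zero>\<^bsub>?Mb\<^esub> \<longleftrightarrow>
       (\<exists>g\<in>mod_hom R C (obj I (i + 1)). \<forall>c\<in>carrier C. f c = diff I (i + 1) (g c)))"
    using iso[unfolded J_homology_iff[OF mMb]] by (rule bexE)
  note q = q0(1) conjunct1[OF q0(2)] bspec[OF conjunct2[OF q0(2)]]
  have \<tau>h: "\<tau> b \<in> mod_hom R ?Mb (Hom_module R C ?Tb)" and \<tau>b: "bij_betw (\<tau> b) (carrier ?Mb) (carrier (Hom_module R C ?Tb))"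
    using \<tau>_iso by (auto simp: mod_iso_def)
  note mHT = module_Hom_module[OF C mTb]
  obtain p where p: "p \<in> mod_hom R (Z i) ?Tb"
    "\<And>f c. f \<in> carrier ?H \<Longrightarrow> c \<in> carrier C \<Longrightarrow> p (f c) = \<tau> b (q f) c"
    by (rule dual_exact_induced[OF Z_module Z mTb mod_hom_comp[OF q(1) \<tau>h]]) (assumption | rule that)+
  have q_zero: "q f = \<zero>\<^bsub>?Mb\<^esub>" if f: "f \<in> carrier ?H" and pf: "\<And>c. c \<in> carrier C \<Longrightarrow> p (f c) = \<zero>\<^bsub>?Tb\<^esub>" for f
  proof -
    note qf = mod_hom_closed[OF q(1) f]
    have "\<tau> b (q f) = \<zero>\<^bsub>Hom_module R C ?Tb\<^esub>"
      by (rule Hom_module_eqI[OF mod_hom_closed[OF \<tau>h qf] module_zero_closed[OF mHT]])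
        (use p(2)[OF f] pf in \<open>simp add: Hom_module_simps\<close>)
    hence "\<tau> b (q f) = \<tau> b \<zero>\<^bsub>?Mb\<^esub>" using mod_hom_zero[OF mMb mHT \<tau>h] by simp
    thus ?thesis
      using \<tau>b qf module_zero_closed[OF mMb] by (auto simp: bij_betw_def inj_on_def)
  qed
  have lifts: "hom_lifts R C (Z i) p ?Tb"
    unfolding hom_lifts_def
  proof
    fix w assume w: "w \<in> mod_hom R C ?Tb"
    have "restrict w (carrier C) \<in> \<tau> b ` q ` carrier ?H"
      using Hom_module_restrict[OF C w] \<tau>b q(2) by (simp add: bij_betw_def)
    then obtain f where f: "f \<in> carrier ?H" "restrict w (carrier C) = \<tau> b (q f)" by blast
    have "p (f c) = w c" if "c \<in> carrier C" for c using p(2)[OF f(1) that] fun_cong[OF f(2), of c] that by simp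
    thus "\<exists>v\<in>mod_hom R C (Z i). \<forall>c\<in>carrier C. p (v c) = w c"
      using f(1) by (intro bexI[of _ f]) (auto simp: Hom_module_simps)
  qed
  have "t \<in> p ` carrier (Z i)" if t: "t \<in> carrier ?Tb" for t
  proof (rule dual_exact_generated[OF mTb dual_exact_power[OF dual_exact_T] submodule_image[OF Z_module mTb p(1)] _ t])
    fix w c assume w: "w \<in> mod_hom R C ?Tb" and c: "c \<in> carrier C"
    obtain v where v: "v \<in> mod_hom R C (Z i)" "\<And>c. c \<in> carrier C \<Longrightarrow> p (v c) = w c"
      by (rule hom_liftsD[OF lifts w]) (assumption | rule that)+
    show "w c \<in> p ` carrier (Z i)" using v(2)[OF c, symmetric] mod_hom_closed[OF v(1) c] by blast
  qed
  hence surj: "p ` cycles I i = carrier ?Tb" using mod_hom_closed[OF p(1)] by (auto simp: cycle_module_eq)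
  let ?K = "{x \<in> carrier (Z i). p x = \<zero>\<^bsub>?Tb\<^esub>}"
  note K = submodule_kernel[OF Z_module mTb p(1)]
  have KZ: "?K \<subseteq> carrier (Z i)" by blast
  have K_ex: "dual_exact ((Z i)\<lparr>carrier := ?K\<rparr>)"
    by (rule dual_exact_kernel[OF Z_module mTb p(1) refl Z dual_exact_power[OF dual_exact_T] lifts])
  note K_module = submodule_module[OF K Z_module]
  have lift_boundary: "\<exists>g\<in>mod_hom R C (obj I (i + 1)). \<forall>c\<in>carrier C. f c = diff I (i + 1) (g c)"
    if f: "f \<in> mod_hom R C (Z i)" and pf: "\<And>c. c \<in> carrier C \<Longrightarrow> p (f c) = \<zero>\<^bsub>?Tb\<^esub>" for f
  proof -
    have f': "restrict f (carrier C) \<in> carrier ?H" by (rule Hom_module_restrict[OF C f])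
    have "q (restrict f (carrier C)) = \<zero>\<^bsub>?Mb\<^esub>" by (rule q_zero[OF f']) (simp add: pf)
    thus ?thesis using q(3)[OF f'] by simp
  qed
  \<comment> \<open>The kernel of \<open>p\<close> is dual exact, hence generated by the images of
    maps \<open>f\<close> from \<open>C\<close>. For these, \<open>p \<circ> f = 0\<close> forces
    \<open>q f = 0\<close>, so \<open>f\<close> lifts through the differential.\<close>
  have KB: "x \<in> boundaries I i" if x: "x \<in> ?K" for x
  proof -
    have sB: "submodule {y \<in> carrier ((Z i)\<lparr>carrier := ?K\<rparr>). y \<in> boundaries I i} R ((Z i)\<lparr>carrier := ?K\<rparr>)"
      by (rule submodule_preimage[OF K_module Z_module mod_hom_restrict_dom[OF mod_hom_id KZ] submodule_boundaries[OF cpx]])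
    have "x \<in> {y \<in> carrier ((Z i)\<lparr>carrier := ?K\<rparr>). y \<in> boundaries I i}"
    proof (rule dual_exact_generated[OF K_module K_ex sB])
      fix f c assume f: "f \<in> mod_hom R C ((Z i)\<lparr>carrier := ?K\<rparr>)" and c: "c \<in> carrier C"
      have fK: "f c \<in> ?K" if "c \<in> carrier C" for c using mod_hom_closed[OF f that] by simp
      obtain g where g: "g \<in> mod_hom R C (obj I (i + 1))" "\<And>c. c \<in> carrier C \<Longrightarrow> f c = diff I (i + 1) (g c)"
        using lift_boundary[OF mod_hom_from_into_sub[OF f KZ]] fK by blast
      have "f c \<in> boundaries I i" unfolding boundaries_def using g(2)[OF c] mod_hom_closed[OF g(1) c] by simp
      thus "f c \<in> {y \<in> carrier ((Z i)\<lparr>carrier := ?K\<rparr>). y \<in> boundaries I i}" using fK[OF c] by simp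
    qed (use x in simp)
    thus ?thesis by simp
  qed
  have dZ: "diff I (i + 1) \<in> mod_hom R (obj I (i + 1)) (Z i)"
    unfolding cycle_module_def using boundaries_subset_cycles[OF cpx, of i]
    by (intro mod_hom_into_sub[OF is_complexD(3)[OF cpx]]) (auto simp: boundaries_def)
  \<comment> \<open>The injective module in degree \<open>i + 1\<close> is dual exact too, so it is
    enough to test images of maps \<open>g\<close> from \<open>C\<close>. Composing \<open>g\<close>
    with the differential gives a boundary of \<open>J\<close>, where \<open>q\<close>
    vanishes.\<close>
  have BK: "x \<in> ?K" if x: "x \<in> boundaries I i" for x
  proof -
    obtain y where y: "y \<in> carrier (obj I (i + 1))" "x = diff I (i + 1) y" using x by (auto simp: boundaries_def)
    have "y \<in> {y \<in> carrier (obj I (i + 1)). p (diff I (i + 1) y) = \<zero>\<^bsub>?Tb\<^esub>}"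
    proof (rule dual_exact_generated[OF cpx_module dual_exact_injective[OF injective_obj]
          submodule_kernel[OF cpx_module mTb mod_hom_comp[OF dZ p(1)]] _ y(1)])
      fix g c assume g: "g \<in> mod_hom R C (obj I (i + 1))" and c: "c \<in> carrier C"
      let ?f = "restrict (\<lambda>c. diff I (i + 1) (g c)) (carrier C)"
      have f: "?f \<in> carrier ?H" by (rule Hom_module_restrict[OF C mod_hom_comp[OF g dZ]])
      have "q ?f = \<zero>\<^bsub>?Mb\<^esub>" unfolding q(3)[OF f] by (rule bexI[OF _ g]) simp
      hence "p (?f c) = \<zero>\<^bsub>Hom_module R C ?Tb\<^esub> c"
        using p(2)[OF f c] mod_hom_zero[OF mMb mHT \<tau>h] by simp
      hence "p (diff I (i + 1) (g c)) = \<zero>\<^bsub>?Tb\<^esub>" using c by (simp add: Hom_module_simps)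
      thus "g c \<in> {y \<in> carrier (obj I (i + 1)). p (diff I (i + 1) y) = \<zero>\<^bsub>?Tb\<^esub>}"
        using mod_hom_closed[OF g c] by simp
    qed
    thus ?thesis using y mod_hom_closed[OF dZ y(1)] by simp
  qed
  have K_eq: "?K = boundaries I i" using KB BK by blast
  have "isomorphic R (homology I i) ?Tb"
    unfolding homology_iso_iff[OF cpx mTb]
    using p(1) surj K_eq by (intro bexI[of _ p]) (auto simp: cycle_module_eq)
  \<comment> \<open>\<open>B i\<close>, being the kernel of \<open>p\<close>, is dual exact, and
    maps from \<open>C\<close> to it lift through the differential because \<open>q\<close> vanishes
    on them; \<open>Z (i + 1)\<close> is the kernel of the differential onto
    \<open>B i\<close>.\<close>
  moreover have "dual_exact (Z (i + 1))"
    unfolding cycle_module_eq(1)[symmetric]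
  proof (rule dual_exact_kernel[OF cpx_module B_facts(1,2,4) dual_exact_injective[OF injective_obj]])
    show "dual_exact (B i)" using K_ex unfolding K_eq boundary_module_eq .
    show "hom_lifts R C (obj I (i + 1)) (diff I (i + 1)) (B i)"
      unfolding hom_lifts_def
    proof
      fix w assume w: "w \<in> mod_hom R C (B i)"
      have wB: "w c \<in> boundaries I i" if "c \<in> carrier C" for c
        using mod_hom_closed[OF w that] by (simp add: boundary_module_eq)
      have "w \<in> mod_hom R C (Z i)"
        using mod_hom_from_into_sub[OF w[folded boundary_module_eq(1)] submodule_subset[OF submodule_boundaries[OF cpx]]] .
      moreover have "p (w c) = \<zero>\<^bsub>?Tb\<^esub>" if "c \<in> carrier C" for c using BK[OF wB[OF that]] by simp
      ultimately obtain g where "g \<in> mod_hom R C (obj I (i + 1))" "\<And>c. c \<in> carrier C \<Longrightarrow> w c = diff I (i + 1) (g c)"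
        using lift_boundary by blast
      thus "\<exists>v\<in>mod_hom R C (obj I (i + 1)). \<forall>x\<in>carrier C. diff I (i + 1) (v x) = w x"
        by (intro bexI[of _ g]) auto
    qed
  qed
  ultimately show ?thesis by blast
qed

lemma homology_from_dual:
  assumes below: "bounded_below I" and iso: "\<And>i. isomorphic R (homology J i) (power_module M (b i))"
  shows "isomorphic R (homology I i) (power_module T (b i))"
proof -
  obtain n where n: "\<And>i. i < n \<Longrightarrow> zero_module (obj I i)" using below by (auto simp: bounded_below_def)
  have low: "dual_exact (Z i)" if "i < n" for i
    by (rule dual_exact_zero_module[OF Z_module zero_obj_imp_zero_cycles[OF n[OF that]]])
  \<comment> \<open>The induction starts at degree \<open>n - 1\<close>, where the object is zero
    and its cycles are dual exact for trivial reasons.\<close>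
  have "dual_exact (Z (n - 1 + int k))" for k
  proof (induction k)
    case 0 thus ?case by (simp add: low)
  next
    case (Suc k)
    have "n - 1 + int (Suc k) = n - 1 + int k + 1" by simp
    thus ?case using homology_dual_step[OF Suc iso] by simp
  qed
  from this[of "nat (i - (n - 1))"] low[of i] have "dual_exact (Z i)" by (cases "i < n") auto
  thus ?thesis using homology_dual_step iso by blast
qed

text \<open>Once all cycles and boundaries are free of higher Ext, maps from \<open>C\<close> lift
  along \<open>I_(i+1) \<rightarrow> B i\<close> and along \<open>Z i \<rightarrow> T^b\<close>.
  Therefore \<open>Hom(C, Z i) \<rightarrow> Hom(C, T^b) = M^b\<close> is onto and its kernel
  consists of the maps that lift through the differential.\<close>

lemma homology_to_dual:
  assumes above: "bounded_above I" and iso: "\<And>i. isomorphic R (homology I i) (power_module T (b i))"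
  shows "isomorphic R (homology J i) (power_module M (b i))"
proof -
  have "\<exists>p. p \<in> mod_hom R (Z i) (power_module T (b i)) \<and> p ` cycles I i = carrier (power_module T (b i)) \<and>
      (\<forall>x\<in>cycles I i. p x = \<zero>\<^bsub>power_module T (b i)\<^esub> \<longleftrightarrow> x \<in> boundaries I i)" for i
    using iso[of i] unfolding homology_iso_iff[OF cpx module_power_module[OF module_T]] by blast
  then obtain p where p: "\<And>i. p i \<in> mod_hom R (Z i) (power_module T (b i))"
    "\<And>i. p i ` carrier (Z i) = carrier (power_module T (b i))"
    "\<And>i x. x \<in> carrier (Z i) \<Longrightarrow> p i x = \<zero>\<^bsub>power_module T (b i)\<^esub> \<longleftrightarrow> x \<in> boundaries I i"
    unfolding cycle_module_eq by metis
  note mTb = module_power_module[OF module_T]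
  have K: "boundaries I i = {x \<in> carrier (Z i). p i x = \<zero>\<^bsub>power_module T (b i)\<^esub>}" for i
    using p(3)[of _ i] boundaries_subset_cycles[OF cpx, of i] by (auto simp: cycle_module_eq)
  \<comment> \<open>\<open>B i\<close> is the quotient of an injective module by
    \<open>Z (i + 1)\<close>, and \<open>Z i\<close> is an extension of a power of \<open>T\<close>
    by \<open>B i\<close>; so acyclicity descends by one degree.\<close>
  have B_acyclic: "ext_acyclic (B i)" if "ext_acyclic (Z (i + 1))" for i
    by (rule ext_acyclic_cokernel[OF cpx_module B_facts _ ext_acyclic_injective[OF injective_obj]])
      (use that in \<open>simp add: cycle_module_eq\<close>)
  have step: "ext_acyclic (Z i)" if "ext_acyclic (Z (i + 1))" for i
    by (rule ext_acyclic_extension[OF Z_module mTb p(1,2) K _ ext_acyclic_power[OF ext_acyclic_T]])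
      (use B_acyclic[OF that] in \<open>simp add: boundary_module_eq\<close>)
  obtain n where n: "\<And>i. i > n \<Longrightarrow> zero_module (obj I i)" using above by (auto simp: bounded_above_def)
  have high: "ext_acyclic (Z i)" if "i > n" for i
    by (rule ext_acyclic_zero_module[OF Z_module zero_obj_imp_zero_cycles[OF n[OF that]]])
  have down: "ext_acyclic (Z (n + 1 - int k))" for k
  proof (induction k)
    case 0 thus ?case by (simp add: high)
  next
    case (Suc k)
    have "n + 1 - int (Suc k) + 1 = n + 1 - int k" by simp
    thus ?case using step Suc by metis
  qed
  have Z_acyclic: "ext_acyclic (Z i)" for i
    using down[of "nat (n + 1 - i)"] high[of i] by (cases "i > n") auto
  have lift_B: "hom_lifts R C (obj I (i + 1)) (diff I (i + 1)) (B i)"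
    by (rule ext_acyclic_lifts[OF cpx_module B_facts]) (use Z_acyclic in \<open>simp add: cycle_module_eq\<close>)
  have lift_T: "hom_lifts R C (Z i) (p i) (power_module T (b i))"
    by (rule ext_acyclic_lifts[OF Z_module mTb p(1,2) K])
      (use B_acyclic[OF Z_acyclic] in \<open>simp add: boundary_module_eq\<close>)
  let ?H = "Hom_module R C (Z i)" and ?Tb = "power_module T (b i)" and ?Mb = "power_module M (b i)"
  note mMb = module_power_module[OF M, of "b i"] and mHT = module_Hom_module[OF C mTb, of "b i"]
  \<comment> \<open>The inverse of \<open>\<tau> (b i)\<close>. Composing it with \<open>P\<close>,
    which is \<open>Hom(C, p i)\<close>, gives the surjection onto \<open>M^b\<close> demanded by
    \<open>J_homology_iff\<close>.\<close>
  obtain \<sigma> where \<sigma>: "\<sigma> \<in> mod_hom R (Hom_module R C ?Tb) ?Mb" "\<And>m. m \<in> carrier ?Mb \<Longrightarrow> \<sigma> (\<tau> (b i) m) = m"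
    "\<And>f. f \<in> carrier (Hom_module R C ?Tb) \<Longrightarrow> \<tau> (b i) (\<sigma> f) = f"
    by (rule mod_iso_inverse[OF mMb mHT \<tau>_iso]) (assumption | rule that)+
  have \<tau>h: "\<tau> (b i) \<in> mod_hom R ?Mb (Hom_module R C ?Tb)" using \<tau>_iso by (simp add: mod_iso_def)
  define P where "P f = restrict (\<lambda>c. p i (f c)) (carrier C)" for f
  have hom: "f \<in> mod_hom R C (Z i)" if "f \<in> carrier ?H" for f using that by (simp add: Hom_module_simps)
  have Ph: "P \<in> mod_hom R ?H (Hom_module R C ?Tb)"
  proof (rule mod_homI)
    fix f assume "f \<in> carrier ?H"
    thus "P f \<in> carrier (Hom_module R C ?Tb)"
      unfolding P_def by (intro Hom_module_restrict[OF C] mod_hom_comp[OF hom p(1)])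
  qed (auto simp: P_def Hom_module_simps(3,4) fun_eq_iff mod_hom_add[OF p(1)] mod_hom_smult[OF p(1)]
      mod_hom_closed[OF hom])
  note q = mod_hom_comp[OF Ph \<sigma>(1)]
  have "(\<lambda>f. \<sigma> (P f)) ` carrier ?H = carrier ?Mb"
  proof
    show "(\<lambda>f. \<sigma> (P f)) ` carrier ?H \<subseteq> carrier ?Mb" using mod_hom_closed[OF q] by blast
    show "carrier ?Mb \<subseteq> (\<lambda>f. \<sigma> (P f)) ` carrier ?H"
    proof
      fix m assume m: "m \<in> carrier ?Mb"
      note \<tau>m = mod_hom_closed[OF \<tau>h m]
      have "\<tau> (b i) m \<in> mod_hom R C ?Tb" using \<tau>m by (simp add: Hom_module_simps)
      then obtain f where f: "f \<in> mod_hom R C (Z i)" "\<And>c. c \<in> carrier C \<Longrightarrow> p i (f c) = \<tau> (b i) m c"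
        using hom_liftsD[OF lift_T] by metis
      note f' = Hom_module_restrict[OF C f(1)]
      have "P (restrict f (carrier C)) = \<tau> (b i) m"
        by (rule Hom_module_eqI[OF mod_hom_closed[OF Ph f'] \<tau>m]) (simp add: P_def f(2))
      hence "\<sigma> (P (restrict f (carrier C))) = m" using \<sigma>(2)[OF m] by simp
      thus "m \<in> (\<lambda>f. \<sigma> (P f)) ` carrier ?H" using f' by blast
    qed
  qed
  moreover have "\<sigma> (P f) = \<zero>\<^bsub>?Mb\<^esub> \<longleftrightarrow> (\<exists>g\<in>mod_hom R C (obj I (i + 1)). \<forall>c\<in>carrier C. f c = diff I (i + 1) (g c))"
    if f: "f \<in> carrier ?H" for f
  proof -
    note Pf = mod_hom_closed[OF Ph f]
    have "\<sigma> (P f) = \<zero>\<^bsub>?Mb\<^esub> \<longleftrightarrow> P f = \<zero>\<^bsub>Hom_module R C ?Tb\<^esub>"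
      using \<sigma>(3)[OF Pf] mod_hom_zero[OF mMb mHT \<tau>h] mod_hom_zero[OF mHT mMb \<sigma>(1)] by metis
    also have "\<dots> \<longleftrightarrow> (\<forall>c\<in>carrier C. p i (f c) = \<zero>\<^bsub>?Tb\<^esub>)"
      by (auto simp: P_def Hom_module_simps fun_eq_iff)
    also have "\<dots> \<longleftrightarrow> (\<forall>c\<in>carrier C. f c \<in> boundaries I i)"
      using p(3) mod_hom_closed[OF hom[OF f]] by simp
    \<comment> \<open>Being a boundary at each \<open>c\<close> is a pointwise condition;
      \<open>lift_B\<close> supplies one linear lift for all \<open>c\<close>.\<close>
    also have "\<dots> \<longleftrightarrow> (\<exists>g\<in>mod_hom R C (obj I (i + 1)). \<forall>c\<in>carrier C. f c = diff I (i + 1) (g c))"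
    proof
      assume "\<forall>c\<in>carrier C. f c \<in> boundaries I i"
      hence "f \<in> mod_hom R C (B i)" by (intro hom_into_boundary[OF hom[OF f]]) simp
      from hom_liftsD[OF lift_B this] obtain g where
        "g \<in> mod_hom R C (obj I (i + 1))" "\<And>c. c \<in> carrier C \<Longrightarrow> diff I (i + 1) (g c) = f c" by metis
      thus "\<exists>g\<in>mod_hom R C (obj I (i + 1)). \<forall>c\<in>carrier C. f c = diff I (i + 1) (g c)"
        by (intro bexI[of _ g]) auto
    next
      assume "\<exists>g\<in>mod_hom R C (obj I (i + 1)). \<forall>c\<in>carrier C. f c = diff I (i + 1) (g c)"
      thus "\<forall>c\<in>carrier C. f c \<in> boundaries I i" using mod_hom_closed by (fastforce simp: boundaries_def)
    qed
    finally show ?thesis .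
  qed
  ultimately show ?thesis unfolding J_homology_iff[OF mMb] using q by blast
qed

lemma all_homology_iff:
  assumes "bounded_cpx I"
  shows "(\<forall>i. isomorphic R (homology J i) (power_module M (b i))) \<longleftrightarrow>
     (\<forall>i. isomorphic R (homology I i) (power_module T (b i)))"
  using homology_to_dual[of b] homology_from_dual[of b] assms by (auto simp: bounded_cpx_def)

section \<open>The two notions of resolution for a bounded complex and nonzero
  \<open>M\<close>\<close>

context
  assumes bounded: "bounded_cpx I" and M_nonzero: "\<not> zero_module M"
begin

lemma T_nonzero: "\<not> zero_module T" using M_nonzero zero_module_T_iff by simp

lemma zero_imp_iso_power:
  assumes "module R X" "module R L" "zero_module X"
  shows "isomorphic R X (power_module L 0)"
  by (rule zero_module_imp_isomorphic[OF assms(1) module_power_module[OF assms(2)] assms(3)])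
    (simp add: zero_module_power_iff[OF assms(2)])

lemma zero_obj_above_sup:
  assumes "\<not> ereal (real_of_int i) \<le> cpx_sup I"
  shows "zero_module (obj I i)"
proof (rule ccontr)
  assume "\<not> zero_module (obj I i)"
  hence "ereal (real_of_int i) \<le> cpx_sup I" unfolding cpx_sup_def by (intro Sup_upper) blast
  thus False using assms by simp
qed

text \<open>A zero homology module is the power with exponent 0, so one function \<open>b\<close>
  covers both alternatives of the definition. As \<open>M\<close> is nonzero, a nonzero exponent
  means nonzero homology.\<close>

lemma C_qi_resolution_iff:
  "C_qi_resolution R C M I \<longleftrightarrow>
    (\<exists>b. (\<forall>i. isomorphic R (homology J i) (power_module M (b i))) \<and> (\<exists>i. b i \<noteq> 0))" (is "_ \<longleftrightarrow> ?r")
proof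
  note mH = module_homology[OF J_complex]
  assume c: "C_qi_resolution R C M I"
  have "\<exists>n. isomorphic R (homology J i) (power_module M n)" for i
    using c zero_imp_iso_power[OF mH M, of i] by (auto simp: C_qi_resolution_def)
  then obtain b where b: "\<And>i. isomorphic R (homology J i) (power_module M (b i))" by metis
  obtain i where "\<not> zero_module (homology J i)"
    using c by (auto simp: C_qi_resolution_def acyclic_cpx_def)
  hence "b i \<noteq> 0" using isomorphic_power_zero_iff[OF mH M b M_nonzero] by simp
  thus ?r using b by blast
next
  note mH = module_homology[OF J_complex]
  assume ?r
  then obtain b i where b: "\<And>i. isomorphic R (homology J i) (power_module M (b i))" "b i \<noteq> 0" by blast
  have "\<not> zero_module (homology J i)"
    using isomorphic_power_zero_iff[OF mH M b(1) M_nonzero] b(2) by simp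
  thus "C_qi_resolution R C M I"
    using inj bounded b(1) by (auto simp: C_qi_resolution_def acyclic_cpx_def)
qed

lemma qi_resolution_iff:
  "qi_resolution R T I \<longleftrightarrow>
    (\<exists>b. (\<forall>i. isomorphic R (homology I i) (power_module T (b i))) \<and> (\<exists>i. b i \<noteq> 0))" (is "_ \<longleftrightarrow> ?r")
proof
  note mH = module_homology[OF cpx]
  assume "qi_resolution R T I"
  then obtain b i where b: "ereal (real_of_int i) \<le> cpx_sup I" "b i \<noteq> (0 :: nat)"
    "\<And>i. ereal (real_of_int i) \<le> cpx_sup I \<Longrightarrow> isomorphic R (homology I i) (power_module T (b i))"
    by (auto simp: qi_resolution_def)
  \<comment> \<open>Above \<open>cpx_sup I\<close> the definition leaves the exponents free; the
    homology vanishes there, and the exponent 0 is the right one.\<close>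
  define b' where "b' i = (if ereal (real_of_int i) \<le> cpx_sup I then b i else 0)" for i
  have "isomorphic R (homology I i) (power_module T (b' i))" for i
    using b(3)[of i] zero_imp_iso_power[OF mH module_T zero_module_homology[OF cpx zero_obj_above_sup[of i]]]
    by (simp add: b'_def)
  moreover have "b' i \<noteq> 0" using b(1,2) by (simp add: b'_def)
  ultimately show ?r by blast
next
  note mH = module_homology[OF cpx]
  assume ?r
  then obtain b i where b: "\<And>i. isomorphic R (homology I i) (power_module T (b i))" "b i \<noteq> 0" by blast
  have "\<not> zero_module (homology I i)"
    using isomorphic_power_zero_iff[OF mH module_T b(1) T_nonzero] b(2) by simp
  hence "ereal (real_of_int i) \<le> cpx_sup I"
    using zero_module_homology[OF cpx zero_obj_above_sup[of i]] by blast
  thus "qi_resolution R T I"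
    using inj bounded b by (auto simp: qi_resolution_def bounded_cpx_def)
qed

lemma resolutions_agree: "C_qi_resolution R C M I \<longleftrightarrow> qi_resolution R T I"
  unfolding C_qi_resolution_iff qi_resolution_iff all_homology_iff[OF bounded] ..

text \<open>In each degree the homology of \<open>J\<close> and of \<open>I\<close> has the same
  exponent, and with nonzero \<open>M\<close> and \<open>T\<close> it vanishes exactly when this
  exponent is 0.\<close>

lemma dimensions_agree:
  assumes "C_qi_resolution R C M I"
  shows "cpx_hinf J = cpx_hinf I" "cpx_inf J = cpx_inf I"
proof -
  obtain b where b: "\<And>i. isomorphic R (homology J i) (power_module M (b i))"
    using assms unfolding C_qi_resolution_iff by blast
  hence b': "isomorphic R (homology I i) (power_module T (b i))" for i
    using all_homology_iff[OF bounded, of b] by blast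
  have "zero_module (homology J i) \<longleftrightarrow> zero_module (homology I i)" for i
    using isomorphic_power_zero_iff[OF module_homology[OF J_complex] M b M_nonzero]
      isomorphic_power_zero_iff[OF module_homology[OF cpx] module_T b' T_nonzero] by simp
  thus "cpx_hinf J = cpx_hinf I" by (simp add: cpx_hinf_def)
  have "zero_module (obj J i) \<longleftrightarrow> zero_module (obj I i)" for i
    using Hom_zero_module_iff[OF cpx_module dual_exact_injective[OF injective_obj]] by simp
  thus "cpx_inf J = cpx_inf I" by (simp only: cpx_inf_def)
qed

end

end

lemma qid_sets_agree:
  assumes "\<not> zero_module M"
  shows "{cpx_hinf (Hom_cpx R C I) - cpx_inf (Hom_cpx R C I) | I :: ('a, 'i) cpx. C_qi_resolution R C M I} =
    {cpx_hinf I - cpx_inf I | I :: ('a, 'i) cpx. qi_resolution R T I \<and> bounded_cpx I}"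
proof -
  have "C_qi_resolution R C M I \<longleftrightarrow> qi_resolution R T I \<and> bounded_cpx I" for I :: "('a, 'i) cpx"
  proof (cases "injective_cpx R I \<and> bounded_cpx I")
    case True thus ?thesis using resolutions_agree[OF _ _ assms] by blast
  qed (auto simp: C_qi_resolution_def qi_resolution_def)
  moreover have "cpx_hinf (Hom_cpx R C I) - cpx_inf (Hom_cpx R C I) = cpx_hinf I - cpx_inf I"
    if "C_qi_resolution R C M I" for I :: "('a, 'i) cpx"
    using dimensions_agree[OF _ _ assms that] that by (simp add: C_qi_resolution_def)
  ultimately show ?thesis by (metis (no_types, opaque_lifting))
qed

end

text \<open>The resolution behind Ext and Tor may have infinite bases, whose duals are not finite
  powers of \<open>C\<close>. The vanishing conditions are therefore transferred to a finite
  resolution by the comparison lemmas.\<close>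

lemma auslander_situation_exists:
  fixes R :: "('r, 'z) ring_scheme" and C :: "('r, 'c) module" and M :: "('r, 'm) module"
  assumes R: "cring R" and noeth: "noetherian_ring R" and sd: "semidualizing R C" and Ma: "M \<in> auslander_class R C"
  obtains S :: "nat \<Rightarrow> ('r + 'c) list set" and d \<epsilon> where "auslander_situation R C S d \<epsilon> M"
proof -
  have C: "module R C" and fg: "fin_gen R C"
    and hom: "homothety R C \<in> mod_iso R (ring_module R) (Hom_module R C C)"
    and extC: "\<And>n. zero_module (Ext R (Suc n) C C)"
    using sd by (auto simp: semidualizing_def)
  have M: "module R M" and unit: "tensor_unit R C M \<in> mod_iso R M (Hom_module R C (tensor R C M))"
    and tor: "\<And>n. zero_module (Tor R (Suc n) C M)"
    and extT: "\<And>n. zero_module (Ext R (Suc n) C (tensor R C M))"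
    using Ma by (auto simp: auslander_class_def)
  obtain S :: "nat \<Rightarrow> ('r + 'c) list set" and d \<epsilon> where res: "nat_resolution R C S d \<epsilon>" and fin: "\<And>n. finite (S n)"
    by (rule finite_nat_resolution_exists[OF R noeth C fg infinite_UNIV_listI]) (rule that)
  define F where "F = chosen_resolution R C"
  \<comment> \<open>The finite resolution lives over the very type of
    \<open>chosen_resolution\<close>, so it also witnesses that the choice there is not
    vacuous.\<close>
  have "\<exists>F \<epsilon>. free_resolution R C (F :: ('r, ('r + 'c) list \<Rightarrow> 'r) cpx) \<epsilon>"
    using nat_resolution_imp_free_resolution[OF R C res] by blast
  hence "\<exists>\<epsilon>. free_resolution R C F \<epsilon>"
    unfolding F_def chosen_resolution_def by (rule someI_ex)
  then obtain \<epsilon>' where F: "free_resolution R C F \<epsilon>'" by blast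
  hence Fc: "is_complex R F" by (simp add: free_resolution_def)
  obtain S' where S': "\<And>n. obj F (int n) = free_module R (S' n)"
    and res': "nat_resolution R C S' (\<lambda>n. diff F (int n + 1)) \<epsilon>'"
    by (rule free_resolution_imp_nat_resolution[OF F]) (rule that)
  have S1: "obj F (int n + 1) = free_module R (S' (Suc n))" for n
    using S'[of "Suc n"] by (simp add: add.commute)
  have S2: "obj F (int n + 2) = free_module R (S' (Suc (Suc n)))" for n
    using S'[of "Suc (Suc n)"] by (simp add: add.commute)
  have d2: "int (Suc n) + 1 = int n + 2" for n by simp
  note Tm = tensor_module[OF C M]
  show ?thesis
  proof (rule that[of S d \<epsilon>], intro auslander_situation.intro semidualizing_resolution.intro
      auslander_situation_axioms.intro)
    show "module R C" "fin_gen R C" "nat_resolution R C S d \<epsilon>"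
      "homothety R C \<in> mod_iso R (ring_module R) (Hom_module R C C)" "module R M"
      "tensor_unit R C M \<in> mod_iso R M (Hom_module R C (tensor R C M))"
      by fact+
    show "finite (S n)" for n by (rule fin)
    show "hom_exact R (free_module R (S (Suc (Suc n)))) (d (Suc n)) (free_module R (S (Suc n))) (d n)
      (free_module R (S n)) C" for n
      using hom_exact_change_resolution[OF R C res' res C]
        zero_Ext_imp_hom_exact[OF C C Fc extC[unfolded Ext_def, folded F_def], unfolded S' S1 S2, folded d2] .
    show "hom_exact R (free_module R (S (Suc (Suc n)))) (d (Suc n)) (free_module R (S (Suc n))) (d n)
      (free_module R (S n)) (tensor R C M)" for n
      using hom_exact_change_resolution[OF R C res' res Tm]
        zero_Ext_imp_hom_exact[OF Tm C Fc extT[unfolded Ext_def, folded F_def], unfolded S' S1 S2, folded d2] .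
    show "t \<in> tensor_left R M (free_module R (S (Suc (Suc n)))) (free_module R (S (Suc n))) (d (Suc n)) `
        carrier (tensor R (free_module R (S (Suc (Suc n)))) M)"
      if "t \<in> carrier (tensor R (free_module R (S (Suc n))) M)"
        "tensor_left R M (free_module R (S (Suc n))) (free_module R (S n)) (d n) t =
          \<zero>\<^bsub>tensor R (free_module R (S n)) M\<^esub>" for n t
      by (rule tensor_exact_change_resolution[OF R C res' res M _ that])
        (rule zero_Tor_imp_tensor_exact[OF M Fc tor[unfolded Tor_def, folded F_def], unfolded S' S1 S2, folded d2])
  qed
qed

theorem theorem4p16:
  fixes R :: "('r, 'z) ring_scheme" and C :: "('r, 'c) module" and M :: "('r, 'm) module"
  assumes "cring R" and "noetherian_ring R"
    and "semidualizing R C"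
    and "M \<in> auslander_class R C"
  shows "(C_qid TYPE('i) R C M < \<infinity> \<longleftrightarrow> qid TYPE('i) R (tensor R C M) < \<infinity>) \<and>
    C_qid TYPE('i) R C M = qid TYPE('i) R (tensor R C M) \<and>
    (\<not> zero_module M \<longrightarrow>
      (\<forall>I :: ('r, 'i) cpx. bounded_cpx I \<and> injective_cpx R I \<longrightarrow>
        (C_qi_resolution R C M I \<longleftrightarrow> qi_resolution R (tensor R C M) I)))"
proof -
  obtain S :: "nat \<Rightarrow> ('r + 'c) list set" and d \<epsilon> where st: "auslander_situation R C S d \<epsilon> M"
    by (rule auslander_situation_exists[OF assms]) (rule that)
  interpret auslander_situation R C S d \<epsilon> M by (rule st)
  \<comment> \<open>If \<open>M\<close> is zero then so is the tensor product, and both dimensions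
    are \<open>- \<infinity>\<close>; otherwise the two infima range over the same set.\<close>
  have "C_qid TYPE('i) R C M = qid TYPE('i) R (tensor R C M)"
    by (simp add: C_qid_def qid_def zero_module_T_iff qid_sets_agree)
  thus ?thesis by (simp add: resolutions_agree)
qed

end
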